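(* Let $\mathcal F$ be a saturated fusion system on a finite $p$-group $S$, and let $A(\mathcal F)_{(p)}$ be the $p$-localized Burnside ring of $\mathcal F$, regarded as a subring of the $p$-localized Burnside ring $A(S)_{(p)}$. For each $X\in A(S)_{(p)}$ there is a well-defined $\mathcal F$-stable element $\pi(X)\in A(\mathcal F)_{(p)}$ determined by the fixed point formula $$\Phi_Q(\pi(X))=\frac{1}{|[Q]_{\mathcal F}|}\sum_{Q'\in[Q]_{\mathcal F}}\Phi_{Q'}(X)\qquad\text{for all } Q\le S,$$ where $[Q]_{\mathcal F}$ is the $\mathcal F$-conjugacy class of $Q$. The resulting map $\pi\colon A(S)_{(p)}\to A(\mathcal F)_{(p)}$ is a homomorphism of $A(\mathcal F)_{(p)}$-modules and restricts to the identity on $A(\mathcal F)_{(p)}$.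
   Context: Here $p$ is a prime and $p$-groups are finite. A fusion system $\mathcal F$ on a $p$-group $S$ is a category whose objects are the subgroups of $S$, whose morphism sets $\mathcal F(P,Q)=\mathrm{Hom}_{\mathcal F}(P,Q)$ consist of injective group homomorphisms $P\to Q$ (composed as homomorphisms) and contain all homomorphisms $P\to Q$ induced by conjugation by elements of $S$, and such that for each $\varphi\in\mathcal F(P,Q)$ the isomorphism $\varphi\colon P\to\varphi P$ and its inverse are morphisms of $\mathcal F$. Write $\mathrm{Aut}_{\mathcal F}(P)=\mathcal F(P,P)$. Subgroups $P,Q$ are $\mathcal F$-conjugate ($P\sim_{\mathcal F}Q$) if they are isomorphic in $\mathcal F$; $[P]_{\mathcal F}$ is the set of $\mathcal F$-conjugates of $P$. $P$ is fully $\mathcal F$-normalized (resp. fully $\mathcal F$-centralized) if $|N_SP|\ge|N_SQ|$ (resp. $|C_SP|\ge|C_SQ|$) for all $Q\in[P]_{\mathcal F}$. $\mathcal F$ is saturated if for all $P\le S$: (1) if $P$ is fully $\mathcal F$-normalized, then $P$ is fully $\mathcal F$-centralized and $\mathrm{Aut}_S(P)$ is a Sylow $p$-subgroup of $\mathrm{Aut}_{\mathcal F}(P)$; (2) every $\varphi\in\mathcal F(P,S)$ with $\varphi(P)$ fully $\mathcal F$-centralized extends to a morphism in $\mathcal F(N_\varphi,S)$, where $N_\varphi=\{x\in N_S(P)\mid \exists y\in S:\varphi\circ c_x=c_y\circ\varphi\}$. $A(S)$ is the Burnside ring of $S$ (Grothendieck ring of isomorphism classes of finite $S$-sets under disjoint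 union and cartesian product), $\Phi_Q\colon A(S)\to\mathbb Z$ is the ring homomorphism with $\Phi_Q(X)=|X^Q|$ for $S$-sets $X$, and the subscript $(p)$ denotes tensoring with $\mathbb Z_{(p)}$; $\Phi_Q$ is extended to $A(S)_{(p)}\to\mathbb Z_{(p)}$. An element $X\in A(S)_{(p)}$ is $\mathcal F$-stable if for all $P\le S$ and $\varphi\in\mathcal F(P,S)$ the restrictions of $X$ to $A(P)_{(p)}$ along $\varphi$ and along the inclusion $P\le S$ agree; equivalently, $\Phi_P(X)=\Phi_Q(X)$ whenever $P\sim_{\mathcal F}Q$. $A(\mathcal F)_{(p)}$ is the subring of $\mathcal F$-stable elements of $A(S)_{(p)}$. *)

theory Defs
  imports Complex_Main "HOL-Library.Nat_Bijection" "HOL-Computational_Algebra.Primes"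
    "HOL-Algebra.Group_Action" "HOL-Algebra.Module"
begin

section \<open>Saturated fusion systems\<close>

text \<open>
  A fusion system on \<open>S\<close> is given by its morphism sets: \<open>F P Q\<close> is the set of morphisms from
  \<open>P\<close> to \<open>Q\<close>, represented as functions that are extensional on \<open>P\<close>.  Only the values of \<open>F\<close>
  at subgroups of \<open>S\<close> matter.
\<close>

type_synonym 'a homs = "'a set \<Rightarrow> 'a set \<Rightarrow> ('a \<Rightarrow> 'a) set"

definition conj_map :: "('a, 'b) monoid_scheme \<Rightarrow> 'a \<Rightarrow> 'a \<Rightarrow> 'a" where
  "conj_map S x g = x \<otimes>\<^bsub>S\<^esub> g \<otimes>\<^bsub>S\<^esub> inv\<^bsub>S\<^esub> x"

definition centralizer :: "('a, 'b) monoid_scheme \<Rightarrow> 'a set \<Rightarrow> 'a set" where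
  "centralizer S P = {x \<in> carrier S. \<forall>g\<in>P. x \<otimes>\<^bsub>S\<^esub> g = g \<otimes>\<^bsub>S\<^esub> x}"

locale finite_p_group = group G for G (structure) +
  fixes p :: nat
  assumes prime_p: "prime p"
    and finite_carrier: "finite (carrier G)"
    and order_prime_power: "\<exists>n. order G = p ^ n"

locale fusion_system = finite_p_group S p for S (structure) and p +
  fixes F :: "'a homs"
  assumes morphism: "\<lbrakk>subgroup P S; subgroup Q S; \<phi> \<in> F P Q\<rbrakk> \<Longrightarrow>
      \<phi> \<in> hom (S\<lparr>carrier := P\<rparr>) (S\<lparr>carrier := Q\<rparr>) \<and> inj_on \<phi> P \<and> \<phi> \<in> extensional P"
    and composition: "\<lbrakk>subgroup P S; subgroup Q S; subgroup R S; \<phi> \<in> F P Q; \<psi> \<in> F Q R\<rbrakk> \<Longrightarrow>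
      compose P \<psi> \<phi> \<in> F P R"
    and conjugation: "\<lbrakk>subgroup P S; subgroup Q S; x \<in> carrier S; conj_map S x ` P \<subseteq> Q\<rbrakk> \<Longrightarrow>
      restrict (conj_map S x) P \<in> F P Q"
    and onto_image: "\<lbrakk>subgroup P S; subgroup Q S; \<phi> \<in> F P Q\<rbrakk> \<Longrightarrow> \<phi> \<in> F P (\<phi> ` P)"
    and inverse: "\<lbrakk>subgroup P S; subgroup Q S; \<phi> \<in> F P Q\<rbrakk> \<Longrightarrow>
      restrict (inv_into P \<phi>) (\<phi> ` P) \<in> F (\<phi> ` P) P"

text \<open>Isomorphism in the category \<open>F\<close>.\<close>

definition F_conjugate :: "'a homs \<Rightarrow> 'a set \<Rightarrow> 'a set \<Rightarrow> bool" where
  "F_conjugate F P Q \<longleftrightarrow>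
    (\<exists>\<phi>\<in>F P Q. \<exists>\<psi>\<in>F Q P. compose P \<psi> \<phi> = (\<lambda>x\<in>P. x) \<and> compose Q \<phi> \<psi> = (\<lambda>x\<in>Q. x))"

definition F_class :: "('a, 'b) monoid_scheme \<Rightarrow> 'a homs \<Rightarrow> 'a set \<Rightarrow> 'a set set" where
  "F_class S F P = {Q. subgroup Q S \<and> F_conjugate F P Q}"

definition fully_normalized :: "('a, 'b) monoid_scheme \<Rightarrow> 'a homs \<Rightarrow> 'a set \<Rightarrow> bool" where
  "fully_normalized S F P \<longleftrightarrow>
    (\<forall>Q\<in>F_class S F P. card (normalizer S Q) \<le> card (normalizer S P))"

definition fully_centralized :: "('a, 'b) monoid_scheme \<Rightarrow> 'a homs \<Rightarrow> 'a set \<Rightarrow> bool" where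
  "fully_centralized S F P \<longleftrightarrow>
    (\<forall>Q\<in>F_class S F P. card (centralizer S Q) \<le> card (centralizer S P))"

definition Aut_F :: "'a homs \<Rightarrow> 'a set \<Rightarrow> ('a \<Rightarrow> 'a) monoid" where
  "Aut_F F P = BijGroup P\<lparr>carrier := F P P\<rparr>"

definition Aut_S :: "('a, 'b) monoid_scheme \<Rightarrow> 'a set \<Rightarrow> ('a \<Rightarrow> 'a) set" where
  "Aut_S S P = (\<lambda>x. restrict (conj_map S x) P) ` normalizer S P"

definition sylow_subgroup :: "nat \<Rightarrow> 'a set \<Rightarrow> ('a, 'b) monoid_scheme \<Rightarrow> bool" where
  "sylow_subgroup p H G \<longleftrightarrow> subgroup H G \<and> card H = p ^ multiplicity p (order G)"

definition N_phi :: "('a, 'b) monoid_scheme \<Rightarrow> 'a set \<Rightarrow> ('a \<Rightarrow> 'a) \<Rightarrow> 'a set" where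
  "N_phi S P \<phi> = {x \<in> normalizer S P.
    \<exists>y\<in>carrier S. \<forall>g\<in>P. \<phi> (conj_map S x g) = conj_map S y (\<phi> g)}"

locale saturated_fusion_system = fusion_system +
  assumes fully_normalized_imp: "\<lbrakk>subgroup P S; fully_normalized S F P\<rbrakk> \<Longrightarrow>
      fully_centralized S F P \<and> sylow_subgroup p (Aut_S S P) (Aut_F F P)"
    and extension: "\<lbrakk>subgroup P S; \<phi> \<in> F P (carrier S); fully_centralized S F (\<phi> ` P)\<rbrakk> \<Longrightarrow>
      \<exists>\<psi>\<in>F (N_phi S P \<phi>) (carrier S). \<forall>x\<in>P. \<psi> x = \<phi> x"


section \<open>Finite G-sets\<close>

text \<open>
  A finite \<open>G\<close>-set is a pair of a finite underlying set and an action.  Underlying sets are taken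
  to be sets of natural numbers, so that every finite \<open>G\<close>-set is represented up to isomorphism.
\<close>

type_synonym 'a gset = "nat set \<times> ('a \<Rightarrow> nat \<Rightarrow> nat)"

definition finite_gsets :: "('a, 'b) monoid_scheme \<Rightarrow> 'a gset set" where
  "finite_gsets G = {(E, act). finite E \<and> group_action G E act}"

definition gset_iso :: "('a, 'b) monoid_scheme \<Rightarrow> ('a gset \<times> 'a gset) set" where
  "gset_iso G = {((E, act), (E', act')).
    (E, act) \<in> finite_gsets G \<and> (E', act') \<in> finite_gsets G \<and>
    (\<exists>f. bij_betw f E E' \<and> (\<forall>g\<in>carrier G. \<forall>x\<in>E. f (act g x) = act' g (f x)))}"

fun gset_sum :: "'a gset \<Rightarrow> 'a gset \<Rightarrow> 'a gset" where
  "gset_sum (E, act) (E', act') =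
    (sum_encode ` (E <+> E'),
     \<lambda>g. \<lambda>n\<in>sum_encode ` (E <+> E'). sum_encode (map_sum (act g) (act' g) (sum_decode n)))"

fun gset_prod :: "'a gset \<Rightarrow> 'a gset \<Rightarrow> 'a gset" where
  "gset_prod (E, act) (E', act') =
    (prod_encode ` (E \<times> E'),
     \<lambda>g. \<lambda>n\<in>prod_encode ` (E \<times> E'). prod_encode (map_prod (act g) (act' g) (prod_decode n)))"

definition gset_empty :: "'a gset" where
  "gset_empty = ({}, \<lambda>g. \<lambda>x\<in>{}. x)"

definition gset_point :: "'a gset" where
  "gset_point = ({0}, \<lambda>g. \<lambda>x\<in>{0}. x)"

fun gset_restrict :: "('c \<Rightarrow> 'a) \<Rightarrow> 'a gset \<Rightarrow> 'c gset" where
  "gset_restrict \<phi> (E, act) = (E, \<lambda>g. act (\<phi> g))"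

fun fixed_points :: "'a set \<Rightarrow> 'a gset \<Rightarrow> nat set" where
  "fixed_points Q (E, act) = {x \<in> E. \<forall>g\<in>Q. act g x = x}"

text \<open>The commutative semiring of isomorphism classes of finite \<open>G\<close>-sets.\<close>

definition gset_semiring :: "('a, 'b) monoid_scheme \<Rightarrow> 'a gset set ring" where
  "gset_semiring G =
    \<lparr>carrier = finite_gsets G // gset_iso G,
     mult = \<lambda>A B. \<Union>X\<in>A. \<Union>Y\<in>B. gset_iso G `` {gset_prod X Y},
     monoid.one = gset_iso G `` {gset_point},
     ring.zero = gset_iso G `` {gset_empty},
     add = \<lambda>A B. \<Union>X\<in>A. \<Union>Y\<in>B. gset_iso G `` {gset_sum X Y}\<rparr>"


section \<open>Grothendieck ring and p-localization\<close>

text \<open>The Grothendieck ring of a commutative semiring; \<open>(a, b)\<close> stands for \<open>a - b\<close>.\<close>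

definition groth_rel :: "('a, 'm) ring_scheme \<Rightarrow> (('a \<times> 'a) \<times> ('a \<times> 'a)) set" where
  "groth_rel R = {((a, b), (c, d)).
    a \<in> carrier R \<and> b \<in> carrier R \<and> c \<in> carrier R \<and> d \<in> carrier R \<and>
    (\<exists>e\<in>carrier R. a \<oplus>\<^bsub>R\<^esub> d \<oplus>\<^bsub>R\<^esub> e = c \<oplus>\<^bsub>R\<^esub> b \<oplus>\<^bsub>R\<^esub> e)}"

definition grothendieck_ring :: "('a, 'm) ring_scheme \<Rightarrow> ('a \<times> 'a) set ring" where
  "grothendieck_ring R =
    \<lparr>carrier = (carrier R \<times> carrier R) // groth_rel R,
     mult = \<lambda>A B. \<Union>(a, b)\<in>A. \<Union>(c, d)\<in>B.
       groth_rel R `` {(a \<otimes>\<^bsub>R\<^esub> c \<oplus>\<^bsub>R\<^esub> b \<otimes>\<^bsub>R\<^esub> d, a \<otimes>\<^bsub>R\<^esub> d \<oplus>\<^bsub>R\<^esub> b \<otimes>\<^bsub>R\<^esub> c)},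
     monoid.one = groth_rel R `` {(\<one>\<^bsub>R\<^esub>, \<zero>\<^bsub>R\<^esub>)},
     ring.zero = groth_rel R `` {(\<zero>\<^bsub>R\<^esub>, \<zero>\<^bsub>R\<^esub>)},
     add = \<lambda>A B. \<Union>(a, b)\<in>A. \<Union>(c, d)\<in>B. groth_rel R `` {(a \<oplus>\<^bsub>R\<^esub> c, b \<oplus>\<^bsub>R\<^esub> d)}\<rparr>"

text \<open>
  \<open>p_localization p R\<close> is the tensor product of the commutative ring \<open>R\<close> with the ring of integers
  localized at \<open>p\<close>, as the ring of fractions \<open>a/m\<close> with \<open>a\<close> in \<open>R\<close> and \<open>m\<close> an integer
  prime to \<open>p\<close>.
\<close>

definition p_denominators :: "nat \<Rightarrow> int set" where
  "p_denominators p = {m. \<not> int p dvd m}"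

definition loc_rel :: "nat \<Rightarrow> ('a, 'm) ring_scheme \<Rightarrow> (('a \<times> int) \<times> ('a \<times> int)) set" where
  "loc_rel p R = {((a, m), (b, n)).
    a \<in> carrier R \<and> m \<in> p_denominators p \<and> b \<in> carrier R \<and> n \<in> p_denominators p \<and>
    (\<exists>k\<in>p_denominators p. add_pow R (k * n) a = add_pow R (k * m) b)}"

definition p_localization :: "nat \<Rightarrow> ('a, 'm) ring_scheme \<Rightarrow> ('a \<times> int) set ring" where
  "p_localization p R =
    \<lparr>carrier = (carrier R \<times> p_denominators p) // loc_rel p R,
     mult = \<lambda>A B. \<Union>(a, m)\<in>A. \<Union>(b, n)\<in>B. loc_rel p R `` {(a \<otimes>\<^bsub>R\<^esub> b, m * n)},
     monoid.one = loc_rel p R `` {(\<one>\<^bsub>R\<^esub>, 1)},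
     ring.zero = loc_rel p R `` {(\<zero>\<^bsub>R\<^esub>, 1)},
     add = \<lambda>A B. \<Union>(a, m)\<in>A. \<Union>(b, n)\<in>B.
       loc_rel p R `` {(add_pow R n a \<oplus>\<^bsub>R\<^esub> add_pow R m b, m * n)}\<rparr>"


section \<open>Burnside rings\<close>

type_synonym 'a burnside = "('a gset set \<times> 'a gset set) set"
type_synonym 'a burnside_p = "('a burnside \<times> int) set"

definition burnside_ring :: "('a, 'b) monoid_scheme \<Rightarrow> 'a burnside ring" where
  "burnside_ring G = grothendieck_ring (gset_semiring G)"

definition burnside_ring_p :: "nat \<Rightarrow> ('a, 'b) monoid_scheme \<Rightarrow> 'a burnside_p ring" where
  "burnside_ring_p p G = p_localization p (burnside_ring G)"

text \<open>
  The number of \<open>Q\<close>-fixed points, on isomorphism classes of finite \<open>G\<close>-sets and then extended to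
  the Burnside ring and to its localization (with values in the rationals, which contain the
  integers localized at \<open>p\<close>).  In each case the image is a singleton, since the value does not
  depend on the representative.
\<close>

definition mark_class :: "'a set \<Rightarrow> 'a gset set \<Rightarrow> int" where
  "mark_class Q A = the_elem ((\<lambda>X. int (card (fixed_points Q X))) ` A)"

definition mark :: "'a set \<Rightarrow> 'a burnside \<Rightarrow> int" where
  "mark Q X = the_elem ((\<lambda>(A, B). mark_class Q A - mark_class Q B) ` X)"

definition mark_p :: "'a set \<Rightarrow> 'a burnside_p \<Rightarrow> rat" where
  "mark_p Q X = the_elem ((\<lambda>(x, m). of_int (mark Q x) / of_int m) ` X)"

text \<open>
  Restriction along a homomorphism \<open>\<phi>\<close> from \<open>H\<close> to a group \<open>G\<close>: the maps from the semiring, the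
  Burnside ring and the localized Burnside ring of \<open>G\<close> to those of \<open>H\<close> induced by
  \<open>gset_restrict \<phi>\<close>.
\<close>

definition res_class :: "('c, 'd) monoid_scheme \<Rightarrow> ('c \<Rightarrow> 'a) \<Rightarrow> 'a gset set \<Rightarrow> 'c gset set" where
  "res_class H \<phi> A = (\<Union>X\<in>A. gset_iso H `` {gset_restrict \<phi> X})"

definition res :: "('c, 'd) monoid_scheme \<Rightarrow> ('c \<Rightarrow> 'a) \<Rightarrow> 'a burnside \<Rightarrow> 'c burnside" where
  "res H \<phi> X =
    (\<Union>(A, B)\<in>X. groth_rel (gset_semiring H) `` {(res_class H \<phi> A, res_class H \<phi> B)})"

definition res_p ::
  "nat \<Rightarrow> ('c, 'd) monoid_scheme \<Rightarrow> ('c \<Rightarrow> 'a) \<Rightarrow> 'a burnside_p \<Rightarrow> 'c burnside_p" where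
  "res_p p H \<phi> X = (\<Union>(x, m)\<in>X. loc_rel p (burnside_ring H) `` {(res H \<phi> x, m)})"

definition stable ::
  "('a, 'b) monoid_scheme \<Rightarrow> nat \<Rightarrow> 'a homs \<Rightarrow> 'a burnside_p \<Rightarrow> bool" where
  "stable S p F X \<longleftrightarrow> (\<forall>P. subgroup P S \<longrightarrow> (\<forall>\<phi>\<in>F P (carrier S).
    res_p p (S\<lparr>carrier := P\<rparr>) \<phi> X = res_p p (S\<lparr>carrier := P\<rparr>) (\<lambda>x. x) X))"

definition burnside_ring_F ::
  "('a, 'b) monoid_scheme \<Rightarrow> nat \<Rightarrow> 'a homs \<Rightarrow> 'a burnside_p ring" where
  "burnside_ring_F S p F =
    burnside_ring_p p S\<lparr>carrier := {X \<in> carrier (burnside_ring_p p S). stable S p F X}\<rparr>"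


section \<open>Module homomorphisms\<close>

text \<open>
  A ring as a module over any of its subrings: the scalar action is the ring multiplication.
\<close>

definition mult_module :: "('a, 'm) ring_scheme \<Rightarrow> ('a, 'a) module" where
  "mult_module R = \<lparr>carrier = carrier R, mult = mult R, monoid.one = monoid.one R,
    ring.zero = ring.zero R, add = add R, smult = mult R\<rparr>"

locale module_homomorphism = M: module R M + N: module R N for R M N +
  fixes f
  assumes hom_closed: "x \<in> carrier M \<Longrightarrow> f x \<in> carrier N"
    and hom_add: "\<lbrakk>x \<in> carrier M; y \<in> carrier M\<rbrakk> \<Longrightarrow> f (x \<oplus>\<^bsub>M\<^esub> y) = f x \<oplus>\<^bsub>N\<^esub> f y"
    and hom_smult: "\<lbrakk>r \<in> carrier R; x \<in> carrier M\<rbrakk> \<Longrightarrow> f (r \<odot>\<^bsub>M\<^esub> x) = r \<odot>\<^bsub>N\<^esub> f x"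

end

theory Submission
  imports Defs "HOL-Algebra.Left_Coset" "HOL-Algebra.Generated_Groups"
begin

text \<open>
  By a theorem of Burnside, a finite \<open>S\<close>-set is determined up to isomorphism by its marks, the
  numbers of fixed points of the subgroups of \<open>S\<close>.  So an element of \<open>A(S)\<^sub>(\<^sub>p\<^sub>)\<close> amounts to a
  function from subgroups to rational numbers, the ring operations are pointwise, and the elements of
  \<open>A(F)\<^sub>(\<^sub>p\<^sub>)\<close> are the mark functions that are constant on \<open>F\<close>-conjugacy classes.  The map \<open>\<pi>\<close> has
  to be averaging over these classes.  Averaging is additive, fixes the functions that are constant
  on classes and commutes with multiplication by them.  So uniqueness, linearity over \<open>A(F)\<^sub>(\<^sub>p\<^sub>)\<close> and
  the identity on \<open>A(F)\<^sub>(\<^sub>p\<^sub>)\<close> are formal, and the content of the theorem is that the average of the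
  marks of an element of \<open>A(S)\<^sub>(\<^sub>p\<^sub>)\<close> is again the mark function of such an element
  (\<open>average_of_marks_is_mark_vector\<close>).

  To prove this, an element \<open>X\<close> is changed, from large subgroups to small ones, without changing the average \<open>a\<close>
  of its marks, until its marks are constant on classes and hence equal to \<open>a\<close>.  Suppose that they
  are constant on the classes of subgroups of order greater than \<open>n\<close>.  Write \<open>m Q\<close> for the mark of
  \<open>X\<close> at \<open>Q\<close> and \<open>N Q\<close> for the normalizer of \<open>Q\<close> in \<open>S\<close>.  The transitive \<open>S\<close>-set \<open>S/Q\<close> has
  mark \<open>|N Q| / |Q|\<close> at \<open>Q\<close> and vanishing marks at the subgroups that are not conjugate to a subgroup
  of \<open>Q\<close>.  So adding \<open>S/Q\<close> with coefficient \<open>(a Q - m Q) |Q| / |N Q|\<close>, for one \<open>Q\<close> from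
  each \<open>S\<close>-class of subgroups of order \<open>n\<close>, makes the marks equal to \<open>a\<close> in order \<open>n\<close> and does not
  change them in larger orders.  The averaged marks of \<open>S/Q\<close> depend only on the \<open>F\<close>-class of \<open>Q\<close>, and
  over each \<open>F\<close>-class the coefficients sum to zero, so the average does not change
  (\<open>stabilize_step\<close>).

  It remains to see that the coefficients have denominators prime to \<open>p\<close>
  (\<open>average_difference_integral\<close>), and this is where saturation is used.  Let \<open>P\<close> be a fully normalized
  member of the class of \<open>Q\<close>.

  \<^item> Some morphism of \<open>F\<close> is defined on \<open>N Q\<close> and takes \<open>Q\<close> onto \<open>P\<close> (\<open>normalizer_extension\<close>).
    Counting the orbits of \<open>N Q\<close> on the \<open>Q\<close>-fixed points, and those of its image on the \<open>P\<close>-fixed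
    points, gives two congruences modulo \<open>|N Q|\<close> that differ only in the terms \<open>|Q| m Q\<close> and
    \<open>|P| m P\<close>.  So \<open>|N Q|\<close> divides \<open>|Q| (m Q - m P)\<close> up to a denominator prime to \<open>p\<close>
    (\<open>mark_p_difference_integral\<close>).

  \<^item> The average divides by the size of the class of \<open>P\<close>, which is \<open>|S| / |N P|\<close> times a number prime
    to \<open>p\<close> (\<open>card_F_class_fully_normalized\<close>).  This is shown by induction on the index of \<open>P\<close>, the
    induction hypothesis being applied to a fully normalized conjugate of \<open>N P\<close>.
\<close>

section \<open>Rings determined by a family of marks\<close>

text \<open>
  The family \<open>\<mu>\<close> of semiring homomorphisms to an integral domain is jointly injective, so a marked
  semiring is a semiring of functions on \<open>I\<close> in disguise.  The Burnside semiring, its Grothendieck ring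
  and its localization are all accessed through such families, and equations in them are proved by
  comparing marks.
\<close>

locale marked_semiring =
  fixes R :: "('a, 'm) ring_scheme" (structure) and I :: "'i set" and \<mu> :: "'i \<Rightarrow> 'a \<Rightarrow> 'k::idom"
  assumes add_closed: "\<lbrakk>x \<in> carrier R; y \<in> carrier R\<rbrakk> \<Longrightarrow> x \<oplus> y \<in> carrier R"
    and mult_closed: "\<lbrakk>x \<in> carrier R; y \<in> carrier R\<rbrakk> \<Longrightarrow> x \<otimes> y \<in> carrier R"
    and zero_in: "\<zero> \<in> carrier R"
    and one_in: "\<one> \<in> carrier R"
    and mark_add: "\<lbrakk>i \<in> I; x \<in> carrier R; y \<in> carrier R\<rbrakk> \<Longrightarrow> \<mu> i (x \<oplus> y) = \<mu> i x + \<mu> i y"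
    and mark_mult: "\<lbrakk>i \<in> I; x \<in> carrier R; y \<in> carrier R\<rbrakk> \<Longrightarrow> \<mu> i (x \<otimes> y) = \<mu> i x * \<mu> i y"
    and mark_zero: "i \<in> I \<Longrightarrow> \<mu> i \<zero> = 0"
    and mark_one: "i \<in> I \<Longrightarrow> \<mu> i \<one> = 1"
    and mark_eqI: "\<lbrakk>x \<in> carrier R; y \<in> carrier R; \<And>i. i \<in> I \<Longrightarrow> \<mu> i x = \<mu> i y\<rbrakk> \<Longrightarrow> x = y"

locale marked_ring = marked_semiring +
  assumes neg_ex: "x \<in> carrier R \<Longrightarrow> \<exists>y\<in>carrier R. \<forall>i\<in>I. \<mu> i y = - \<mu> i x"
begin

lemma cring: "cring R"
proof (rule cringI)
  show "abelian_group R"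
  proof (rule abelian_groupI)
    fix x assume x: "x \<in> carrier R"
    obtain y where y: "y \<in> carrier R" "\<forall>i\<in>I. \<mu> i y = - \<mu> i x"
      using neg_ex[OF x] by blast
    then have "y \<oplus> x = \<zero>"
      using x by (intro mark_eqI) (auto simp: add_closed mark_add mark_zero zero_in)
    with y(1) show "\<exists>y\<in>carrier R. y \<oplus> x = \<zero>" by blast
  qed (auto intro!: mark_eqI simp: add_closed zero_in mark_add mark_zero algebra_simps)
  show "Group.comm_monoid R"
    by (rule comm_monoidI)
       (auto intro!: mark_eqI simp: mult_closed one_in mark_mult mark_one algebra_simps)
qed (auto intro!: mark_eqI simp: mult_closed add_closed mark_mult mark_add algebra_simps)

sublocale cring R by (rule cring)

lemma mark_neg: "\<lbrakk>i \<in> I; x \<in> carrier R\<rbrakk> \<Longrightarrow> \<mu> i (\<ominus> x) = - \<mu> i x"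
  using mark_add[of i x "\<ominus> x"] by (simp add: r_neg mark_zero eq_neg_iff_add_eq_0 add.commute)

lemma mark_add_pow_nat:
  assumes "i \<in> I" "x \<in> carrier R"
  shows "\<mu> i (add_pow R (n::nat) x) = of_nat n * \<mu> i x"
  by (induction n) (use assms in \<open>auto simp: mark_zero mark_add algebra_simps\<close>)

lemma mark_add_pow:
  assumes "i \<in> I" "x \<in> carrier R"
  shows "\<mu> i (add_pow R (k::int) x) = of_int k * \<mu> i x"
  using assms
  by (cases "k \<ge> 0") (auto simp: add_pow_int_ge add_pow_int_lt mark_add_pow_nat mark_neg)

end

lemma UN_constant_on: "\<lbrakk>x \<in> A; \<And>y. y \<in> A \<Longrightarrow> f y = c\<rbrakk> \<Longrightarrow> (\<Union>y\<in>A. f y) = c"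
  by auto

lemma UN2_constant_on:
  "\<lbrakk>x \<in> A; y \<in> B; \<And>a b c d. \<lbrakk>(a, b) \<in> A; (c, d) \<in> B\<rbrakk> \<Longrightarrow> f a b c d = e\<rbrakk> \<Longrightarrow>
    (\<Union>(a, b)\<in>A. \<Union>(c, d)\<in>B. f a b c d) = e"
  by (intro UN_constant_on[of x] UN_constant_on[of y]) (auto intro!: UN_constant_on[of y])

lemma the_elem_image: "\<lbrakk>x \<in> A; \<And>y. y \<in> A \<Longrightarrow> f y = c\<rbrakk> \<Longrightarrow> the_elem (f ` A) = c"
  by (metis image_is_empty equals0D image_cong image_constant_conv the_elem_eq)

definition groth_mark :: "('i \<Rightarrow> 'a \<Rightarrow> 'k::idom) \<Rightarrow> 'i \<Rightarrow> ('a \<times> 'a) set \<Rightarrow> 'k" where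
  "groth_mark \<mu> i X = the_elem ((\<lambda>(a, b). \<mu> i a - \<mu> i b) ` X)"

context marked_semiring
begin

text \<open>
  The auxiliary summand \<open>e\<close> of the Grothendieck relation cancels because the marks take values in a
  ring; conversely \<open>e = 0\<close> suffices, because equal marks mean equal elements.
\<close>

lemma groth_rel_iff:
  "((a, b), (c, d)) \<in> groth_rel R \<longleftrightarrow>
    a \<in> carrier R \<and> b \<in> carrier R \<and> c \<in> carrier R \<and> d \<in> carrier R \<and>
    (\<forall>i\<in>I. \<mu> i a - \<mu> i b = \<mu> i c - \<mu> i d)"
proof -
  have "(\<exists>e\<in>carrier R. a \<oplus> d \<oplus> e = c \<oplus> b \<oplus> e) \<longleftrightarrow> (\<forall>i\<in>I. \<mu> i a - \<mu> i b = \<mu> i c - \<mu> i d)"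
    if c: "a \<in> carrier R" "b \<in> carrier R" "c \<in> carrier R" "d \<in> carrier R"
  proof
    assume "\<exists>e\<in>carrier R. a \<oplus> d \<oplus> e = c \<oplus> b \<oplus> e"
    then obtain e where e: "e \<in> carrier R" "a \<oplus> d \<oplus> e = c \<oplus> b \<oplus> e" by blast
    show "\<forall>i\<in>I. \<mu> i a - \<mu> i b = \<mu> i c - \<mu> i d"
    proof
      fix i assume "i \<in> I"
      with e c have "\<mu> i a + \<mu> i d + \<mu> i e = \<mu> i c + \<mu> i b + \<mu> i e"
        by (metis add_closed mark_add)
      then show "\<mu> i a - \<mu> i b = \<mu> i c - \<mu> i d" by (simp add: algebra_simps)
    qed
  next
    assume eq: "\<forall>i\<in>I. \<mu> i a - \<mu> i b = \<mu> i c - \<mu> i d"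
    have "a \<oplus> d \<oplus> \<zero> = c \<oplus> b \<oplus> \<zero>"
      using eq c by (intro mark_eqI) (auto simp: add_closed zero_in mark_add algebra_simps)
    then show "\<exists>e\<in>carrier R. a \<oplus> d \<oplus> e = c \<oplus> b \<oplus> e" using zero_in by blast
  qed
  then show ?thesis unfolding groth_rel_def by auto
qed

abbreviation groth_class :: "'a \<Rightarrow> 'a \<Rightarrow> ('a \<times> 'a) set" where
  "groth_class a b \<equiv> groth_rel R `` {(a, b)}"

lemma groth_class_self:
  "\<lbrakk>a \<in> carrier R; b \<in> carrier R\<rbrakk> \<Longrightarrow> (a, b) \<in> groth_class a b"
  by (simp add: groth_rel_iff)

lemma groth_class_eqI:
  assumes "a \<in> carrier R" "b \<in> carrier R" "c \<in> carrier R" "d \<in> carrier R"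
    "\<And>i. i \<in> I \<Longrightarrow> \<mu> i a - \<mu> i b = \<mu> i c - \<mu> i d"
  shows "groth_class a b = groth_class c d"
  using assms by (auto simp: groth_rel_iff)

lemma groth_mark_class:
  assumes "a \<in> carrier R" "b \<in> carrier R" "i \<in> I"
  shows "groth_mark \<mu> i (groth_class a b) = \<mu> i a - \<mu> i b"
  unfolding groth_mark_def using assms
  by (intro the_elem_image[where x = "(a, b)"]) (auto simp: groth_rel_iff)

lemma groth_carrierE:
  assumes "X \<in> carrier (grothendieck_ring R)"
  obtains a b where "a \<in> carrier R" "b \<in> carrier R" "X = groth_class a b"
  using assms by (auto simp: grothendieck_ring_def elim!: quotientE)

lemma groth_carrierI:
  "\<lbrakk>a \<in> carrier R; b \<in> carrier R\<rbrakk> \<Longrightarrow> groth_class a b \<in> carrier (grothendieck_ring R)"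
  by (auto simp: grothendieck_ring_def intro: quotientI)

lemma groth_add:
  assumes "a \<in> carrier R" "b \<in> carrier R" "c \<in> carrier R" "d \<in> carrier R"
  shows "groth_class a b \<oplus>\<^bsub>grothendieck_ring R\<^esub> groth_class c d = groth_class (a \<oplus> c) (b \<oplus> d)"
proof -
  have eq: "groth_class (a' \<oplus> c') (b' \<oplus> d') = groth_class (a \<oplus> c) (b \<oplus> d)"
    if "(a', b') \<in> groth_class a b" "(c', d') \<in> groth_class c d" for a' b' c' d'
  proof (rule groth_class_eqI)
    fix i assume i: "i \<in> I"
    have "(\<mu> i a' - \<mu> i b') + (\<mu> i c' - \<mu> i d') = (\<mu> i a - \<mu> i b) + (\<mu> i c - \<mu> i d)"
      using that i by (simp add: groth_rel_iff)
    then show "\<mu> i (a' \<oplus> c') - \<mu> i (b' \<oplus> d') = \<mu> i (a \<oplus> c) - \<mu> i (b \<oplus> d)"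
      using that assms i by (simp add: groth_rel_iff mark_add algebra_simps)
  qed (use that assms in \<open>auto simp: groth_rel_iff add_closed\<close>)
  show ?thesis
    using UN2_constant_on[OF groth_class_self[OF assms(1,2)] groth_class_self[OF assms(3,4)] eq]
    by (simp add: grothendieck_ring_def)
qed

lemma groth_mult:
  assumes "a \<in> carrier R" "b \<in> carrier R" "c \<in> carrier R" "d \<in> carrier R"
  shows "groth_class a b \<otimes>\<^bsub>grothendieck_ring R\<^esub> groth_class c d =
    groth_class (a \<otimes> c \<oplus> b \<otimes> d) (a \<otimes> d \<oplus> b \<otimes> c)"
proof -
  have eq: "groth_class (a' \<otimes> c' \<oplus> b' \<otimes> d') (a' \<otimes> d' \<oplus> b' \<otimes> c') =
      groth_class (a \<otimes> c \<oplus> b \<otimes> d) (a \<otimes> d \<oplus> b \<otimes> c)"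
    if "(a', b') \<in> groth_class a b" "(c', d') \<in> groth_class c d" for a' b' c' d'
  proof (rule groth_class_eqI)
    fix i assume i: "i \<in> I"
    have "(\<mu> i a' - \<mu> i b') * (\<mu> i c' - \<mu> i d') = (\<mu> i a - \<mu> i b) * (\<mu> i c - \<mu> i d)"
      using that i by (simp add: groth_rel_iff)
    then show "\<mu> i (a' \<otimes> c' \<oplus> b' \<otimes> d') - \<mu> i (a' \<otimes> d' \<oplus> b' \<otimes> c') =
        \<mu> i (a \<otimes> c \<oplus> b \<otimes> d) - \<mu> i (a \<otimes> d \<oplus> b \<otimes> c)"
      using that assms i
      by (simp add: groth_rel_iff mark_add mark_mult add_closed mult_closed algebra_simps)
  qed (use that assms in \<open>auto simp: groth_rel_iff add_closed mult_closed\<close>)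
  show ?thesis
    using UN2_constant_on[OF groth_class_self[OF assms(1,2)] groth_class_self[OF assms(3,4)] eq]
    by (simp add: grothendieck_ring_def)
qed

lemma marked_ring_groth: "marked_ring (grothendieck_ring R) I (groth_mark \<mu>)"
proof
  fix X Y assume X: "X \<in> carrier (grothendieck_ring R)" and Y: "Y \<in> carrier (grothendieck_ring R)"
  obtain a b where X': "a \<in> carrier R" "b \<in> carrier R" "X = groth_class a b"
    using X by (rule groth_carrierE)
  obtain c d where Y': "c \<in> carrier R" "d \<in> carrier R" "Y = groth_class c d"
    using Y by (rule groth_carrierE)
  show "X \<oplus>\<^bsub>grothendieck_ring R\<^esub> Y \<in> carrier (grothendieck_ring R)"
    using X' Y' by (simp add: groth_add groth_carrierI add_closed)
  show "X \<otimes>\<^bsub>grothendieck_ring R\<^esub> Y \<in> carrier (grothendieck_ring R)"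
    using X' Y' by (simp add: groth_mult groth_carrierI add_closed mult_closed)
  fix i assume "i \<in> I"
  then show "groth_mark \<mu> i (X \<oplus>\<^bsub>grothendieck_ring R\<^esub> Y) = groth_mark \<mu> i X + groth_mark \<mu> i Y"
    using X' Y' by (simp add: groth_add groth_mark_class add_closed mark_add)
  show "groth_mark \<mu> i (X \<otimes>\<^bsub>grothendieck_ring R\<^esub> Y) = groth_mark \<mu> i X * groth_mark \<mu> i Y"
    using X' Y' \<open>i \<in> I\<close>
    by (simp add: groth_mult groth_mark_class add_closed mult_closed mark_add mark_mult algebra_simps)
next
  have "\<zero>\<^bsub>grothendieck_ring R\<^esub> = groth_class \<zero> \<zero>" "\<one>\<^bsub>grothendieck_ring R\<^esub> = groth_class \<one> \<zero>"
    by (simp_all add: grothendieck_ring_def)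
  then show "\<zero>\<^bsub>grothendieck_ring R\<^esub> \<in> carrier (grothendieck_ring R)"
    "\<one>\<^bsub>grothendieck_ring R\<^esub> \<in> carrier (grothendieck_ring R)"
    "\<And>i. i \<in> I \<Longrightarrow> groth_mark \<mu> i \<zero>\<^bsub>grothendieck_ring R\<^esub> = 0"
    "\<And>i. i \<in> I \<Longrightarrow> groth_mark \<mu> i \<one>\<^bsub>grothendieck_ring R\<^esub> = 1"
    by (simp_all add: groth_carrierI zero_in one_in groth_mark_class mark_zero mark_one)
next
  fix X Y assume X: "X \<in> carrier (grothendieck_ring R)" and Y: "Y \<in> carrier (grothendieck_ring R)"
    and eq: "\<And>i. i \<in> I \<Longrightarrow> groth_mark \<mu> i X = groth_mark \<mu> i Y"
  obtain a b where X': "a \<in> carrier R" "b \<in> carrier R" "X = groth_class a b"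
    using X by (rule groth_carrierE)
  obtain c d where Y': "c \<in> carrier R" "d \<in> carrier R" "Y = groth_class c d"
    using Y by (rule groth_carrierE)
  show "X = Y"
    unfolding X'(3) Y'(3) using eq X' Y' by (intro groth_class_eqI) (simp_all add: groth_mark_class)
next
  fix X assume "X \<in> carrier (grothendieck_ring R)"
  then obtain a b where X': "a \<in> carrier R" "b \<in> carrier R" "X = groth_class a b"
    by (rule groth_carrierE)
  then show "\<exists>Y\<in>carrier (grothendieck_ring R). \<forall>i\<in>I. groth_mark \<mu> i Y = - groth_mark \<mu> i X"
    by (intro bexI[of _ "groth_class b a"]) (auto simp: groth_mark_class groth_carrierI)
qed

end

definition loc_mark :: "('i \<Rightarrow> 'a \<Rightarrow> int) \<Rightarrow> 'i \<Rightarrow> ('a \<times> int) set \<Rightarrow> rat" where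
  "loc_mark \<mu> i X = the_elem ((\<lambda>(x, m). of_int (\<mu> i x) / of_int m) ` X)"

locale marked_int_ring = marked_ring R I \<mu>
  for R :: "('a, 'm) ring_scheme" (structure) and I :: "'i set" and \<mu> :: "'i \<Rightarrow> 'a \<Rightarrow> int" +
  fixes p :: nat
  assumes prime_p: "prime p"
begin

lemma den_mult: "\<lbrakk>m \<in> p_denominators p; n \<in> p_denominators p\<rbrakk> \<Longrightarrow> m * n \<in> p_denominators p"
  using prime_p by (simp add: p_denominators_def prime_dvd_mult_iff)

lemma den_one: "1 \<in> p_denominators p"
  using prime_gt_1_nat[OF prime_p] by (simp add: p_denominators_def)

lemma den_nonzero: "m \<in> p_denominators p \<Longrightarrow> m \<noteq> 0"
  by (auto simp: p_denominators_def)

text \<open>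
  A ring with a jointly injective family of homomorphisms to the integers is torsion free, which is
  why the auxiliary factor \<open>k\<close> cancels and only the quotients of marks matter.
\<close>

lemma loc_rel_iff:
  "((a, m), (b, n)) \<in> loc_rel p R \<longleftrightarrow>
    a \<in> carrier R \<and> m \<in> p_denominators p \<and> b \<in> carrier R \<and> n \<in> p_denominators p \<and>
    (\<forall>i\<in>I. (of_int (\<mu> i a) / of_int m :: rat) = of_int (\<mu> i b) / of_int n)"
proof -
  have "(\<exists>k\<in>p_denominators p. add_pow R (k * n) a = add_pow R (k * m) b) \<longleftrightarrow>
      (\<forall>i\<in>I. (of_int (\<mu> i a) / of_int m :: rat) = of_int (\<mu> i b) / of_int n)"
    if c: "a \<in> carrier R" "b \<in> carrier R" "m \<in> p_denominators p" "n \<in> p_denominators p"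
  proof -
    have loc_class: "(of_int (\<mu> i a) / of_int m :: rat) = of_int (\<mu> i b) / of_int n \<longleftrightarrow>
        n * \<mu> i a = m * \<mu> i b" for i
      using den_nonzero[OF c(3)] den_nonzero[OF c(4)]
      by (simp add: divide_simps flip: of_int_mult) (metis mult.commute)
    show ?thesis unfolding loc_class
    proof
      assume "\<exists>k\<in>p_denominators p. add_pow R (k * n) a = add_pow R (k * m) b"
      then obtain k where k: "k \<in> p_denominators p" "add_pow R (k * n) a = add_pow R (k * m) b"
        by blast
      have "k * n * \<mu> i a = k * m * \<mu> i b" if "i \<in> I" for i
        using arg_cong[OF k(2), of "\<mu> i"] c that by (simp add: mark_add_pow)
      then show "\<forall>i\<in>I. n * \<mu> i a = m * \<mu> i b" using den_nonzero[OF k(1)] by simp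
    next
      assume eq: "\<forall>i\<in>I. n * \<mu> i a = m * \<mu> i b"
      then have "add_pow R (1 * n) a = add_pow R (1 * m) b"
        using c by (intro mark_eqI) (auto simp: mark_add_pow)
      then show "\<exists>k\<in>p_denominators p. add_pow R (k * n) a = add_pow R (k * m) b"
        using den_one by blast
    qed
  qed
  then show ?thesis unfolding loc_rel_def by auto
qed

abbreviation loc_class :: "'a \<Rightarrow> int \<Rightarrow> ('a \<times> int) set" where
  "loc_class a m \<equiv> loc_rel p R `` {(a, m)}"

lemma loc_class_self: "\<lbrakk>a \<in> carrier R; m \<in> p_denominators p\<rbrakk> \<Longrightarrow> (a, m) \<in> loc_class a m"
  by (simp add: loc_rel_iff)

lemma loc_class_eqI:
  assumes "a \<in> carrier R" "m \<in> p_denominators p" "b \<in> carrier R" "n \<in> p_denominators p"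
    "\<And>i. i \<in> I \<Longrightarrow> (of_int (\<mu> i a) / of_int m :: rat) = of_int (\<mu> i b) / of_int n"
  shows "loc_class a m = loc_class b n"
  using assms by (auto simp: loc_rel_iff)

lemma loc_mark_class:
  assumes "a \<in> carrier R" "m \<in> p_denominators p" "i \<in> I"
  shows "loc_mark \<mu> i (loc_class a m) = of_int (\<mu> i a) / of_int m"
  unfolding loc_mark_def using assms
  by (intro the_elem_image[where x = "(a, m)"]) (auto simp: loc_rel_iff)

lemma loc_carrierE:
  assumes "X \<in> carrier (p_localization p R)"
  obtains a m where "a \<in> carrier R" "m \<in> p_denominators p" "X = loc_class a m"
  using assms by (auto simp: p_localization_def elim!: quotientE)

lemma loc_carrierI:
  "\<lbrakk>a \<in> carrier R; m \<in> p_denominators p\<rbrakk> \<Longrightarrow> loc_class a m \<in> carrier (p_localization p R)"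
  by (auto simp: p_localization_def intro: quotientI)

lemma loc_add:
  assumes "a \<in> carrier R" "m \<in> p_denominators p" "b \<in> carrier R" "n \<in> p_denominators p"
  shows "loc_class a m \<oplus>\<^bsub>p_localization p R\<^esub> loc_class b n = loc_class (add_pow R n a \<oplus> add_pow R m b) (m * n)"
proof -
  have eq: "loc_class (add_pow R n' a' \<oplus> add_pow R m' b') (m' * n') =
      loc_class (add_pow R n a \<oplus> add_pow R m b) (m * n)"
    if "(a', m') \<in> loc_class a m" "(b', n') \<in> loc_class b n" for a' m' b' n'
  proof (rule loc_class_eqI)
    fix i assume i: "i \<in> I"
    have "(of_int (\<mu> i a') / of_int m' :: rat) + of_int (\<mu> i b') / of_int n' =
        of_int (\<mu> i a) / of_int m + of_int (\<mu> i b) / of_int n"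
      using that i by (simp add: loc_rel_iff)
    then show "(of_int (\<mu> i (add_pow R n' a' \<oplus> add_pow R m' b')) / of_int (m' * n') :: rat) =
        of_int (\<mu> i (add_pow R n a \<oplus> add_pow R m b)) / of_int (m * n)"
      using that assms i den_nonzero
      by (simp add: loc_rel_iff mark_add mark_add_pow add_divide_distrib algebra_simps)
  qed (use that assms in \<open>auto simp: loc_rel_iff den_mult\<close>)
  show ?thesis
    using UN2_constant_on[OF loc_class_self[OF assms(1,2)] loc_class_self[OF assms(3,4)] eq]
    by (simp add: p_localization_def)
qed

lemma loc_mult:
  assumes "a \<in> carrier R" "m \<in> p_denominators p" "b \<in> carrier R" "n \<in> p_denominators p"
  shows "loc_class a m \<otimes>\<^bsub>p_localization p R\<^esub> loc_class b n = loc_class (a \<otimes> b) (m * n)"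
proof -
  have eq: "loc_class (a' \<otimes> b') (m' * n') = loc_class (a \<otimes> b) (m * n)"
    if "(a', m') \<in> loc_class a m" "(b', n') \<in> loc_class b n" for a' m' b' n'
  proof (rule loc_class_eqI)
    fix i assume i: "i \<in> I"
    have "(of_int (\<mu> i a') / of_int m' :: rat) * (of_int (\<mu> i b') / of_int n') =
        (of_int (\<mu> i a) / of_int m) * (of_int (\<mu> i b) / of_int n)"
      using that i by (simp add: loc_rel_iff)
    then show "(of_int (\<mu> i (a' \<otimes> b')) / of_int (m' * n') :: rat) =
        of_int (\<mu> i (a \<otimes> b)) / of_int (m * n)"
      using that assms i by (simp add: loc_rel_iff mark_mult)
  qed (use that assms in \<open>auto simp: loc_rel_iff den_mult\<close>)
  show ?thesis
    using UN2_constant_on[OF loc_class_self[OF assms(1,2)] loc_class_self[OF assms(3,4)] eq]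
    by (simp add: p_localization_def)
qed

lemma marked_ring_loc: "marked_ring (p_localization p R) I (loc_mark \<mu>)"
proof
  fix X Y assume X: "X \<in> carrier (p_localization p R)" and Y: "Y \<in> carrier (p_localization p R)"
  obtain a m where X': "a \<in> carrier R" "m \<in> p_denominators p" "X = loc_class a m"
    using X by (rule loc_carrierE)
  obtain b n where Y': "b \<in> carrier R" "n \<in> p_denominators p" "Y = loc_class b n"
    using Y by (rule loc_carrierE)
  show "X \<oplus>\<^bsub>p_localization p R\<^esub> Y \<in> carrier (p_localization p R)"
    using X' Y' by (simp add: loc_add loc_carrierI den_mult)
  show "X \<otimes>\<^bsub>p_localization p R\<^esub> Y \<in> carrier (p_localization p R)"
    using X' Y' by (simp add: loc_mult loc_carrierI den_mult)
  fix i assume i: "i \<in> I"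
  show "loc_mark \<mu> i (X \<oplus>\<^bsub>p_localization p R\<^esub> Y) = loc_mark \<mu> i X + loc_mark \<mu> i Y"
    using X' Y' i den_nonzero
    by (simp add: loc_add loc_mark_class den_mult mark_add mark_add_pow field_simps)
  show "loc_mark \<mu> i (X \<otimes>\<^bsub>p_localization p R\<^esub> Y) = loc_mark \<mu> i X * loc_mark \<mu> i Y"
    using X' Y' i by (simp add: loc_mult loc_mark_class den_mult mark_mult)
next
  have "\<zero>\<^bsub>p_localization p R\<^esub> = loc_class \<zero> 1" "\<one>\<^bsub>p_localization p R\<^esub> = loc_class \<one> 1"
    by (simp_all add: p_localization_def)
  then show "\<zero>\<^bsub>p_localization p R\<^esub> \<in> carrier (p_localization p R)"
    "\<one>\<^bsub>p_localization p R\<^esub> \<in> carrier (p_localization p R)"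
    "\<And>i. i \<in> I \<Longrightarrow> loc_mark \<mu> i \<zero>\<^bsub>p_localization p R\<^esub> = 0"
    "\<And>i. i \<in> I \<Longrightarrow> loc_mark \<mu> i \<one>\<^bsub>p_localization p R\<^esub> = 1"
    by (simp_all add: loc_carrierI den_one loc_mark_class mark_zero mark_one)
next
  fix X Y assume X: "X \<in> carrier (p_localization p R)" and Y: "Y \<in> carrier (p_localization p R)"
    and eq: "\<And>i. i \<in> I \<Longrightarrow> loc_mark \<mu> i X = loc_mark \<mu> i Y"
  obtain a m where X': "a \<in> carrier R" "m \<in> p_denominators p" "X = loc_class a m"
    using X by (rule loc_carrierE)
  obtain b n where Y': "b \<in> carrier R" "n \<in> p_denominators p" "Y = loc_class b n"
    using Y by (rule loc_carrierE)
  show "X = Y"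
    unfolding X'(3) Y'(3) using eq X' Y' by (intro loc_class_eqI) (simp_all add: loc_mark_class)
next
  fix X assume "X \<in> carrier (p_localization p R)"
  then obtain a m where X': "a \<in> carrier R" "m \<in> p_denominators p" "X = loc_class a m"
    by (rule loc_carrierE)
  then show "\<exists>Y\<in>carrier (p_localization p R). \<forall>i\<in>I. loc_mark \<mu> i Y = - loc_mark \<mu> i X"
    by (intro bexI[of _ "loc_class (\<ominus> a) m"]) (auto simp: loc_mark_class mark_neg loc_carrierI)
qed

end

section \<open>Finite G-sets are determined by their marks\<close>

text \<open>
  Compared with a homomorphism to the group of extensional bijections of \<open>E\<close>, this description of an
  action is inherited by invariant subsets and by subgroups without restricting the functions
  \<open>a g\<close>.
\<close>

definition acts :: "('a, 'b) monoid_scheme \<Rightarrow> 'x set \<Rightarrow> ('a \<Rightarrow> 'x \<Rightarrow> 'x) \<Rightarrow> bool" where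
  "acts G E a \<longleftrightarrow>
    (\<forall>g\<in>carrier G. \<forall>x\<in>E. a g x \<in> E) \<and> (\<forall>x\<in>E. a \<one>\<^bsub>G\<^esub> x = x) \<and>
    (\<forall>g\<in>carrier G. \<forall>h\<in>carrier G. \<forall>x\<in>E. a (g \<otimes>\<^bsub>G\<^esub> h) x = a g (a h x))"

definition equivariant_bij ::
  "('a, 'b) monoid_scheme \<Rightarrow> ('x \<Rightarrow> 'y) \<Rightarrow> 'x set \<Rightarrow> ('a \<Rightarrow> 'x \<Rightarrow> 'x) \<Rightarrow> 'y set \<Rightarrow> ('a \<Rightarrow> 'y \<Rightarrow> 'y) \<Rightarrow> bool" where
  "equivariant_bij G f E a E' a' \<longleftrightarrow>
    bij_betw f E E' \<and> (\<forall>g\<in>carrier G. \<forall>x\<in>E. f (a g x) = a' g (f x))"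

definition fixed_set :: "'a set \<Rightarrow> 'x set \<Rightarrow> ('a \<Rightarrow> 'x \<Rightarrow> 'x) \<Rightarrow> 'x set" where
  "fixed_set Q E a = {x \<in> E. \<forall>g\<in>Q. a g x = x}"

lemma fixed_points_eq: "fixed_points Q (E, act) = fixed_set Q E act"
  by (simp add: fixed_set_def)

lemma actsD:
  assumes "acts G E a"
  shows "\<lbrakk>g \<in> carrier G; x \<in> E\<rbrakk> \<Longrightarrow> a g x \<in> E"
    and "x \<in> E \<Longrightarrow> a \<one>\<^bsub>G\<^esub> x = x"
    and "\<lbrakk>g \<in> carrier G; h \<in> carrier G; x \<in> E\<rbrakk> \<Longrightarrow> a (g \<otimes>\<^bsub>G\<^esub> h) x = a g (a h x)"
  using assms by (auto simp: acts_def)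

lemma equivariant_bij_card_fixed:
  assumes "equivariant_bij G f E a E' a'" "Q \<subseteq> carrier G" "acts G E a"
  shows "card (fixed_set Q E a) = card (fixed_set Q E' a')"
proof -
  have bij: "bij_betw f E E'" and eqv: "\<And>g x. \<lbrakk>g \<in> carrier G; x \<in> E\<rbrakk> \<Longrightarrow> f (a g x) = a' g (f x)"
    using assms(1) by (auto simp: equivariant_bij_def)
  have "a' g (f x) = f x \<longleftrightarrow> a g x = x" if "g \<in> Q" "x \<in> E" for g x
  proof -
    have "g \<in> carrier G" using that assms by auto
    then have "a' g (f x) = f (a g x)" "a g x \<in> E"
      using eqv that actsD[OF assms(3)] by auto
    then show ?thesis using bij that by (auto simp: bij_betw_def inj_on_eq_iff)
  qed
  then have "fixed_set Q E' a' = f ` fixed_set Q E a"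
    using bij by (auto simp: fixed_set_def bij_betw_def)
  moreover have "inj_on f (fixed_set Q E a)"
    using bij by (auto simp: fixed_set_def bij_betw_def intro: inj_on_subset)
  ultimately show ?thesis by (simp add: card_image)
qed

context group
begin

lemma acts_inv:
  assumes "acts G E a" "g \<in> carrier G" "x \<in> E"
  shows "a (inv g) (a g x) = x" "a g (a (inv g) x) = x"
  using actsD(3)[OF assms(1) inv_closed[OF assms(2)] assms(2,3)]
    actsD(3)[OF assms(1) assms(2) inv_closed[OF assms(2)] assms(3)] actsD(2)[OF assms(1,3)] assms(2)
  by simp_all

lemma acts_eq_iff:
  assumes "acts G E a" "g \<in> carrier G" "h \<in> carrier G" "x \<in> E"
  shows "a g x = a h x \<longleftrightarrow> a (inv h \<otimes> g) x = x"
proof -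
  have "a (inv h \<otimes> g) x = a (inv h) (a g x)"
    using actsD(3)[OF assms(1)] assms by simp
  then show ?thesis
    using acts_inv[OF assms(1,3), of x] acts_inv[OF assms(1,3), of "a g x"]
      actsD(1)[OF assms(1,2,4)] assms(4) by auto
qed

lemma group_action_imp_acts:
  assumes "group_action G E act"
  shows "acts G E act"
proof -
  interpret group_action G E act by (rule assms)
  show ?thesis
    unfolding acts_def
  proof (intro conjI ballI)
    fix x assume x: "x \<in> E"
    show "act \<one> x = x" using fun_cong[OF id_eq_one, of x] x by simp
    fix g assume g: "g \<in> carrier G"
    show "act g x \<in> E" by (rule element_image[OF g x refl])
    fix h assume "h \<in> carrier G"
    then show "act (g \<otimes> h) x = act g (act h x)" by (rule composition_rule[OF x g])
  qed
qed

lemma acts_imp_group_action: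
  assumes "acts G E a"
  shows "group_action G E (\<lambda>g. \<lambda>x\<in>E. a g x)"
proof -
  have bij: "(\<lambda>x\<in>E. a g x) \<in> Bij E" if "g \<in> carrier G" for g
  proof -
    have "bij_betw (a g) E E"
    proof (rule bij_betw_byWitness[where f' = "a (inv g)"])
      show "\<forall>x\<in>E. a (inv g) (a g x) = x" "\<forall>x\<in>E. a g (a (inv g) x) = x"
        using acts_inv[OF assms that] by simp_all
      show "a g ` E \<subseteq> E" "a (inv g) ` E \<subseteq> E"
        using actsD(1)[OF assms] that by auto
    qed
    then show ?thesis unfolding Bij_def using bij_betw_cong[of E "\<lambda>x\<in>E. a g x" "a g" E] by auto
  qed
  show ?thesis
    unfolding group_action_def group_hom_def group_hom_axioms_def
  proof (intro conjI homI)
    fix g h assume gh: "g \<in> carrier G" "h \<in> carrier G"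
    show "(\<lambda>x\<in>E. a (g \<otimes> h) x) = (\<lambda>x\<in>E. a g x) \<otimes>\<^bsub>BijGroup E\<^esub> (\<lambda>x\<in>E. a h x)"
      using bij gh actsD[OF assms] by (auto simp: BijGroup_def compose_def fun_eq_iff)
  qed (use bij in \<open>auto simp: BijGroup_def group_BijGroup[unfolded BijGroup_def] is_group\<close>)
qed

lemma acts_subset:
  assumes "acts G E a" "U \<subseteq> E" "\<And>g x. \<lbrakk>g \<in> carrier G; x \<in> U\<rbrakk> \<Longrightarrow> a g x \<in> U"
  shows "acts G U a"
  using assms unfolding acts_def by blast

lemma acts_orbit:
  assumes "acts G E a" "x \<in> E"
  shows "acts G (orbit G a x) a" "acts G (E - orbit G a x) a" "orbit G a x \<subseteq> E" "x \<in> orbit G a x"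
proof -
  show sub: "orbit G a x \<subseteq> E" using actsD(1)[OF assms(1)] assms(2) by (auto simp: orbit_def)
  show "x \<in> orbit G a x" unfolding orbit_def using actsD(2)[OF assms(1,2)] by force
  have cl: "a g y \<in> orbit G a x" if g: "g \<in> carrier G" and y: "y \<in> orbit G a x" for g y
  proof -
    obtain h where "h \<in> carrier G" "y = a h x" using y by (auto simp: orbit_def)
    then have "a g y = a (g \<otimes> h) x" "g \<otimes> h \<in> carrier G"
      using actsD(3)[OF assms(1)] assms(2) g by auto
    then show ?thesis by (auto simp: orbit_def)
  qed
  show "acts G (orbit G a x) a" by (rule acts_subset[OF assms(1) sub cl])
  show "acts G (E - orbit G a x) a"
  proof (rule acts_subset[OF assms(1)])
    fix g y assume g: "g \<in> carrier G" and y: "y \<in> E - orbit G a x"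
    have "a g y \<notin> orbit G a x"
      using cl[OF inv_closed[OF g], of "a g y"] acts_inv(1)[OF assms(1) g, of y] y by auto
    then show "a g y \<in> E - orbit G a x" using y g actsD(1)[OF assms(1)] by auto
  qed auto
qed

lemma stabilizer_subgroup_acts:
  assumes "acts G E a" "x \<in> E"
  shows "subgroup (stabilizer G a x) G"
proof (rule subgroupI)
  show "stabilizer G a x \<subseteq> carrier G" by (auto simp: stabilizer_def)
  show "stabilizer G a x \<noteq> {}" using actsD(2)[OF assms] by (auto simp: stabilizer_def)
  show "inv g \<in> stabilizer G a x" if "g \<in> stabilizer G a x" for g
    using that acts_inv(1)[OF assms(1) _ assms(2), of g] by (auto simp: stabilizer_def)
  show "g \<otimes> h \<in> stabilizer G a x" if "g \<in> stabilizer G a x" "h \<in> stabilizer G a x" for g h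
    using that actsD(3)[OF assms(1) _ _ assms(2)] by (auto simp: stabilizer_def)
qed

lemma orbits_equivalent_if_stabilizers_equal:
  assumes "acts G E a" "x \<in> E" "acts G E' a'" "y \<in> E'"
    and "stabilizer G a x = stabilizer G a' y"
  shows "\<exists>f. equivariant_bij G f (orbit G a x) a (orbit G a' y) a'"
proof -
  have same: "a g x = a h x \<longleftrightarrow> a' g y = a' h y" if "g \<in> carrier G" "h \<in> carrier G" for g h
  proof -
    have "inv h \<otimes> g \<in> stabilizer G a x \<longleftrightarrow> inv h \<otimes> g \<in> stabilizer G a' y" using assms by simp
    then show ?thesis
      using that acts_eq_iff[OF assms(1) that assms(2)] acts_eq_iff[OF assms(3) that assms(4)]
      by (simp add: stabilizer_def)
  qed
  define f where "f z = a' (SOME g. g \<in> carrier G \<and> a g x = z) y" for z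
  have f: "f (a g x) = a' g y" if "g \<in> carrier G" for g
  proof -
    have "(SOME h. h \<in> carrier G \<and> a h x = a g x) \<in> carrier G \<and>
        a (SOME h. h \<in> carrier G \<and> a h x = a g x) x = a g x"
      by (rule someI) (use that in simp)
    then show ?thesis unfolding f_def using same that by blast
  qed
  have "bij_betw f (orbit G a x) (orbit G a' y)"
    unfolding bij_betw_def
  proof
    show "inj_on f (orbit G a x)" using same by (auto simp: inj_on_def orbit_def f)
    show "f ` orbit G a x = orbit G a' y" by (force simp: orbit_def f)
  qed
  moreover have "f (a g z) = a' g (f z)" if g: "g \<in> carrier G" and z: "z \<in> orbit G a x" for g z
  proof -
    obtain h where h: "h \<in> carrier G" "z = a h x" using z by (auto simp: orbit_def)
    then have "f (a g z) = f (a (g \<otimes> h) x)" using actsD(3)[OF assms(1) g h(1) assms(2)] by simp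
    also have "\<dots> = a' (g \<otimes> h) y" using f g h by simp
    also have "\<dots> = a' g (f z)" using f g h actsD(3)[OF assms(3) g h(1) assms(4)] by simp
    finally show ?thesis .
  qed
  ultimately show ?thesis unfolding equivariant_bij_def by blast
qed

text \<open>
  Burnside's theorem.  Let \<open>Q\<close> be a stabilizer of largest order in \<open>E\<close>.  Equality of marks yields a
  point \<open>y\<close> of \<open>E'\<close> fixed by \<open>Q\<close>, and then a point of \<open>E\<close> fixed by the stabilizer of \<open>y\<close>; so by
  maximality the stabilizer of \<open>y\<close> is \<open>Q\<close>.  Hence \<open>E\<close> and \<open>E'\<close> contain isomorphic orbits, and
  induction applies to what remains after removing them.
\<close>

theorem equivalent_if_marks_equal:
  fixes E :: "'x set" and E' :: "'y set"
  assumes "finite (carrier G)" "finite E" "finite E'" "acts G E a" "acts G E' a'"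
    and "\<And>Q. subgroup Q G \<Longrightarrow> card (fixed_set Q E a) = card (fixed_set Q E' a')"
  shows "\<exists>f. equivariant_bij G f E a E' a'"
  using assms(2-)
proof (induction "card E" arbitrary: E E' rule: less_induct)
  case less
  note E = \<open>acts G E a\<close> and E' = \<open>acts G E' a'\<close> and marks = less.prems(5)
  have fix_stab: "x \<in> fixed_set (stabilizer G a x) E a" if "x \<in> E" for x
    using that by (auto simp: fixed_set_def stabilizer_def)
  have fix_stab': "y \<in> fixed_set (stabilizer G a' y) E' a'" if "y \<in> E'" for y
    using that by (auto simp: fixed_set_def stabilizer_def)
  show ?case
  proof (cases "E = {}")
    case True
    have "fixed_set {\<one>} E' a' = E'" using actsD(2)[OF E'] by (auto simp: fixed_set_def)
    then have "card E' = 0"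
      using marks[OF triv_subgroup] True by (auto simp: fixed_set_def)
    then have "E' = {}" using \<open>finite E'\<close> by simp
    then show ?thesis using True by (auto simp: equivariant_bij_def bij_betw_def)
  next
    case False
    obtain x where x: "x \<in> E" and
      max: "\<And>z. z \<in> E \<Longrightarrow> card (stabilizer G a z) \<le> card (stabilizer G a x)"
    proof -
      let ?c = "\<lambda>z. card (stabilizer G a z)"
      have "Max (?c ` E) \<in> ?c ` E" using False \<open>finite E\<close> by (intro Max_in) auto
      then obtain x where "x \<in> E" "?c x = Max (?c ` E)" by auto
      then show thesis using that[of x] \<open>finite E\<close> by simp
    qed
    let ?Q = "stabilizer G a x"
    have Q: "subgroup ?Q G" by (rule stabilizer_subgroup_acts[OF E x])
    have fin: "finite (fixed_set H E a)" "finite (fixed_set H E' a')" for H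
      using \<open>finite E\<close> \<open>finite E'\<close> by (auto simp: fixed_set_def)
    have "fixed_set ?Q E' a' \<noteq> {}"
      using fix_stab[OF x] fin marks[OF Q] by (metis card_eq_0_iff empty_iff)
    then obtain y where y: "y \<in> E'" and Qy: "?Q \<subseteq> stabilizer G a' y"
      by (auto simp: fixed_set_def stabilizer_def)
    let ?Q' = "stabilizer G a' y"
    have Q': "subgroup ?Q' G" by (rule stabilizer_subgroup_acts[OF E' y])
    have "fixed_set ?Q' E a \<noteq> {}"
      using fix_stab'[OF y] fin marks[OF Q'] by (metis card_eq_0_iff empty_iff)
    then obtain z where z: "z \<in> E" and Qz: "?Q' \<subseteq> stabilizer G a z"
      by (auto simp: fixed_set_def stabilizer_def)
    have finst: "finite (stabilizer G a z)" "finite ?Q'"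
      using assms(1) by (auto simp: stabilizer_def)
    have "?Q = ?Q'"
      using max[OF z] card_mono[OF finst(1) Qz] Qy finst by (metis card_mono card_subset_eq le_antisym le_trans)
    from orbits_equivalent_if_stabilizers_equal[OF E x E' y this]
    obtain f where f: "equivariant_bij G f (orbit G a x) a (orbit G a' y) a'" by blast
    note orb = acts_orbit[OF E x] and orb' = acts_orbit[OF E' y]
    have split: "card (fixed_set H E a) = card (fixed_set H (orbit G a x) a) + card (fixed_set H (E - orbit G a x) a)"
      for H
      using orb(3) \<open>finite E\<close> finite_subset[OF orb(3)]
      by (subst card_Un_disjoint[symmetric]) (auto simp: fixed_set_def intro!: arg_cong[where f = card])
    have split': "card (fixed_set H E' a') = card (fixed_set H (orbit G a' y) a') + card (fixed_set H (E' - orbit G a' y) a')"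
      for H
      using orb'(3) \<open>finite E'\<close> finite_subset[OF orb'(3)]
      by (subst card_Un_disjoint[symmetric]) (auto simp: fixed_set_def intro!: arg_cong[where f = card])
    have "\<exists>f'. equivariant_bij G f' (E - orbit G a x) a (E' - orbit G a' y) a'"
    proof (rule less.hyps)
      show "card (E - orbit G a x) < card E"
        using x orb(4) \<open>finite E\<close> by (intro psubset_card_mono) auto
      fix H assume H: "subgroup H G"
      show "card (fixed_set H (E - orbit G a x) a) = card (fixed_set H (E' - orbit G a' y) a')"
        using marks[OF H] split[of H] split'[of H]
          equivariant_bij_card_fixed[OF f subgroup.subset[OF H] orb(1)] by simp
    qed (use \<open>finite E\<close> \<open>finite E'\<close> orb orb' in auto)
    then obtain f' where f': "equivariant_bij G f' (E - orbit G a x) a (E' - orbit G a' y) a'" by blast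
    define h where "h z = (if z \<in> orbit G a x then f z else f' z)" for z
    have "bij_betw h (orbit G a x \<union> (E - orbit G a x)) (orbit G a' y \<union> (E' - orbit G a' y))"
      using f f' unfolding h_def equivariant_bij_def
      by (intro bij_betw_disjoint_Un) auto
    then have "bij_betw h E E'" using orb(3) orb'(3) by (simp add: Un_absorb1)
    moreover have "h (a g z) = a' g (h z)" if "g \<in> carrier G" "z \<in> E" for g z
      using f f' actsD(1)[OF orb(1)] actsD(1)[OF orb(2)] that
      unfolding h_def equivariant_bij_def by auto
    ultimately show ?thesis unfolding equivariant_bij_def by blast
  qed
qed

lemma finite_gsets_iff: "(E, act) \<in> finite_gsets G \<longleftrightarrow> finite E \<and> group_action G E act"
  by (simp add: finite_gsets_def)

lemma gset_iso_iff_marks: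
  assumes "finite (carrier G)"
  shows "(X, Y) \<in> gset_iso G \<longleftrightarrow> X \<in> finite_gsets G \<and> Y \<in> finite_gsets G \<and>
    (\<forall>Q. subgroup Q G \<longrightarrow> card (fixed_points Q X) = card (fixed_points Q Y))"
proof -
  obtain E a E' a' where XY: "X = (E, a)" "Y = (E', a')" by (metis surj_pair)
  have "(\<exists>f. bij_betw f E E' \<and> (\<forall>g\<in>carrier G. \<forall>x\<in>E. f (a g x) = a' g (f x))) \<longleftrightarrow>
      (\<forall>Q. subgroup Q G \<longrightarrow> card (fixed_points Q X) = card (fixed_points Q Y))"
    if "X \<in> finite_gsets G" "Y \<in> finite_gsets G"
  proof -
    have acts: "finite E" "finite E'" "acts G E a" "acts G E' a'"
      using that XY group_action_imp_acts by (auto simp: finite_gsets_iff)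
    show ?thesis
      using equivalent_if_marks_equal[OF assms acts]
        equivariant_bij_card_fixed[of G _ E a E' a', OF _ _ acts(3)]
      unfolding XY fixed_points_eq equivariant_bij_def by (metis subgroup.subset)
  qed
  then show ?thesis unfolding XY gset_iso_def by auto
qed

text \<open>
  The \<open>S\<close>-sets that occur later consist of cosets; this moves them to the natural numbers, where the
  Burnside ring is built.
\<close>

lemma gset_of_acts:
  fixes E :: "'x set"
  assumes "finite E" "acts G E a"
  obtains X where "X \<in> finite_gsets G"
    "\<And>Q. Q \<subseteq> carrier G \<Longrightarrow> card (fixed_points Q X) = card (fixed_set Q E a)"
proof -
  obtain e :: "'x \<Rightarrow> nat" where e: "inj_on e E" using finite_imp_inj_to_nat_seg[OF assms(1)] by blast
  define a' where "a' g n = e (a g (inv_into E e n))" for g n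
  have eqv: "a' g (e x) = e (a g x)" if "x \<in> E" for g x
    using e that by (simp add: a'_def)
  have acts: "acts G (e ` E) a'"
    unfolding acts_def using actsD[OF assms(2)] by (auto simp: eqv)
  let ?X = "(e ` E, \<lambda>g. \<lambda>n\<in>e ` E. a' g n)"
  have "?X \<in> finite_gsets G"
    using acts_imp_group_action[OF acts] assms(1) by (simp add: finite_gsets_iff)
  moreover have "equivariant_bij G e E a (e ` E) (\<lambda>g. \<lambda>n\<in>e ` E. a' g n)"
    using e eqv by (auto simp: equivariant_bij_def inj_on_imp_bij_betw)
  ultimately show thesis
    using that[of ?X] equivariant_bij_card_fixed[OF _ _ assms(2)] by (metis fixed_points_eq)
qed

end

section \<open>Marks on the Burnside ring\<close>

lemma fixed_set_mono_eq: "E = E' \<Longrightarrow> (\<And>g x. \<lbrakk>g \<in> Q; x \<in> E\<rbrakk> \<Longrightarrow> a g x = a' g x) \<Longrightarrow> fixed_set Q E a = fixed_set Q E' a'"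
  by (auto simp: fixed_set_def)

context group
begin

lemma gset_of_actsI:
  assumes "finite E" "acts G E a" "act = (\<lambda>g. \<lambda>x\<in>E. a g x)"
  shows "(E, act) \<in> finite_gsets G" "fixed_points Q (E, act) = fixed_set Q E a"
proof -
  show "(E, act) \<in> finite_gsets G"
    using acts_imp_group_action[OF assms(2)] assms by (simp add: finite_gsets_iff)
  show "fixed_points Q (E, act) = fixed_set Q E a"
    unfolding fixed_points_eq assms(3) by (rule fixed_set_mono_eq) auto
qed

lemma gset_sum:
  assumes "X \<in> finite_gsets G" "Y \<in> finite_gsets G"
  shows "gset_sum X Y \<in> finite_gsets G"
    and "card (fixed_points Q (gset_sum X Y)) = card (fixed_points Q X) + card (fixed_points Q Y)"
proof -
  obtain E a E' a' where XY: "X = (E, a)" "Y = (E', a')" by (metis surj_pair)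
  have acts: "finite E" "finite E'" "acts G E a" "acts G E' a'"
    using assms XY group_action_imp_acts by (auto simp: finite_gsets_iff)
  let ?E = "sum_encode ` (E <+> E')"
  let ?a = "\<lambda>g n. sum_encode (map_sum (a g) (a' g) (sum_decode n))"
  have A: "acts G ?E ?a"
    unfolding acts_def using actsD[OF acts(3)] actsD[OF acts(4)] by auto
  note R = gset_of_actsI[OF _ A refl]
  show "gset_sum X Y \<in> finite_gsets G" unfolding XY using R(1) acts by simp
  have "fixed_set Q ?E ?a = sum_encode ` (fixed_set Q E a <+> fixed_set Q E' a')"
    by (auto simp: fixed_set_def sum_encode_eq)
  then have "card (fixed_set Q ?E ?a) = card (fixed_set Q E a) + card (fixed_set Q E' a')"
    using acts by (simp add: card_image inj_sum_encode card_Plus fixed_set_def)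
  then show "card (fixed_points Q (gset_sum X Y)) = card (fixed_points Q X) + card (fixed_points Q Y)"
    unfolding XY using R(2) acts by (simp add: fixed_points_eq del: fixed_points.simps)
qed

lemma gset_prod:
  assumes "X \<in> finite_gsets G" "Y \<in> finite_gsets G"
  shows "gset_prod X Y \<in> finite_gsets G"
    and "card (fixed_points Q (gset_prod X Y)) = card (fixed_points Q X) * card (fixed_points Q Y)"
proof -
  obtain E a E' a' where XY: "X = (E, a)" "Y = (E', a')" by (metis surj_pair)
  have acts: "finite E" "finite E'" "acts G E a" "acts G E' a'"
    using assms XY group_action_imp_acts by (auto simp: finite_gsets_iff)
  let ?E = "prod_encode ` (E \<times> E')"
  let ?a = "\<lambda>g n. prod_encode (map_prod (a g) (a' g) (prod_decode n))"
  have A: "acts G ?E ?a"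
    unfolding acts_def using actsD[OF acts(3)] actsD[OF acts(4)] by auto
  note R = gset_of_actsI[OF _ A refl]
  show "gset_prod X Y \<in> finite_gsets G" unfolding XY using R(1) acts by simp
  have "fixed_set Q ?E ?a = prod_encode ` (fixed_set Q E a \<times> fixed_set Q E' a')"
    by (auto simp: fixed_set_def prod_encode_eq)
  then have "card (fixed_set Q ?E ?a) = card (fixed_set Q E a) * card (fixed_set Q E' a')"
    using acts by (simp add: card_image inj_prod_encode card_cartesian_product fixed_set_def)
  then show "card (fixed_points Q (gset_prod X Y)) = card (fixed_points Q X) * card (fixed_points Q Y)"
    unfolding XY using R(2) acts by (simp add: fixed_points_eq del: fixed_points.simps)
qed

lemma gset_empty: "gset_empty \<in> finite_gsets G" "fixed_points Q gset_empty = {}"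
  unfolding gset_empty_def
  by (rule gset_of_actsI(1)[where a = "\<lambda>g x. x"], auto simp: acts_def)

lemma gset_point: "gset_point \<in> finite_gsets G" "fixed_points Q gset_point = {0}"
  unfolding gset_point_def
  by (rule gset_of_actsI(1)[where a = "\<lambda>g x. x"], auto simp: acts_def)

end

lemma gset_restrict:
  assumes "group G" "group H" "h \<in> hom H G" "X \<in> finite_gsets G"
  shows "gset_restrict h X \<in> finite_gsets H"
    and "fixed_points Q (gset_restrict h X) = fixed_points (h ` Q) X"
proof -
  obtain E a where X: "X = (E, a)" by (metis surj_pair)
  have "finite E" and act: "group_action G E a"
    using assms(4) X by (auto simp: group.finite_gsets_iff[OF assms(1)])
  have "a \<in> hom G (BijGroup E)"
    using act by (simp add: group_action_def group_hom_def group_hom_axioms_def)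
  then have "(\<lambda>g. a (h g)) \<in> hom H (BijGroup E)"
    using hom_compose[OF assms(3)] by (simp add: comp_def)
  then have "group_action H E (\<lambda>g. a (h g))"
    by (simp add: group_action_def group_hom_def group_hom_axioms_def assms(2) group_BijGroup)
  then show "gset_restrict h X \<in> finite_gsets H"
    using \<open>finite E\<close> X by (simp add: group.finite_gsets_iff[OF assms(2)])
  show "fixed_points Q (gset_restrict h X) = fixed_points (h ` Q) X"
    unfolding X by simp
qed

locale finite_group = group G for G (structure) +
  assumes finite_carrier: "finite (carrier G)"
begin

abbreviation gset_class :: "'a gset \<Rightarrow> 'a gset set" where
  "gset_class X \<equiv> gset_iso G `` {X}"

lemma gset_class_eqI:
  assumes "X \<in> finite_gsets G" "Y \<in> finite_gsets G"
    "\<And>Q. subgroup Q G \<Longrightarrow> card (fixed_points Q X) = card (fixed_points Q Y)"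
  shows "gset_class X = gset_class Y"
  using assms by (auto simp: gset_iso_iff_marks[OF finite_carrier])

lemma gset_class_self: "X \<in> finite_gsets G \<Longrightarrow> X \<in> gset_class X"
  by (simp add: gset_iso_iff_marks[OF finite_carrier])

lemma gset_classD:
  assumes "Y \<in> gset_class X"
  shows "Y \<in> finite_gsets G" "subgroup Q G \<Longrightarrow> card (fixed_points Q Y) = card (fixed_points Q X)"
  using assms by (auto simp: gset_iso_iff_marks[OF finite_carrier])

lemma mark_class_gset_class:
  "\<lbrakk>X \<in> finite_gsets G; subgroup Q G\<rbrakk> \<Longrightarrow> mark_class Q (gset_class X) = int (card (fixed_points Q X))"
  unfolding mark_class_def using gset_classD gset_class_self
  by (intro the_elem_image[where x = X]) auto

lemma semiring_carrierE:
  assumes "A \<in> carrier (gset_semiring G)"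
  obtains X where "X \<in> finite_gsets G" "A = gset_class X"
  using assms by (auto simp: gset_semiring_def elim!: quotientE)

lemma semiring_carrierI: "X \<in> finite_gsets G \<Longrightarrow> gset_class X \<in> carrier (gset_semiring G)"
  by (auto simp: gset_semiring_def intro: quotientI)

lemma semiring_add:
  assumes "X \<in> finite_gsets G" "Y \<in> finite_gsets G"
  shows "gset_class X \<oplus>\<^bsub>gset_semiring G\<^esub> gset_class Y = gset_class (gset_sum X Y)"
proof -
  have "(\<Union>Y'\<in>gset_class Y. gset_class (gset_sum X' Y')) = gset_class (gset_sum X Y)"
    if "X' \<in> gset_class X" for X'
    by (rule UN_constant_on[OF gset_class_self[OF assms(2)]], rule gset_class_eqI)
       (use that gset_classD assms gset_sum in auto)
  then have "(\<Union>X'\<in>gset_class X. \<Union>Y'\<in>gset_class Y. gset_class (gset_sum X' Y')) = gset_class (gset_sum X Y)"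
    by (intro UN_constant_on[OF gset_class_self[OF assms(1)]])
  then show ?thesis by (simp add: gset_semiring_def)
qed

lemma semiring_mult:
  assumes "X \<in> finite_gsets G" "Y \<in> finite_gsets G"
  shows "gset_class X \<otimes>\<^bsub>gset_semiring G\<^esub> gset_class Y = gset_class (gset_prod X Y)"
proof -
  have "(\<Union>Y'\<in>gset_class Y. gset_class (gset_prod X' Y')) = gset_class (gset_prod X Y)"
    if "X' \<in> gset_class X" for X'
    by (rule UN_constant_on[OF gset_class_self[OF assms(2)]], rule gset_class_eqI)
       (use that gset_classD assms gset_prod in auto)
  then have "(\<Union>X'\<in>gset_class X. \<Union>Y'\<in>gset_class Y. gset_class (gset_prod X' Y')) = gset_class (gset_prod X Y)"
    by (intro UN_constant_on[OF gset_class_self[OF assms(1)]])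
  then show ?thesis by (simp add: gset_semiring_def)
qed

lemma marked_gset_semiring: "marked_semiring (gset_semiring G) {Q. subgroup Q G} mark_class"
proof
  fix A B assume A: "A \<in> carrier (gset_semiring G)" and B: "B \<in> carrier (gset_semiring G)"
  obtain X where X: "X \<in> finite_gsets G" "A = gset_class X" using A by (rule semiring_carrierE)
  obtain Y where Y: "Y \<in> finite_gsets G" "B = gset_class Y" using B by (rule semiring_carrierE)
  show "A \<oplus>\<^bsub>gset_semiring G\<^esub> B \<in> carrier (gset_semiring G)"
    "A \<otimes>\<^bsub>gset_semiring G\<^esub> B \<in> carrier (gset_semiring G)"
    using X Y by (simp_all add: semiring_add semiring_mult semiring_carrierI gset_sum gset_prod)
  fix Q assume "Q \<in> {Q. subgroup Q G}"
  then show "mark_class Q (A \<oplus>\<^bsub>gset_semiring G\<^esub> B) = mark_class Q A + mark_class Q B"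
    "mark_class Q (A \<otimes>\<^bsub>gset_semiring G\<^esub> B) = mark_class Q A * mark_class Q B"
    using X Y
    by (simp_all add: semiring_add semiring_mult mark_class_gset_class gset_sum gset_prod)
next
  have "\<zero>\<^bsub>gset_semiring G\<^esub> = gset_class gset_empty" "\<one>\<^bsub>gset_semiring G\<^esub> = gset_class gset_point"
    by (simp_all add: gset_semiring_def)
  then show "\<zero>\<^bsub>gset_semiring G\<^esub> \<in> carrier (gset_semiring G)"
    "\<one>\<^bsub>gset_semiring G\<^esub> \<in> carrier (gset_semiring G)"
    "\<And>Q. Q \<in> {Q. subgroup Q G} \<Longrightarrow> mark_class Q \<zero>\<^bsub>gset_semiring G\<^esub> = 0"
    "\<And>Q. Q \<in> {Q. subgroup Q G} \<Longrightarrow> mark_class Q \<one>\<^bsub>gset_semiring G\<^esub> = 1"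
    by (simp_all add: semiring_carrierI mark_class_gset_class gset_empty gset_point)
next
  fix A B assume A: "A \<in> carrier (gset_semiring G)" and B: "B \<in> carrier (gset_semiring G)"
    and eq: "\<And>Q. Q \<in> {Q. subgroup Q G} \<Longrightarrow> mark_class Q A = mark_class Q B"
  obtain X where X: "X \<in> finite_gsets G" "A = gset_class X" using A by (rule semiring_carrierE)
  obtain Y where Y: "Y \<in> finite_gsets G" "B = gset_class Y" using B by (rule semiring_carrierE)
  show "A = B"
    unfolding X(2) Y(2) using eq X Y by (intro gset_class_eqI) (auto simp: mark_class_gset_class)
qed

sublocale semiring: marked_semiring "gset_semiring G" "{Q. subgroup Q G}" mark_class
  by (rule marked_gset_semiring)

lemma mark_eq_groth_mark: "mark = groth_mark mark_class"
  by (auto simp: fun_eq_iff mark_def groth_mark_def)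

sublocale burnside: marked_ring "burnside_ring G" "{Q. subgroup Q G}" mark
  unfolding burnside_ring_def mark_eq_groth_mark by (rule semiring.marked_ring_groth)

lemma burnside_carrierE:
  assumes "x \<in> carrier (burnside_ring G)"
  obtains X Y where "X \<in> finite_gsets G" "Y \<in> finite_gsets G"
    "x = semiring.groth_class (gset_class X) (gset_class Y)"
    "\<And>Q. subgroup Q G \<Longrightarrow> mark Q x = int (card (fixed_points Q X)) - int (card (fixed_points Q Y))"
proof -
  obtain A B where AB: "A \<in> carrier (gset_semiring G)" "B \<in> carrier (gset_semiring G)"
      "x = semiring.groth_class A B"
    using assms unfolding burnside_ring_def by (rule semiring.groth_carrierE)
  obtain X where X: "X \<in> finite_gsets G" "A = gset_class X" using AB(1) by (rule semiring_carrierE)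
  obtain Y where Y: "Y \<in> finite_gsets G" "B = gset_class Y" using AB(2) by (rule semiring_carrierE)
  show thesis
    using that[OF X(1) Y(1)] AB X Y
    by (simp add: mark_eq_groth_mark semiring.groth_mark_class mark_class_gset_class)
qed

lemma burnside_of_acts:
  assumes "finite E" "acts G E a"
  obtains x where "x \<in> carrier (burnside_ring G)"
    "\<And>Q. subgroup Q G \<Longrightarrow> mark Q x = int (card (fixed_set Q E a))"
proof -
  obtain X where X: "X \<in> finite_gsets G"
    "\<And>Q. Q \<subseteq> carrier G \<Longrightarrow> card (fixed_points Q X) = card (fixed_set Q E a)"
    using gset_of_acts[OF assms] by metis
  let ?x = "semiring.groth_class (gset_class X) (gset_class gset_empty)"
  have "?x \<in> carrier (burnside_ring G)"
    unfolding burnside_ring_def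
    by (intro semiring.groth_carrierI semiring_carrierI X gset_empty)
  moreover have "mark Q ?x = int (card (fixed_set Q E a))" if "subgroup Q G" for Q
    using that X
    by (simp add: mark_eq_groth_mark semiring.groth_mark_class mark_class_gset_class
      semiring_carrierI gset_empty subgroup.subset)
  ultimately show thesis by (rule that)
qed

end

locale finite_group_prime = finite_group G for G (structure) +
  fixes p :: nat
  assumes prime_p: "prime p"
begin

sublocale burnside: marked_int_ring "burnside_ring G" "{Q. subgroup Q G}" mark p
  by unfold_locales (rule prime_p)

lemma mark_p_eq_loc_mark: "mark_p = loc_mark mark"
  by (auto simp: fun_eq_iff mark_p_def loc_mark_def)

sublocale burnside_p: marked_ring "burnside_ring_p p G" "{Q. subgroup Q G}" mark_p
  unfolding burnside_ring_p_def mark_p_eq_loc_mark by (rule burnside.marked_ring_loc)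

lemma burnside_p_carrierE:
  assumes "X \<in> carrier (burnside_ring_p p G)"
  obtains x m where "x \<in> carrier (burnside_ring G)" "m \<in> p_denominators p"
    "X = burnside.loc_class x m"
    "\<And>Q. subgroup Q G \<Longrightarrow> mark_p Q X = of_int (mark Q x) / of_int m"
  using assms unfolding burnside_ring_p_def
  by (elim burnside.loc_carrierE) (simp add: mark_p_eq_loc_mark burnside.loc_mark_class)

lemma burnside_p_carrierI:
  assumes "x \<in> carrier (burnside_ring G)" "m \<in> p_denominators p"
  obtains X where "X \<in> carrier (burnside_ring_p p G)"
    "\<And>Q. subgroup Q G \<Longrightarrow> mark_p Q X = of_int (mark Q x) / of_int m"
  using that[of "burnside.loc_class x m"] assms unfolding burnside_ring_p_def
  by (simp add: mark_p_eq_loc_mark burnside.loc_mark_class burnside.loc_carrierI)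

end

text \<open>
  Points of a restricted set fixed by \<open>Q\<close> are points of the original set fixed by \<open>h ` Q\<close>.  The
  identity passes from sets to their classes, to formal differences and to fractions.
\<close>

lemma res_p_marks:
  assumes "finite_group_prime G p" "finite_group_prime H p" "h \<in> hom H G"
    and X: "X \<in> carrier (burnside_ring_p p G)"
  shows "res_p p H h X \<in> carrier (burnside_ring_p p H)"
    and "subgroup Q H \<Longrightarrow> mark_p Q (res_p p H h X) = mark_p (h ` Q) X"
proof -
  interpret G: finite_group_prime G p by (rule assms(1))
  interpret H: finite_group_prime H p by (rule assms(2))
  interpret h: group_hom H G h by unfold_locales (rule assms(3))
  note restr = gset_restrict[OF G.is_group H.is_group assms(3)]
  have img: "subgroup (h ` Q) G" if "subgroup Q H" for Q
    using h.subgroup_img_is_subgroup[OF that] .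
  have res_cls: "res_class H h (G.gset_class Z) = H.gset_class (gset_restrict h Z)"
    if "Z \<in> finite_gsets G" for Z
    unfolding res_class_def using that G.gset_classD restr img
    by (intro UN_constant_on[OF G.gset_class_self] H.gset_class_eqI) auto
  have res_cls': "res_class H h A \<in> carrier (gset_semiring H)"
      "subgroup Q H \<Longrightarrow> mark_class Q (res_class H h A) = mark_class (h ` Q) A"
    if A: "A \<in> carrier (gset_semiring G)" for A Q
  proof -
    obtain Z where "Z \<in> finite_gsets G" "A = G.gset_class Z" using A by (rule G.semiring_carrierE)
    then show "res_class H h A \<in> carrier (gset_semiring H)"
      "subgroup Q H \<Longrightarrow> mark_class Q (res_class H h A) = mark_class (h ` Q) A"
      using restr img by (simp_all add: res_cls H.semiring_carrierI H.mark_class_gset_class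
        G.mark_class_gset_class)
  qed
  have groth: "res H h x \<in> carrier (burnside_ring H)"
      "subgroup Q H \<Longrightarrow> mark Q (res H h x) = mark (h ` Q) x"
    if x: "x \<in> carrier (burnside_ring G)" for x Q
  proof -
    obtain A B where AB: "A \<in> carrier (gset_semiring G)" "B \<in> carrier (gset_semiring G)"
        "x = G.semiring.groth_class A B"
      using x unfolding burnside_ring_def by (rule G.semiring.groth_carrierE)
    have eq: "H.semiring.groth_class (res_class H h A') (res_class H h B') =
        H.semiring.groth_class (res_class H h A) (res_class H h B)"
      if "(A', B') \<in> x" for A' B'
      using that unfolding AB(3)
      by (intro H.semiring.groth_class_eqI) (auto simp: G.semiring.groth_rel_iff res_cls' img)
    have r: "res H h x = H.semiring.groth_class (res_class H h A) (res_class H h B)"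
      unfolding res_def
    proof (rule UN_constant_on)
      show "(A, B) \<in> x" using AB by (simp add: G.semiring.groth_rel_iff)
    qed (use eq in \<open>simp only: split_paired_all prod.case\<close>)
    show "res H h x \<in> carrier (burnside_ring H)"
      unfolding r burnside_ring_def by (intro H.semiring.groth_carrierI res_cls' AB)
    show "mark Q (res H h x) = mark (h ` Q) x" if "subgroup Q H"
      unfolding r unfolding AB(3) using AB that img
      by (simp add: H.mark_eq_groth_mark H.semiring.groth_mark_class
        G.semiring.groth_mark_class res_cls')
  qed
  obtain x m where xm: "x \<in> carrier (burnside_ring G)" "m \<in> p_denominators p"
      "X = G.burnside.loc_class x m"
    using X unfolding burnside_ring_p_def by (rule G.burnside.loc_carrierE)
  have eq: "H.burnside.loc_class (res H h x') m' = H.burnside.loc_class (res H h x) m"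
    if "(x', m') \<in> X" for x' m'
    using that unfolding xm(3)
    by (intro H.burnside.loc_class_eqI) (auto simp: G.burnside.loc_rel_iff groth img)
  have r: "res_p p H h X = H.burnside.loc_class (res H h x) m"
    unfolding res_p_def
  proof (rule UN_constant_on)
    show "(x, m) \<in> X" using xm by (simp add: G.burnside.loc_rel_iff)
  qed (use eq in \<open>simp only: split_paired_all prod.case\<close>)
  show "res_p p H h X \<in> carrier (burnside_ring_p p H)"
    unfolding r burnside_ring_p_def by (intro H.burnside.loc_carrierI groth xm)
  show "mark_p Q (res_p p H h X) = mark_p (h ` Q) X" if "subgroup Q H"
    unfolding r unfolding xm(3) using xm that img
    by (simp add: H.mark_p_eq_loc_mark H.burnside.loc_mark_class G.burnside.loc_mark_class groth)
qed

section \<open>Counting with group actions\<close>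

context group
begin

lemma orbit_stabilizer_acts:
  assumes "acts G X a" "x \<in> X"
  shows "card (orbit G a x) * card (stabilizer G a x) = order G"
proof -
  interpret group_action G X "\<lambda>g. \<lambda>x\<in>X. a g x" by (rule acts_imp_group_action[OF assms(1)])
  have "orbit G (\<lambda>g. \<lambda>x\<in>X. a g x) x = orbit G a x"
      "stabilizer G (\<lambda>g. \<lambda>x\<in>X. a g x) x = stabilizer G a x"
    using assms(2) by (auto simp: orbit_def stabilizer_def)
  then show ?thesis using orbit_stabilizer_theorem[OF assms(2)] by simp
qed

text \<open>
  A property of sums over \<open>X\<close> that is closed under addition needs to be checked only for sums over
  single orbits.  The summands are functions of an index \<open>i\<close>, so that \<open>P\<close> can express that a function
  on subgroups is the mark function of an element; numbers are the case of a one-element index type.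
\<close>

lemma sum_over_orbits:
  fixes h :: "'x \<Rightarrow> 'i \<Rightarrow> 'k::comm_monoid_add"
  assumes "acts G X a" "finite X" "P (\<lambda>i. 0)"
    and plus: "\<And>f g. \<lbrakk>P f; P g\<rbrakk> \<Longrightarrow> P (\<lambda>i. f i + g i)"
    and orb: "\<And>x. x \<in> X \<Longrightarrow> P (\<lambda>i. \<Sum>y\<in>orbit G a x. h y i)"
  shows "P (\<lambda>i. \<Sum>y\<in>X. h y i)"
  using assms(1,2) orb
proof (induction "card X" arbitrary: X rule: less_induct)
  case less
  show ?case
  proof (cases "X = {}")
    case True
    then show ?thesis using assms(3) by simp
  next
    case False
    then obtain x where x: "x \<in> X" by blast
    let ?U = "orbit G a x"
    note U = acts_orbit[OF less.prems(1) x]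
    have "card (X - ?U) < card X"
      using x U(4) less.prems(2) by (intro psubset_card_mono) auto
    then have "P (\<lambda>i. \<Sum>y\<in>X - ?U. h y i)"
    proof (rule less.hyps)
      show "acts G (X - ?U) a" by (rule U(2))
      show "finite (X - ?U)" using less.prems(2) by simp
      show "P (\<lambda>i. \<Sum>y\<in>orbit G a z. h y i)" if "z \<in> X - ?U" for z
        using less.prems(3)[of z] that by simp
    qed
    then have "P (\<lambda>i. (\<Sum>y\<in>X - ?U. h y i) + (\<Sum>y\<in>?U. h y i))"
      using less.prems(3)[OF x] by (rule plus)
    moreover have "(\<lambda>i. \<Sum>y\<in>X. h y i) = (\<lambda>i. (\<Sum>y\<in>X - ?U. h y i) + (\<Sum>y\<in>?U. h y i))"
      by (rule ext, rule sum.subset_diff[OF U(3) less.prems(2)])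
    ultimately show ?thesis by metis
  qed
qed

lemma dvd_card_by_orbits:
  assumes "acts G X a" "finite X" "\<And>x. x \<in> X \<Longrightarrow> m dvd card (orbit G a x)"
  shows "m dvd card X"
proof -
  have "m dvd (\<Sum>y\<in>X. 1)"
    by (rule sum_over_orbits[where P = "\<lambda>f. m dvd f ()" and h = "\<lambda>_ _. 1", OF assms(1,2)])
       (use assms(3) in auto)
  then show ?thesis by simp
qed

lemma p_group_fixed_points:
  assumes "acts G X a" "finite X" "prime p" "order G = p ^ n"
  shows "p dvd card (X - fixed_set (carrier G) X a)"
proof (rule dvd_card_by_orbits)
  show "acts G (X - fixed_set (carrier G) X a) a"
  proof (rule acts_subset[OF assms(1)])
    fix g x assume g: "g \<in> carrier G" and x: "x \<in> X - fixed_set (carrier G) X a"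
    have "a g x \<notin> fixed_set (carrier G) X a"
    proof
      assume f: "a g x \<in> fixed_set (carrier G) X a"
      then have "a (inv g) (a g x) = a g x" using g by (auto simp: fixed_set_def)
      then have "x = a g x" using acts_inv[OF assms(1) g, of x] x by simp
      then show False using f x by simp
    qed
    then show "a g x \<in> X - fixed_set (carrier G) X a"
      using actsD(1)[OF assms(1) g] x by auto
  qed auto
  fix x assume x: "x \<in> X - fixed_set (carrier G) X a"
  have "card (orbit G a x) dvd p ^ n"
    using orbit_stabilizer_acts[OF assms(1), of x] x assms(4) by (metis DiffD1 dvd_triv_left)
  moreover have "card (orbit G a x) \<noteq> 1"
  proof
    assume "card (orbit G a x) = 1"
    then have "orbit G a x = {x}"
      using acts_orbit(4)[OF assms(1), of x] x by (metis DiffD1 card_1_singletonE singletonD)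
    then show False using x by (auto simp: orbit_def fixed_set_def)
  qed
  ultimately show "p dvd card (orbit G a x)"
    using assms(3) by (metis divides_primepow_nat dvd_power gr0I power_0)
qed (use assms in auto)

lemma l_coset_eq_iff:
  assumes "subgroup B G" "a \<in> carrier G" "b \<in> carrier G"
  shows "a <#\<^bsub>G\<^esub> B = b <#\<^bsub>G\<^esub> B \<longleftrightarrow> inv b \<otimes> a \<in> B"
proof
  interpret B: subgroup B G by (rule assms(1))
  assume "a <#\<^bsub>G\<^esub> B = b <#\<^bsub>G\<^esub> B"
  then have "a \<in> b <#\<^bsub>G\<^esub> B" using lcos_self[OF assms(2,1)] by simp
  then show "inv b \<otimes> a \<in> B"
    using assms by (auto simp: l_coset_def m_assoc[symmetric])
next
  interpret B: subgroup B G by (rule assms(1))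
  assume *: "inv b \<otimes> a \<in> B"
  then have "a = b \<otimes> (inv b \<otimes> a)" using assms by (simp add: m_assoc[symmetric])
  then have "a \<in> b <#\<^bsub>G\<^esub> B" using * by (auto simp: l_coset_def)
  then show "a <#\<^bsub>G\<^esub> B = b <#\<^bsub>G\<^esub> B" using l_repr_independence[OF _ assms(3,1)] by simp
qed

lemma coset_action:
  assumes "subgroup B G" "group H" "\<rho> \<in> hom H G"
  shows "acts H (lcosets B) (\<lambda>h C. \<rho> h <#\<^bsub>G\<^esub> C)"
    and "a \<in> carrier G \<Longrightarrow>
      stabilizer H (\<lambda>h C. \<rho> h <#\<^bsub>G\<^esub> C) (a <#\<^bsub>G\<^esub> B) = {h \<in> carrier H. inv a \<otimes> \<rho> h \<otimes> a \<in> B}"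
proof -
  interpret H: group H by (rule assms(2))
  interpret \<rho>: group_hom H G \<rho> by unfold_locales (rule assms(3))
  have sub: "B \<subseteq> carrier G" by (rule subgroup.subset[OF assms(1)])
  have trans: "x <#\<^bsub>G\<^esub> (b <#\<^bsub>G\<^esub> B) = (x \<otimes> b) <#\<^bsub>G\<^esub> B" if "x \<in> carrier G" "b \<in> carrier G" for x b
    using that sub by (simp add: lcos_m_assoc)
  show "acts H (lcosets B) (\<lambda>h C. \<rho> h <#\<^bsub>G\<^esub> C)"
    unfolding acts_def LCOSETS_def by (auto simp: trans m_assoc)
  assume a: "a \<in> carrier G"
  have "\<rho> h <#\<^bsub>G\<^esub> (a <#\<^bsub>G\<^esub> B) = a <#\<^bsub>G\<^esub> B \<longleftrightarrow> inv a \<otimes> \<rho> h \<otimes> a \<in> B" if "h \<in> carrier H" for h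
    using that a l_coset_eq_iff[OF assms(1), of "\<rho> h \<otimes> a" a] by (simp add: trans m_assoc)
  then show "stabilizer H (\<lambda>h C. \<rho> h <#\<^bsub>G\<^esub> C) (a <#\<^bsub>G\<^esub> B) = {h \<in> carrier H. inv a \<otimes> \<rho> h \<otimes> a \<in> B}"
    by (auto simp: stabilizer_def)
qed

text \<open>
  Sylow's conjugacy theorem, for the image of a \<open>p\<close>-group \<open>H\<close> under \<open>\<rho>\<close>: the number of cosets of \<open>B\<close> is
  prime to \<open>p\<close>, so \<open>H\<close> fixes a coset \<open>a B\<close>, which means that \<open>a\<close> conjugates the image into \<open>B\<close>.
\<close>

lemma p_subgroup_into_sylow:
  assumes fin: "finite (carrier G)" and p: "prime p"
    and syl: "subgroup B G" "card B = p ^ multiplicity p (order G)"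
    and H: "group H" "order H = p ^ n" "\<rho> \<in> hom H G"
  obtains a where "a \<in> carrier G" "\<And>h. h \<in> carrier H \<Longrightarrow> inv a \<otimes> \<rho> h \<otimes> a \<in> B"
proof -
  let ?X = "lcosets B" and ?a = "\<lambda>h C. \<rho> h <#\<^bsub>G\<^esub> C"
  note act = coset_action[OF syl(1) H(1,3)]
  have finX: "finite ?X" using fin by (simp add: LCOSETS_def)
  have ord: "card ?X * p ^ multiplicity p (order G) = order G"
    using l_lagrange[OF fin syl(1)] syl(2) by simp
  have pos: "order G \<noteq> 0" using fin order_gt_0_iff_finite by simp
  have "\<not> p dvd card ?X"
  proof
    assume "p dvd card ?X"
    then have "p ^ Suc (multiplicity p (order G)) dvd order G" using ord by (metis mult_dvd_mono dvd_refl power_Suc)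
    then have "Suc (multiplicity p (order G)) \<le> multiplicity p (order G)"
      using p pos by (intro multiplicity_geI) (auto simp: not_prime_unit)
    then show False by simp
  qed
  moreover have "p dvd card (?X - fixed_set (carrier H) ?X ?a)"
    by (rule group.p_group_fixed_points[OF H(1) act(1) finX p H(2)])
  ultimately obtain C where C: "C \<in> fixed_set (carrier H) ?X ?a"
    by (metis Diff_empty ex_in_conv)
  then obtain a where a: "a \<in> carrier G" "C = a <#\<^bsub>G\<^esub> B" by (auto simp: fixed_set_def LCOSETS_def)
  have "inv a \<otimes> \<rho> h \<otimes> a \<in> B" if "h \<in> carrier H" for h
    using C act(2)[OF a(1)] that unfolding a(2) by (auto simp: fixed_set_def stabilizer_def)
  then show thesis using that a by blast
qed

text \<open>
  In the action of \<open>D\<close> on the cosets of \<open>B\<close>, the stabilizer of \<open>a B\<close> is the set whose cardinality is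
  \<open>c\<close>.  So every orbit has \<open>card D / c\<close> elements, and this number divides the number of cosets.
\<close>

lemma
  assumes fin: "finite (carrier G)" and "subgroup B G" "subgroup D G"
    and c: "\<And>a. a \<in> carrier G \<Longrightarrow> card {d \<in> D. inv a \<otimes> d \<otimes> a \<in> B} = c"
  shows card_mult_dvd_if_conjugate_intersections_equal: "card D * card B dvd order G * c"
    and card_conjugate_intersection_dvd: "c dvd card D"
proof -
  let ?H = "G\<lparr>carrier := D\<rparr>" and ?a = "\<lambda>h C. id h <#\<^bsub>G\<^esub> C"
  have H: "group ?H" by (rule subgroup.subgroup_is_group[OF assms(3) is_group])
  have id: "id \<in> hom ?H G" using subgroup.subset[OF assms(3)] by (auto simp: hom_def)
  note act = coset_action[OF assms(2) H id]
  have finX: "finite (lcosets B)" using fin by (simp add: LCOSETS_def)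
  have orb: "card (orbit ?H ?a C) * c = card D" if C: "C \<in> lcosets B" for C
  proof -
    obtain a where a: "a \<in> carrier G" "C = a <#\<^bsub>G\<^esub> B" using C by (auto simp: LCOSETS_def)
    show ?thesis
      using group.orbit_stabilizer_acts[OF H act(1) C] act(2)[OF a(1)] c[OF a(1)] a(2)
      by (simp add: order_def)
  qed
  have "card D = card (orbit ?H ?a B) * c"
    using orb[of B] coset_mult_one[of B] lcos_mult_one[of B] subgroup.subset[OF assms(2)] one_closed
    unfolding LCOSETS_def by force
  moreover have "finite D" "\<one> \<in> D"
    using fin assms(3) subgroup.subset subgroup.one_closed by (auto intro: finite_subset)
  ultimately have "c \<noteq> 0" "card D \<noteq> 0" by (metis card_0_eq empty_iff mult_0_right)+
  show "c dvd card D" using \<open>card D = card (orbit ?H ?a B) * c\<close> by simp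
  have "card D div c dvd card (lcosets B)"
  proof (rule group.dvd_card_by_orbits[OF H act(1) finX])
    fix C assume "C \<in> lcosets B"
    then show "card D div c dvd card (orbit ?H ?a C)"
      unfolding orb[OF \<open>C \<in> lcosets B\<close>, symmetric] using \<open>c \<noteq> 0\<close> by simp
  qed
  moreover have "card D = card D div c * c"
    using \<open>card D = card (orbit ?H ?a B) * c\<close> \<open>c \<noteq> 0\<close> by simp
  ultimately have "card D dvd card (lcosets B) * c" by (metis mult_dvd_mono dvd_refl)
  then have "card D * card B dvd card (lcosets B) * c * card B" by (rule mult_dvd_mono) simp
  then show "card D * card B dvd order G * c" by (simp add: l_lagrange[OF fin assms(2), symmetric] ac_simps)
qed

lemma generate_fixed_set:
  assumes "acts G E a" "K \<subseteq> carrier G"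
  shows "fixed_set (generate G K) E a = fixed_set K E a"
proof
  show "fixed_set (generate G K) E a \<subseteq> fixed_set K E a"
    by (auto simp: fixed_set_def intro: generate.incl)
  show "fixed_set K E a \<subseteq> fixed_set (generate G K) E a"
  proof
    fix x assume x: "x \<in> fixed_set K E a"
    then have "x \<in> E" "K \<subseteq> stabilizer G a x" using assms(2) by (auto simp: fixed_set_def stabilizer_def)
    then have "generate G K \<subseteq> stabilizer G a x"
      using generate_subgroup_incl stabilizer_subgroup_acts[OF assms(1)] by blast
    then show "x \<in> fixed_set (generate G K) E a"
      using \<open>x \<in> E\<close> by (auto simp: fixed_set_def stabilizer_def)
  qed
qed

section \<open>Conjugation\<close>

lemma conj_map_closed [simp]:
  "\<lbrakk>x \<in> carrier G; g \<in> carrier G\<rbrakk> \<Longrightarrow> conj_map G x g \<in> carrier G"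
  by (simp add: conj_map_def)

lemma conj_map_mult:
  "\<lbrakk>x \<in> carrier G; y \<in> carrier G; g \<in> carrier G\<rbrakk> \<Longrightarrow> conj_map G (x \<otimes> y) g = conj_map G x (conj_map G y g)"
  by (simp add: conj_map_def m_assoc inv_mult_group)

lemma conj_map_hom: "x \<in> carrier G \<Longrightarrow> conj_map G x \<in> hom G G"
  by (rule homI) (simp_all add: conj_map_def m_assoc inv_solve_left)

lemma conj_map_one [simp]: "g \<in> carrier G \<Longrightarrow> conj_map G \<one> g = g"
  by (simp add: conj_map_def)

lemma conj_map_inv [simp]:
  "\<lbrakk>x \<in> carrier G; g \<in> carrier G\<rbrakk> \<Longrightarrow> conj_map G (inv x) (conj_map G x g) = g"
  "\<lbrakk>x \<in> carrier G; g \<in> carrier G\<rbrakk> \<Longrightarrow> conj_map G x (conj_map G (inv x) g) = g"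
  by (simp_all add: conj_map_mult[symmetric])

lemma conj_map_inj: "x \<in> carrier G \<Longrightarrow> inj_on (conj_map G x) (carrier G)"
  by (rule inj_on_inverseI[where g = "conj_map G (inv x)"]) simp

lemma conj_map_subgroup:
  assumes "x \<in> carrier G" "subgroup H G"
  shows "subgroup (conj_map G x ` H) G"
proof -
  interpret group_hom G G "conj_map G x" by unfold_locales (rule conj_map_hom[OF assms(1)])
  show ?thesis by (rule subgroup_img_is_subgroup[OF assms(2)])
qed

lemma conj_map_image_mult:
  "\<lbrakk>x \<in> carrier G; y \<in> carrier G; P \<subseteq> carrier G\<rbrakk> \<Longrightarrow>
    conj_map G (x \<otimes> y) ` P = conj_map G x ` conj_map G y ` P"
  by (force simp: image_image conj_map_mult)

lemma conj_map_image_one: "P \<subseteq> carrier G \<Longrightarrow> conj_map G \<one> ` P = P"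
  by (force simp: subset_eq)

lemma acts_conj_subgroups: "acts G {P. subgroup P G} (\<lambda>x P. conj_map G x ` P)"
  unfolding acts_def
proof (intro conjI ballI)
  fix P assume "P \<in> {P. subgroup P G}"
  then have P: "subgroup P G" by simp
  show "conj_map G \<one> ` P = P" by (rule conj_map_image_one[OF subgroup.subset[OF P]])
  fix g assume g: "g \<in> carrier G"
  show "conj_map G g ` P \<in> {P. subgroup P G}" using conj_map_subgroup[OF g P] by simp
  fix h assume "h \<in> carrier G"
  then show "conj_map G (g \<otimes> h) ` P = conj_map G g ` conj_map G h ` P"
    by (rule conj_map_image_mult[OF g _ subgroup.subset[OF P]])
qed

lemma normalizer_eq:
  assumes "P \<subseteq> carrier G"
  shows "normalizer G P = {x \<in> carrier G. conj_map G x ` P = P}"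
proof -
  have "x <#\<^bsub>G\<^esub> P #> inv x = conj_map G x ` P" for x
    by (auto simp: l_coset_def r_coset_def conj_map_def)
  then show ?thesis using assms by (auto simp: normalizer_def stabilizer_def)
qed

lemma normalizer_eq_stabilizer:
  "P \<subseteq> carrier G \<Longrightarrow> normalizer G P = stabilizer G (\<lambda>x P. conj_map G x ` P) P"
  by (simp add: normalizer_eq stabilizer_def)

lemma normalizerI:
  assumes "finite (carrier G)" "P \<subseteq> carrier G" "x \<in> carrier G" "conj_map G x ` P \<subseteq> P"
  shows "x \<in> normalizer G P"
proof -
  have "conj_map G x ` P = P"
    using assms conj_map_inj[OF assms(3)]
    by (metis (no_types, lifting) endo_inj_surj finite_subset inj_on_subset)
  then show ?thesis using assms by (simp add: normalizer_eq)
qed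

lemma normalizer_subgroup: "subgroup P G \<Longrightarrow> subgroup (normalizer G P) G"
  using normalizer_imp_subgroup[OF subgroup.subset] .

lemma subgroup_le_normalizer:
  assumes "subgroup P G"
  shows "P \<subseteq> normalizer G P"
proof
  interpret P: subgroup P G by (rule assms)
  fix x assume x: "x \<in> P"
  have "conj_map G y ` P \<subseteq> P" if "y \<in> P" for y
    using that by (auto simp: conj_map_def)
  then have *: "conj_map G x ` P \<subseteq> P" "conj_map G (inv x) ` P \<subseteq> P" using x by auto
  have "P \<subseteq> conj_map G x ` P"
  proof
    fix g assume "g \<in> P"
    then have "conj_map G (inv x) g \<in> P" "g = conj_map G x (conj_map G (inv x) g)"
      using * x P.subset by auto
    then show "g \<in> conj_map G x ` P" by blast
  qed
  then show "x \<in> normalizer G P" using * x P.subset by (auto simp: normalizer_eq)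
qed

lemma card_conjugates:
  assumes "subgroup P G"
  shows "card (orbit G (\<lambda>x P. conj_map G x ` P) P) * card (normalizer G P) = order G"
  using orbit_stabilizer_acts[OF acts_conj_subgroups] assms
  by (simp add: normalizer_eq_stabilizer subgroup.subset)

end

section \<open>Marks of coset spaces and congruences between marks\<close>

text \<open>
  The points \<open>a Q\<close> of \<open>G/Q\<close> fixed by \<open>R\<close> are the cosets of the elements \<open>a\<close> in this set.  Its
  cardinality is thus \<open>|Q|\<close> times the mark of \<open>G/Q\<close> at \<open>R\<close>, and is more convenient because it involves no
  cosets.
\<close>

definition transporter :: "('a, 'b) monoid_scheme \<Rightarrow> 'a set \<Rightarrow> 'a set \<Rightarrow> 'a set" where
  "transporter G R Q = {a \<in> carrier G. conj_map G (inv\<^bsub>G\<^esub> a) ` R \<subseteq> Q}"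

context finite_group
begin

text \<open>
  \<open>N\<close> acts on the \<open>P\<close>-fixed points of \<open>X\<close> because it normalizes \<open>P\<close>.  By the orbit-counting lemma the
  numbers of fixed points of the elements of \<open>N\<close> in this action sum to \<open>card N\<close> times the number of
  orbits.
\<close>

lemma fixed_points_congruence:
  assumes X: "X \<in> finite_gsets G" and P: "subgroup P G" and N: "subgroup N G"
    and "P \<subseteq> N" "N \<subseteq> normalizer G P"
  shows "card N dvd (\<Sum>n\<in>N. card (fixed_points (generate G (insert n P)) X))"
proof -
  obtain E a where X': "X = (E, a)" by (metis surj_pair)
  have E: "finite E" "acts G E a"
    using X X' group_action_imp_acts by (auto simp: finite_gsets_iff)
  have NG: "N \<subseteq> carrier G" and PG: "P \<subseteq> carrier G" using N P subgroup.subset by auto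
  let ?H = "G\<lparr>carrier := N\<rparr>" and ?F = "fixed_set P E a"
  have H: "group ?H" by (rule subgroup.subgroup_is_group[OF N is_group])
  have "a n x \<in> ?F" if n: "n \<in> N" and x: "x \<in> ?F" for n x
  proof -
    have nG: "n \<in> carrier G" and xE: "x \<in> E" using n NG x by (auto simp: fixed_set_def)
    have "a g (a n x) = a n x" if g: "g \<in> P" for g
    proof -
      have "n \<in> normalizer G P" using n assms by auto
      then obtain g' where g': "g' \<in> P" "g = conj_map G n g'"
        using g PG by (auto simp: normalizer_eq)
      then have "g \<otimes> n = n \<otimes> g'" using nG PG by (auto simp: conj_map_def m_assoc)
      then have "a g (a n x) = a n (a g' x)"
        using actsD(3)[OF E(2)] nG xE g g' PG by (metis subsetD)
      then show ?thesis using x g' by (simp add: fixed_set_def)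
    qed
    then show ?thesis using actsD(1)[OF E(2) nG xE] by (auto simp: fixed_set_def)
  qed
  moreover have "a (g \<otimes> h) x = a g (a h x)" if "g \<in> N" "h \<in> N" "x \<in> ?F" for g h x
    using actsD(3)[OF E(2)] that NG by (auto simp: fixed_set_def)
  moreover have "a \<one> x = x" if "x \<in> ?F" for x
    using actsD(2)[OF E(2)] that by (auto simp: fixed_set_def)
  ultimately have act: "acts ?H ?F a" by (simp add: acts_def)
  interpret act: group_action ?H ?F "\<lambda>g. \<lambda>x\<in>?F. a g x"
    by (rule group.acts_imp_group_action[OF H act])
  have "invariants ?F (\<lambda>g. \<lambda>x\<in>?F. a g x) n = fixed_points (generate G (insert n P)) X" if "n \<in> N" for n
  proof -
    have "insert n P \<subseteq> carrier G" using that NG PG by auto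
    then have "fixed_points (generate G (insert n P)) X = fixed_set (insert n P) E a"
      unfolding X' fixed_points_eq by (rule generate_fixed_set[OF E(2)])
    also have "\<dots> = {x \<in> ?F. a n x = x}" by (auto simp: fixed_set_def)
    finally show ?thesis by (auto simp: invariants_def)
  qed
  then have "(\<Sum>n\<in>N. card (fixed_points (generate G (insert n P)) X)) =
      card (orbits ?H ?F (\<lambda>g. \<lambda>x\<in>?F. a g x)) * card N"
    using act.burnside E finite_subset[OF NG finite_carrier] by (simp add: order_def fixed_set_def)
  then show ?thesis by simp
qed

lemma coset_marks:
  assumes Q: "subgroup Q G"
  shows "\<exists>x\<in>carrier (burnside_ring G). \<forall>R. subgroup R G \<longrightarrow>
    mark R x * int (card Q) = int (card (transporter G R Q))"
proof -
  have id: "id \<in> hom G G" by (auto simp: hom_def)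
  note act = coset_action[OF Q is_group id]
  have fin: "finite (lcosets Q)" using finite_carrier by (simp add: LCOSETS_def)
  obtain x where x: "x \<in> carrier (burnside_ring G)"
    "\<And>R. subgroup R G \<Longrightarrow> mark R x = int (card (fixed_set R (lcosets Q) (\<lambda>h C. id h <#\<^bsub>G\<^esub> C)))"
    using burnside_of_acts[OF fin act(1)] by metis
  have "card (fixed_set R (lcosets Q) (\<lambda>h C. id h <#\<^bsub>G\<^esub> C)) * card Q =
      card (transporter G R Q)" if R: "subgroup R G" for R
  proof -
    let ?F = "fixed_set R (lcosets Q) (\<lambda>h C. id h <#\<^bsub>G\<^esub> C)"
    have RG: "R \<subseteq> carrier G" by (rule subgroup.subset[OF R])
    have QG: "Q \<subseteq> carrier G" by (rule subgroup.subset[OF Q])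
    have memb: "a <#\<^bsub>G\<^esub> Q \<in> ?F \<longleftrightarrow> conj_map G (inv a) ` R \<subseteq> Q" if a: "a \<in> carrier G" for a
    proof -
      have "a <#\<^bsub>G\<^esub> Q \<in> lcosets Q" using a by (auto simp: LCOSETS_def)
      then have "a <#\<^bsub>G\<^esub> Q \<in> ?F \<longleftrightarrow> (\<forall>r\<in>R. r \<in> stabilizer G (\<lambda>h C. id h <#\<^bsub>G\<^esub> C) (a <#\<^bsub>G\<^esub> Q))"
        using RG by (auto simp: fixed_set_def stabilizer_def)
      also have "\<dots> \<longleftrightarrow> conj_map G (inv a) ` R \<subseteq> Q"
        unfolding act(2)[OF a] using RG a by (auto simp: conj_map_def)
      finally show ?thesis .
    qed
    have "transporter G R Q = \<Union>?F"
    proof (intro equalityI subsetI)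
      fix a assume "a \<in> transporter G R Q"
      then show "a \<in> \<Union>?F" using memb lcos_self[OF _ Q, of a] by (auto simp: transporter_def)
    next
      fix a assume "a \<in> \<Union>?F"
      then obtain C where C: "C \<in> ?F" "a \<in> C" by blast
      then obtain b where b: "b \<in> carrier G" "C = b <#\<^bsub>G\<^esub> Q" by (auto simp: fixed_set_def LCOSETS_def)
      have "a \<in> carrier G" using C b l_coset_subset_G[OF QG] by auto
      moreover have "C = a <#\<^bsub>G\<^esub> Q" using l_repr_independence[OF _ b(1) Q] C b by auto
      ultimately show "a \<in> transporter G R Q"
        using memb C by (auto simp: transporter_def)
    qed
    moreover have "card Q * card ?F = card (\<Union>?F)"
    proof (rule card_partition)
      have "?F \<subseteq> lcosets Q" by (auto simp: fixed_set_def)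
      then have F: "C \<in> lcosets Q" if "C \<in> ?F" for C using that by blast
      show "finite ?F" by (rule finite_subset[OF \<open>?F \<subseteq> lcosets Q\<close> fin])
      have "\<Union>?F \<subseteq> carrier G" using F lcosets_subset_PowG[OF Q] by blast
      then show "finite (\<Union>?F)" by (rule finite_subset[OF _ finite_carrier])
      show "card C = card Q" if "C \<in> ?F" for C
        using l_card_cosets_equal[OF F[OF that] QG finite_carrier] by simp
      show "C \<inter> C' = {}" if "C \<in> ?F" "C' \<in> ?F" "C \<noteq> C'" for C C'
        by (rule lcos_disjoint[OF Q F[OF that(1)] F[OF that(2)] that(3)])
    qed
    ultimately show ?thesis by (simp add: mult.commute)
  qed
  then have "mark R x * int (card Q) = int (card (transporter G R Q))"
    if "subgroup R G" for R
    unfolding x(2)[OF that] using that by (simp flip: of_nat_mult)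
  then show ?thesis using x(1) by blast
qed

end

sublocale finite_p_group \<subseteq> finite_group_prime G p
  by unfold_locales (rule finite_carrier, rule prime_p)

context finite_p_group
begin

lemma subgroup_card_power:
  assumes "subgroup H G"
  obtains k where "card H = p ^ k"
proof -
  obtain n where "order G = p ^ n" using order_prime_power by blast
  then have "card H dvd p ^ n"
    using lagrange[OF assms] by (metis dvd_triv_right)
  then show thesis using prime_p that by (metis divides_primepow_nat)
qed

text \<open>
  \<open>P\<close> acts on the cosets of \<open>P\<close>, and the fixed cosets are those of elements of the normalizer.  Their
  number is divisible by \<open>p\<close>, since the number of all cosets is, so \<open>P\<close> is not the only fixed one.
\<close>

lemma normalizer_grows:
  assumes P: "subgroup P G" and neq: "P \<noteq> carrier G"
  shows "P \<subset> normalizer G P"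
proof (rule ccontr)
  assume "\<not> P \<subset> normalizer G P"
  then have nP: "normalizer G P = P" using subgroup_le_normalizer[OF P] by blast
  have PG: "P \<subseteq> carrier G" by (rule subgroup.subset[OF P])
  let ?H = "G\<lparr>carrier := P\<rparr>" and ?a = "\<lambda>h C. id h <#\<^bsub>G\<^esub> C"
  have H: "group ?H" by (rule subgroup.subgroup_is_group[OF P is_group])
  have id: "id \<in> hom ?H G" using PG by (auto simp: hom_def)
  note act = coset_action[OF P H id]
  have fin: "finite (lcosets P)" using finite_carrier by (simp add: LCOSETS_def)
  obtain k where "order ?H = p ^ k" using subgroup_card_power[OF P] by (auto simp: order_def)
  then have p: "p dvd card (lcosets P - fixed_set P (lcosets P) ?a)"
    using group.p_group_fixed_points[OF H act(1) fin prime_p] by simp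
  have "fixed_set P (lcosets P) ?a = {P}"
  proof (intro equalityI subsetI)
    fix C assume "C \<in> fixed_set P (lcosets P) ?a"
    then obtain a where a: "a \<in> carrier G" "C = a <#\<^bsub>G\<^esub> P" "\<forall>h\<in>P. ?a h C = C"
      by (auto simp: fixed_set_def LCOSETS_def)
    then have "P \<subseteq> stabilizer ?H ?a (a <#\<^bsub>G\<^esub> P)" by (auto simp: stabilizer_def)
    then have "conj_map G (inv a) ` P \<subseteq> P"
      unfolding act(2)[OF a(1)] using a by (auto simp: conj_map_def)
    then have "inv a \<in> P" using normalizerI[OF finite_carrier PG, of "inv a"] a nP by auto
    then have "a \<in> P" using P a(1) subgroup.m_inv_closed by (metis inv_inv)
    then show "C \<in> {P}"
      using l_coset_eq_iff[OF P a(1) one_closed] lcos_mult_one[OF PG] a by simp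
  next
    fix C assume "C \<in> {P}"
    moreover have "P \<in> lcosets P" unfolding LCOSETS_def using lcos_mult_one[OF PG] one_closed by force
    ultimately show "C \<in> fixed_set P (lcosets P) ?a"
      using P PG by (auto simp: fixed_set_def coset_join3)
  qed
  moreover have "P \<in> lcosets P" unfolding LCOSETS_def using lcos_mult_one[OF PG] one_closed by force
  ultimately have one: "p dvd card (lcosets P) - 1" using p fin by simp
  have ord: "card (lcosets P) * card P = order G" by (rule l_lagrange[OF finite_carrier P])
  have "card P < order G"
    using PG neq finite_carrier by (simp add: order_def psubset_card_mono psubsetI)
  then have ne1: "card (lcosets P) \<noteq> 1" "card (lcosets P) \<noteq> 0" using ord by (cases "card (lcosets P)"; force)+
  obtain n where "order G = p ^ n" using order_prime_power by blast
  then have "card (lcosets P) dvd p ^ n" using ord by (metis dvd_triv_left)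
  then have "p dvd card (lcosets P)"
    using prime_p ne1 by (metis divides_primepow_nat dvd_power gr0I power_0)
  then have "p dvd 1" using one ne1 dvd_diff_nat[of p "card (lcosets P)" "card (lcosets P) - 1"] by simp
  then show False using prime_p by simp
qed

end

section \<open>Fusion systems and stable elements\<close>

context fusion_system
begin

lemma finite_sub: "subgroup P S \<Longrightarrow> finite P"
  using finite_subset[OF subgroup.subset finite_carrier] .

lemma finite_subgroups: "finite {P. subgroup P S}"
  by (rule finite_subset[of _ "Pow (carrier S)"]) (auto simp: finite_carrier dest: subgroup.subset)

lemma finite_group_prime_subgroup:
  assumes "subgroup P S"
  shows "finite_group_prime (S\<lparr>carrier := P\<rparr>) p"
proof -
  interpret P: group "S\<lparr>carrier := P\<rparr>" by (rule subgroup.subgroup_is_group[OF assms is_group])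
  show ?thesis by unfold_locales (use finite_sub[OF assms] prime_p in simp_all)
qed

lemma morphismD:
  assumes "subgroup P S" "subgroup Q S" "\<phi> \<in> F P Q"
  shows "x \<in> P \<Longrightarrow> \<phi> x \<in> Q" "\<lbrakk>x \<in> P; y \<in> P\<rbrakk> \<Longrightarrow> \<phi> (x \<otimes> y) = \<phi> x \<otimes> \<phi> y"
    "inj_on \<phi> P" "\<phi> \<in> extensional P" "\<phi> ` P \<subseteq> Q"
  using morphism[OF assms] by (auto simp: hom_def)

lemma morphism_group_hom:
  assumes "subgroup P S" "subgroup Q S" "\<phi> \<in> F P Q"
  shows "group_hom (S\<lparr>carrier := P\<rparr>) S \<phi>"
proof -
  interpret P: group "S\<lparr>carrier := P\<rparr>" by (rule subgroup.subgroup_is_group[OF assms(1) is_group])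
  show ?thesis
    by unfold_locales (use morphismD[OF assms] subgroup.subset[OF assms(2)] in \<open>auto simp: hom_def\<close>)
qed

lemma morphism_image_subgroup:
  assumes "subgroup P S" "subgroup Q S" "\<phi> \<in> F P Q" "subgroup R S" "R \<subseteq> P"
  shows "subgroup (\<phi> ` R) S"
  using group_hom.subgroup_img_is_subgroup[OF morphism_group_hom[OF assms(1-3)]]
    subgroup_incl[OF assms(4,1,5)] by blast

lemma morphism_inv:
  assumes "subgroup P S" "subgroup Q S" "\<phi> \<in> F P Q" "x \<in> P"
  shows "\<phi> (inv x) = inv (\<phi> x)"
  using group_hom.hom_inv[OF morphism_group_hom[OF assms(1-3)], of x] assms(4)
    m_inv_consistent[OF assms(1,4)] by simp

lemma morphism_conj_map:
  assumes "subgroup P S" "subgroup Q S" "\<phi> \<in> F P Q" "x \<in> P" "y \<in> P"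
  shows "\<phi> (conj_map S x y) = conj_map S (\<phi> x) (\<phi> y)"
  using morphismD[OF assms(1-3)] morphism_inv[OF assms(1-4)] assms(4,5)
    subgroup.m_closed[OF assms(1)] subgroup.m_inv_closed[OF assms(1)]
  by (simp add: conj_map_def)

lemma inclusion:
  assumes "subgroup P S" "subgroup Q S" "P \<subseteq> Q"
  shows "(\<lambda>x\<in>P. x) \<in> F P Q"
proof -
  have "restrict (conj_map S \<one>) P = (\<lambda>x\<in>P. x)"
    using subgroup.mem_carrier[OF assms(1)] by (auto simp: fun_eq_iff)
  moreover have "conj_map S \<one> ` P \<subseteq> Q"
    using conj_map_image_one[OF subgroup.subset[OF assms(1)]] assms(3) by simp
  ultimately show ?thesis using conjugation[OF assms(1,2) one_closed] by simp
qed

lemma morphism_enlarge: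
  assumes "subgroup P S" "subgroup Q S" "\<phi> \<in> F P Q" "subgroup R S" "Q \<subseteq> R"
  shows "\<phi> \<in> F P R"
proof -
  have "compose P (\<lambda>x\<in>Q. x) \<phi> = \<phi>"
    using morphismD[OF assms(1-3)] by (auto simp: fun_eq_iff compose_def extensional_def)
  then show ?thesis
    using composition[OF assms(1,2,4,3) inclusion[OF assms(2,4,5)]] by simp
qed

lemma morphism_restrict:
  assumes "subgroup P S" "subgroup Q S" "\<phi> \<in> F P Q" "subgroup R S" "R \<subseteq> P"
  shows "restrict \<phi> R \<in> F R (\<phi> ` R)"
proof -
  have "compose R \<phi> (\<lambda>x\<in>R. x) = restrict \<phi> R" by (auto simp: fun_eq_iff compose_def)
  then have *: "restrict \<phi> R \<in> F R Q"
    using composition[OF assms(4,1,2) inclusion[OF assms(4,1,5)] assms(3)] by simp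
  show ?thesis using onto_image[OF assms(4,2) *] by simp
qed

text \<open>
  Since every morphism of a fusion system is invertible onto its image, \<open>F\<close>-conjugacy can be witnessed
  by a single surjective morphism.
\<close>

lemma F_class_iff:
  assumes "subgroup P S"
  shows "Q \<in> F_class S F P \<longleftrightarrow> subgroup Q S \<and> (\<exists>\<phi>\<in>F P Q. \<phi> ` P = Q)"
proof -
  have "F_conjugate F P Q \<longleftrightarrow> (\<exists>\<phi>\<in>F P Q. \<phi> ` P = Q)" if Q: "subgroup Q S"
  proof
    assume "F_conjugate F P Q"
    then obtain \<phi> \<psi> where *: "\<phi> \<in> F P Q" "\<psi> \<in> F Q P" "compose Q \<phi> \<psi> = (\<lambda>x\<in>Q. x)"
      by (auto simp: F_conjugate_def)
    have "x \<in> \<phi> ` P" if "x \<in> Q" for x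
    proof -
      have "\<phi> (\<psi> x) = x" using fun_cong[OF *(3), of x] that by (simp add: compose_def)
      then show ?thesis using morphismD(1)[OF Q assms *(2) that] by force
    qed
    then have "Q \<subseteq> \<phi> ` P" by (rule subsetI)
    then have "\<phi> ` P = Q" using morphismD(5)[OF assms Q *(1)] by simp
    then show "\<exists>\<phi>\<in>F P Q. \<phi> ` P = Q" using * by blast
  next
    assume "\<exists>\<phi>\<in>F P Q. \<phi> ` P = Q"
    then obtain \<phi> where \<phi>: "\<phi> \<in> F P Q" "\<phi> ` P = Q" by blast
    have "restrict (inv_into P \<phi>) Q \<in> F Q P" using inverse[OF assms Q \<phi>(1)] \<phi>(2) by simp
    moreover have "compose P (restrict (inv_into P \<phi>) Q) \<phi> = (\<lambda>x\<in>P. x)"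
        "compose Q \<phi> (restrict (inv_into P \<phi>) Q) = (\<lambda>x\<in>Q. x)"
      using \<phi>(2) morphismD(3)[OF assms Q \<phi>(1)] f_inv_into_f[of _ \<phi> P]
      by (auto simp: fun_eq_iff compose_def)
    ultimately show "F_conjugate F P Q" unfolding F_conjugate_def using \<phi>(1) by blast
  qed
  then show ?thesis by (auto simp: F_class_def)
qed

lemma F_classE:
  assumes "subgroup P S" "Q \<in> F_class S F P"
  obtains \<phi> where "\<phi> \<in> F P Q" "\<phi> ` P = Q" "subgroup Q S"
  using assms F_class_iff by blast

lemma F_class_image:
  assumes "subgroup P S" "subgroup Q S" "\<phi> \<in> F P Q" "subgroup R S" "R \<subseteq> P"
  shows "\<phi> ` R \<in> F_class S F R"
  using morphism_restrict[OF assms] morphism_image_subgroup[OF assms]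
  unfolding F_class_iff[OF assms(4)] by (metis image_restrict_eq)

lemma F_class_subgroup: "Q \<in> F_class S F P \<Longrightarrow> subgroup Q S"
  by (simp add: F_class_def)

lemma F_class_refl:
  assumes P: "subgroup P S"
  shows "P \<in> F_class S F P"
proof -
  have "(\<lambda>x\<in>P. x) ` P = P" by simp
  then show ?thesis unfolding F_class_iff[OF P] using P inclusion[OF P P subset_refl] by blast
qed

lemma F_class_sym:
  assumes P: "subgroup P S" and "Q \<in> F_class S F P"
  shows "P \<in> F_class S F Q"
proof -
  have "F_conjugate F P Q" using assms(2) by (simp add: F_class_def)
  then have "F_conjugate F Q P" unfolding F_conjugate_def by blast
  then show ?thesis using P by (simp add: F_class_def)
qed

lemma F_class_trans:
  assumes P: "subgroup P S" and Q: "Q \<in> F_class S F P" and R: "R \<in> F_class S F Q"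
  shows "R \<in> F_class S F P"
proof -
  obtain \<phi> where \<phi>: "\<phi> \<in> F P Q" "\<phi> ` P = Q" "subgroup Q S" using F_classE[OF P Q] by blast
  obtain \<psi> where \<psi>: "\<psi> \<in> F Q R" "\<psi> ` Q = R" "subgroup R S" using F_classE[OF \<phi>(3) R] by blast
  have "compose P \<psi> \<phi> \<in> F P R" using composition P \<phi> \<psi> by blast
  moreover have "compose P \<psi> \<phi> ` P = R" using \<phi>(2) \<psi>(2) by (auto simp: compose_def)
  ultimately show ?thesis unfolding F_class_iff[OF P] using \<psi>(3) by blast
qed

lemma F_class_eq:
  assumes "subgroup P S" "Q \<in> F_class S F P"
  shows "F_class S F Q = F_class S F P"
proof -
  have Q: "subgroup Q S" by (rule F_class_subgroup[OF assms(2)])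
  show ?thesis
    using F_class_trans[OF Q F_class_sym[OF assms]] F_class_trans[OF assms] by blast
qed

lemma F_class_card:
  assumes "subgroup P S" "Q \<in> F_class S F P"
  shows "card Q = card P"
  using F_classE[OF assms] morphismD(3)[OF assms(1)] card_image by metis

lemma finite_F_class: "finite (F_class S F P)"
  by (rule finite_subset[OF _ finite_subgroups]) (auto simp: F_class_def)

lemma card_F_class_pos: "subgroup P S \<Longrightarrow> card (F_class S F P) > 0"
  using F_class_refl finite_F_class card_gt_0_iff by blast

lemma conj_F_class:
  assumes "subgroup P S" "x \<in> carrier S"
  shows "conj_map S x ` P \<in> F_class S F P"
proof -
  have Q: "subgroup (conj_map S x ` P) S" by (rule conj_map_subgroup[OF assms(2,1)])
  then show ?thesis
    unfolding F_class_iff[OF assms(1)]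
    using conjugation[OF assms(1) Q assms(2) subset_refl] by (metis image_restrict_eq)
qed

lemma acts_F_class: "acts S (F_class S F P) (\<lambda>x Q. conj_map S x ` Q)" if P: "subgroup P S"
proof (rule acts_subset[OF acts_conj_subgroups])
  show "F_class S F P \<subseteq> {P. subgroup P S}" by (auto simp: F_class_def)
  show "conj_map S x ` Q \<in> F_class S F P" if "x \<in> carrier S" "Q \<in> F_class S F P" for x Q
    by (rule F_class_trans[OF P that(2) conj_F_class[OF F_class_subgroup[OF that(2)] that(1)]])
qed

lemma normalizer_image:
  assumes "subgroup H S" "subgroup K S" "\<phi> \<in> F H K" "subgroup P S" "P \<subseteq> H" "H \<subseteq> normalizer S P"
  shows "\<phi> ` H \<subseteq> normalizer S (\<phi> ` P)"
proof
  fix y assume "y \<in> \<phi> ` H"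
  then obtain x where x: "x \<in> H" "y = \<phi> x" by blast
  have "subgroup (\<phi> ` P) S" by (rule morphism_image_subgroup[OF assms(1-5)])
  moreover have "y \<in> carrier S"
    using x morphismD(1)[OF assms(1-3)] subgroup.mem_carrier[OF assms(2)] by simp
  moreover have "conj_map S y ` \<phi> ` P \<subseteq> \<phi> ` P"
  proof -
    have "conj_map S y (\<phi> g) \<in> \<phi> ` P" if g: "g \<in> P" for g
    proof -
      have "conj_map S x g \<in> P"
        using x(1) g assms(6) by (auto simp: normalizer_eq[OF subgroup.subset[OF assms(4)]])
      then show ?thesis
        using morphism_conj_map[OF assms(1-3) x(1), of g] g assms(5) x(2) by (metis imageI subsetD)
    qed
    then show ?thesis by blast
  qed
  ultimately show "y \<in> normalizer S (\<phi> ` P)"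
    by (intro normalizerI[OF finite_carrier subgroup.subset])
qed

text \<open>
  By Burnside's theorem for the subgroup \<open>P\<close>, two restrictions to \<open>P\<close> agree when their marks at the
  subgroups \<open>Q\<close> of \<open>P\<close> do, and these are the marks of \<open>X\<close> at \<open>\<phi> ` Q\<close> and at \<open>Q\<close>.
\<close>

lemma stable_iff:
  assumes X: "X \<in> carrier (burnside_ring_p p S)"
  shows "stable S p F X \<longleftrightarrow>
    (\<forall>P. subgroup P S \<longrightarrow> (\<forall>Q\<in>F_class S F P. mark_p Q X = mark_p P X))"
proof
  assume st: "stable S p F X"
  show "\<forall>P. subgroup P S \<longrightarrow> (\<forall>Q\<in>F_class S F P. mark_p Q X = mark_p P X)"
  proof (intro allI impI ballI)
    fix P Q assume P: "subgroup P S" and Q: "Q \<in> F_class S F P"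
    obtain \<phi> where \<phi>: "\<phi> \<in> F P Q" "\<phi> ` P = Q" "subgroup Q S" using F_classE[OF P Q] by blast
    have \<phi>S: "\<phi> \<in> F P (carrier S)"
      using morphism_enlarge[OF P \<phi>(3,1) subgroup_self] subgroup.subset[OF \<phi>(3)] by blast
    note fgp = finite_group_prime_axioms finite_group_prime_subgroup[OF P]
    have h: "\<phi> \<in> hom (S\<lparr>carrier := P\<rparr>) S"
      using morphism_group_hom[OF P subgroup_self \<phi>S] by (simp add: group_hom_def group_hom_axioms_def)
    have i: "(\<lambda>x. x) \<in> hom (S\<lparr>carrier := P\<rparr>) S" using subgroup.subset[OF P] by (auto simp: hom_def)
    have P': "subgroup P (S\<lparr>carrier := P\<rparr>)" by (rule subgroup_incl[OF P P]) simp
    have "mark_p (\<phi> ` P) X = mark_p ((\<lambda>x. x) ` P) X"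
      using st P \<phi>S unfolding stable_def
      by (metis res_p_marks(2)[OF fgp h X P'] res_p_marks(2)[OF fgp i X P'])
    then show "mark_p Q X = mark_p P X" using \<phi>(2) by simp
  qed
next
  assume inv: "\<forall>P. subgroup P S \<longrightarrow> (\<forall>Q\<in>F_class S F P. mark_p Q X = mark_p P X)"
  show "stable S p F X"
    unfolding stable_def
  proof (intro allI impI ballI)
    fix P \<phi> assume P: "subgroup P S" and \<phi>: "\<phi> \<in> F P (carrier S)"
    note fgp = finite_group_prime_axioms finite_group_prime_subgroup[OF P]
    interpret P: finite_group_prime "S\<lparr>carrier := P\<rparr>" p by (rule fgp(2))
    have h: "\<phi> \<in> hom (S\<lparr>carrier := P\<rparr>) S"
      using morphism_group_hom[OF P subgroup_self \<phi>] by (simp add: group_hom_def group_hom_axioms_def)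
    have i: "(\<lambda>x. x) \<in> hom (S\<lparr>carrier := P\<rparr>) S" using subgroup.subset[OF P] by (auto simp: hom_def)
    show "res_p p (S\<lparr>carrier := P\<rparr>) \<phi> X = res_p p (S\<lparr>carrier := P\<rparr>) (\<lambda>x. x) X"
    proof (rule P.burnside_p.mark_eqI)
      fix Q assume "Q \<in> {Q. subgroup Q (S\<lparr>carrier := P\<rparr>)}"
      then have Q: "subgroup Q (S\<lparr>carrier := P\<rparr>)" by simp
      have QS: "subgroup Q S" "Q \<subseteq> P"
        using incl_subgroup[OF P Q] subgroup.subset[OF Q] by auto
      have "\<phi> ` Q \<in> F_class S F Q" by (rule F_class_image[OF P subgroup_self \<phi> QS])
      then show "mark_p Q (res_p p (S\<lparr>carrier := P\<rparr>) \<phi> X) =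
          mark_p Q (res_p p (S\<lparr>carrier := P\<rparr>) (\<lambda>x. x) X)"
        using inv QS(1) by (simp add: res_p_marks(2)[OF fgp h X Q] res_p_marks(2)[OF fgp i X Q])
    qed (use res_p_marks(1)[OF fgp h X] res_p_marks(1)[OF fgp i X] in auto)
  qed
qed

section \<open>Automorphism groups and fully normalized subgroups\<close>

lemma Aut_F_subgroup:
  assumes R: "subgroup R S"
  shows "subgroup (F R R) (BijGroup R)"
proof -
  interpret B: group "BijGroup R" by (rule group_BijGroup)
  have onto: "\<phi> ` R = R" if "\<phi> \<in> F R R" for \<phi>
    using morphismD[OF R R that] finite_sub[OF R] by (simp add: endo_inj_surj)
  have bij: "\<phi> \<in> Bij R" if "\<phi> \<in> F R R" for \<phi>
    using morphismD[OF R R that] onto[OF that] by (simp add: Bij_def bij_betw_def)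
  show ?thesis
  proof (rule B.subgroupI)
    show "F R R \<subseteq> carrier (BijGroup R)" using bij by (auto simp: BijGroup_def)
    show "F R R \<noteq> {}" using inclusion[OF R R] by blast
    show "inv\<^bsub>BijGroup R\<^esub> \<phi> \<in> F R R" if "\<phi> \<in> F R R" for \<phi>
      using inverse[OF R R that] onto[OF that] bij[OF that] by (simp add: inv_BijGroup)
    show "\<phi> \<otimes>\<^bsub>BijGroup R\<^esub> \<psi> \<in> F R R" if "\<phi> \<in> F R R" "\<psi> \<in> F R R" for \<phi> \<psi>
      using composition[OF R R R that(2,1)] bij that by (simp add: BijGroup_def)
  qed
qed

lemma Aut_F:
  assumes R: "subgroup R S"
  shows "group (Aut_F F R)" "carrier (Aut_F F R) = F R R" "finite (F R R)"
    and "\<lbrakk>\<alpha> \<in> F R R; \<beta> \<in> F R R\<rbrakk> \<Longrightarrow> \<alpha> \<otimes>\<^bsub>Aut_F F R\<^esub> \<beta> = compose R \<alpha> \<beta>"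
    and "\<one>\<^bsub>Aut_F F R\<^esub> = (\<lambda>x\<in>R. x)"
    and "\<alpha> \<in> F R R \<Longrightarrow> \<alpha> ` R = R"
    and "\<lbrakk>\<alpha> \<in> F R R; x \<in> R\<rbrakk> \<Longrightarrow> \<alpha> ((inv\<^bsub>Aut_F F R\<^esub> \<alpha>) x) = x"
    and "\<lbrakk>\<alpha> \<in> F R R; x \<in> R\<rbrakk> \<Longrightarrow> (inv\<^bsub>Aut_F F R\<^esub> \<alpha>) (\<alpha> x) = x"
    and "\<alpha> \<in> F R R \<Longrightarrow> inv\<^bsub>Aut_F F R\<^esub> \<alpha> \<in> F R R"
proof -
  note sub = Aut_F_subgroup[OF R]
  show G: "group (Aut_F F R)"
    unfolding Aut_F_def by (rule subgroup.subgroup_is_group[OF sub group_BijGroup])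
  interpret A: group "Aut_F F R" by (rule G)
  show C: "carrier (Aut_F F R) = F R R" and one: "\<one>\<^bsub>Aut_F F R\<^esub> = (\<lambda>x\<in>R. x)"
    by (simp_all add: Aut_F_def BijGroup_def)
  have bij: "F R R \<subseteq> Bij R" using subgroup.subset[OF sub] by (simp add: BijGroup_def)
  show M: "\<alpha> \<otimes>\<^bsub>Aut_F F R\<^esub> \<beta> = compose R \<alpha> \<beta>" if "\<alpha> \<in> F R R" "\<beta> \<in> F R R" for \<alpha> \<beta>
    using bij that by (auto simp: Aut_F_def BijGroup_def)
  show "\<alpha> ` R = R" if "\<alpha> \<in> F R R" for \<alpha>
    using bij that by (auto simp: Bij_def bij_betw_def)
  have inv: "inv\<^bsub>Aut_F F R\<^esub> \<alpha> \<in> F R R" if "\<alpha> \<in> F R R" for \<alpha>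
    using A.inv_closed[of \<alpha>] that C by simp
  then show "\<alpha> \<in> F R R \<Longrightarrow> inv\<^bsub>Aut_F F R\<^esub> \<alpha> \<in> F R R" .
  show "\<alpha> ((inv\<^bsub>Aut_F F R\<^esub> \<alpha>) x) = x" "(inv\<^bsub>Aut_F F R\<^esub> \<alpha>) (\<alpha> x) = x"
    if "\<alpha> \<in> F R R" "x \<in> R" for \<alpha> x
    using A.r_inv[of \<alpha>] A.l_inv[of \<alpha>] that C one M inv
    by (auto simp: compose_def fun_eq_iff dest!: spec[of _ x])
  have "F R R \<subseteq> R \<rightarrow>\<^sub>E R" using bij by (auto simp: Bij_def bij_betw_def PiE_def)
  then show "finite (F R R)" using finite_sub[OF R] finite_PiE[of R "\<lambda>_. R"] by (auto intro: finite_subset)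
qed

lemma exists_fully_normalized:
  assumes "subgroup P S"
  obtains Q where "Q \<in> F_class S F P" "fully_normalized S F Q"
proof -
  let ?n = "\<lambda>Q. card (normalizer S Q)"
  have "Max (?n ` F_class S F P) \<in> ?n ` F_class S F P"
    using F_class_refl[OF assms] finite_F_class by (intro Max_in) auto
  then obtain Q where Q: "Q \<in> F_class S F P" "?n Q = Max (?n ` F_class S F P)" by auto
  then have "fully_normalized S F Q"
    unfolding fully_normalized_def F_class_eq[OF assms Q(1)] using finite_F_class by simp
  then show thesis using that Q by blast
qed

end

context saturated_fusion_system
begin

text \<open>
  Any isomorphism \<open>\<chi>\<close> from \<open>Q\<close> to \<open>P\<close> turns conjugation by \<open>normalizer S Q\<close> into a \<open>p\<close>-group of automorphisms
  of \<open>P\<close>.  By Sylow's theorem an automorphism \<open>\<alpha>\<close> conjugates it into the Sylow subgroup \<open>Aut_S S P\<close>.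
  After composing \<open>\<chi>\<close> with the inverse of \<open>\<alpha>\<close>, conjugation by each element of \<open>normalizer S Q\<close> corresponds to
  conjugation by an element of \<open>S\<close>, and the extension axiom applies on all of \<open>normalizer S Q\<close>.
\<close>

lemma normalizer_extension:
  assumes P: "subgroup P S" and fn: "fully_normalized S F P" and Q: "Q \<in> F_class S F P"
  obtains \<psi> where "\<psi> \<in> F (normalizer S Q) (carrier S)" "\<psi> ` Q = P"
proof -
  have QS: "subgroup Q S" by (rule F_class_subgroup[OF Q])
  have QG: "Q \<subseteq> carrier S" and PG: "P \<subseteq> carrier S" using QS P subgroup.subset by auto
  obtain \<chi> where \<chi>: "\<chi> \<in> F Q P" "\<chi> ` Q = P" using F_classE[OF QS F_class_sym[OF P Q]] by blast
  define \<chi>' where "\<chi>' = restrict (inv_into Q \<chi>) P"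
  have \<chi>': "\<chi>' \<in> F P Q" using inverse[OF QS P \<chi>(1)] \<chi>(2) by (simp add: \<chi>'_def)
  have c1: "\<chi>' (\<chi> x) = x" if "x \<in> Q" for x
    using that \<chi>(2) morphismD(3)[OF QS P \<chi>(1)] by (auto simp: \<chi>'_def)
  have c2: "\<chi> (\<chi>' x) = x" if "x \<in> P" for x
    using that \<chi>(2) by (auto simp: \<chi>'_def f_inv_into_f)
  note in\<chi> = morphismD(1)[OF QS P \<chi>(1)] and in\<chi>' = morphismD(1)[OF P QS \<chi>']
  let ?N = "normalizer S Q" and ?A = "Aut_F F P"
  have N: "subgroup ?N S" by (rule normalizer_subgroup[OF QS])
  have NG: "?N \<subseteq> carrier S" by (rule subgroup.subset[OF N])
  have conjQ: "conj_map S x g \<in> Q" if "x \<in> ?N" "g \<in> Q" for x g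
    using that by (auto simp: normalizer_eq[OF QG])
  note A = Aut_F[OF P]
  interpret A: group ?A by (rule A(1))
  define \<rho> where "\<rho> x = compose P (compose Q \<chi> (restrict (conj_map S x) Q)) \<chi>'" for x
  have \<rho>_in: "\<rho> x \<in> F P P" if x: "x \<in> ?N" for x
  proof -
    have "restrict (conj_map S x) Q \<in> F Q Q"
      using conjugation[OF QS QS, of x] x NG conjQ by auto
    then show ?thesis unfolding \<rho>_def using composition QS P \<chi>(1) \<chi>' by blast
  qed
  have \<rho>: "\<rho> x y = \<chi> (conj_map S x (\<chi>' y))" if "y \<in> P" for x y
    using that in\<chi>' by (simp add: \<rho>_def compose_def)
  let ?H = "S\<lparr>carrier := ?N\<rparr>"
  have H: "group ?H" by (rule subgroup.subgroup_is_group[OF N is_group])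
  have "\<rho> \<in> hom ?H ?A"
  proof (rule homI)
    show "\<rho> x \<in> carrier ?A" if "x \<in> carrier ?H" for x using that \<rho>_in A(2) by simp
    fix x y assume "x \<in> carrier ?H" "y \<in> carrier ?H"
    then have xy: "x \<in> ?N" "y \<in> ?N" by auto
    have "\<rho> (x \<otimes> y) = compose P (\<rho> x) (\<rho> y)"
    proof
      fix z
      show "\<rho> (x \<otimes> y) z = compose P (\<rho> x) (\<rho> y) z"
      proof (cases "z \<in> P")
        case True
        have z: "\<chi>' z \<in> Q" using True in\<chi>' by simp
        have "\<rho> y z = \<chi> (conj_map S y (\<chi>' z))" using \<rho>[OF True] .
        moreover have "\<dots> \<in> P" using in\<chi> conjQ[OF xy(2) z] by simp
        ultimately have "\<rho> x (\<rho> y z) = \<chi> (conj_map S x (conj_map S y (\<chi>' z)))"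
          using \<rho> c1 conjQ[OF xy(2) z] by simp
        moreover have "\<chi>' z \<in> carrier S" using z QG by blast
        ultimately show ?thesis using xy NG True
          by (simp add: \<rho> compose_def conj_map_mult subset_iff)
      next
        case False
        then show ?thesis by (simp add: \<rho>_def compose_def)
      qed
    qed
    then show "\<rho> (x \<otimes>\<^bsub>?H\<^esub> y) = \<rho> x \<otimes>\<^bsub>?A\<^esub> \<rho> y" using A(4) \<rho>_in xy by simp
  qed
  moreover obtain n where "order ?H = p ^ n" using subgroup_card_power[OF N] by (auto simp: order_def)
  moreover have "subgroup (Aut_S S P) ?A" "card (Aut_S S P) = p ^ multiplicity p (order ?A)"
    using fully_normalized_imp[OF P fn] by (auto simp: sylow_subgroup_def)
  moreover have "finite (carrier ?A)" using A by simp
  ultimately obtain \<alpha> where \<alpha>: "\<alpha> \<in> F P P"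
    and \<alpha>B: "\<And>h. h \<in> ?N \<Longrightarrow> inv\<^bsub>?A\<^esub> \<alpha> \<otimes>\<^bsub>?A\<^esub> \<rho> h \<otimes>\<^bsub>?A\<^esub> \<alpha> \<in> Aut_S S P"
    using A.p_subgroup_into_sylow[OF _ prime_p _ _ H] A(2) by (metis partial_object.select_convs(1) partial_object.update_convs(1) partial_object.surjective)
  define \<alpha>' where "\<alpha>' = inv\<^bsub>?A\<^esub> \<alpha>"
  have \<alpha>': "\<alpha>' \<in> F P P" unfolding \<alpha>'_def by (rule A(9)[OF \<alpha>])
  have a1: "\<alpha> (\<alpha>' x) = x" "\<alpha>' (\<alpha> x) = x" if "x \<in> P" for x
    using A(7,8)[OF \<alpha> that] by (simp_all add: \<alpha>'_def)
  note in\<alpha> = morphismD(1)[OF P P \<alpha>] and in\<alpha>' = morphismD(1)[OF P P \<alpha>']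
  define \<phi> where "\<phi> = compose Q \<alpha>' \<chi>"
  have \<phi>: "\<phi> \<in> F Q P" unfolding \<phi>_def by (rule composition[OF QS P P \<chi>(1) \<alpha>'])
  have \<phi>Q: "\<phi> ` Q = P" using \<chi>(2) A(6)[OF \<alpha>'] by (auto simp: \<phi>_def compose_def)
  \<comment> \<open>Conjugation by \<open>x\<close> on \<open>Q\<close> becomes conjugation by the \<open>y\<close> that represents \<open>\<alpha>' \<rho>(x) \<alpha>\<close> in \<open>Aut_S S P\<close>.\<close>
  have "N_phi S Q \<phi> = ?N"
  proof -
    have "\<exists>y\<in>carrier S. \<forall>g\<in>Q. \<phi> (conj_map S x g) = conj_map S y (\<phi> g)" if x: "x \<in> ?N" for x
    proof -
      obtain y where y: "y \<in> normalizer S P" "\<alpha>' \<otimes>\<^bsub>?A\<^esub> \<rho> x \<otimes>\<^bsub>?A\<^esub> \<alpha> = restrict (conj_map S y) P"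
        using \<alpha>B[OF x] by (auto simp: Aut_S_def \<alpha>'_def)
      have yG: "y \<in> carrier S" using y subgroup.subset[OF normalizer_subgroup[OF P]] by blast
      have "\<alpha>' \<otimes>\<^bsub>?A\<^esub> \<rho> x \<otimes>\<^bsub>?A\<^esub> \<alpha> = compose P (compose P \<alpha>' (\<rho> x)) \<alpha>"
        using A(4) \<alpha>' \<rho>_in[OF x] \<alpha> composition[OF P P P] by simp
      then have e: "conj_map S y g = \<alpha>' (\<rho> x (\<alpha> g))" if "g \<in> P" for g
        using fun_cong[OF y(2), of g] that in\<alpha>[OF that] by (simp add: compose_def)
      have "\<phi> (conj_map S x g) = conj_map S y (\<phi> g)" if g: "g \<in> Q" for g
      proof -
        have "conj_map S y (\<phi> g) = \<alpha>' (\<rho> x (\<alpha> (\<alpha>' (\<chi> g))))"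
          using e[of "\<phi> g"] g in\<chi>[OF g] in\<alpha>' by (simp add: \<phi>_def compose_def)
        also have "\<dots> = \<alpha>' (\<chi> (conj_map S x g))"
          using in\<chi>[OF g] \<rho> c1[OF g] a1 by simp
        finally show ?thesis using conjQ[OF x g] by (simp add: \<phi>_def compose_def)
      qed
      then show ?thesis using yG by blast
    qed
    then show ?thesis by (auto simp: N_phi_def)
  qed
  moreover have "\<phi> \<in> F Q (carrier S)"
    by (rule morphism_enlarge[OF QS P \<phi> subgroup_self PG])
  moreover have "fully_centralized S F (\<phi> ` Q)" using fully_normalized_imp[OF P fn] \<phi>Q by simp
  ultimately obtain \<psi> where \<psi>: "\<psi> \<in> F ?N (carrier S)" "\<forall>x\<in>Q. \<psi> x = \<phi> x"
    using extension[OF QS] by metis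
  then have "\<psi> ` Q = P" using \<phi>Q by (metis image_cong)
  then show thesis using that \<psi>(1) by blast
qed

text \<open>
  The fibres of \<open>x \<mapsto> conj_map S x\<close>, restricted to \<open>R\<close>, are the left cosets of the centralizer of \<open>R\<close>.
\<close>

lemma card_conj_image:
  assumes H: "subgroup H S" and C: "centralizer S R \<subseteq> H" and R: "R \<subseteq> carrier S"
  shows "card ((\<lambda>x. restrict (conj_map S x) R) ` H) * card (centralizer S R) = card H"
proof -
  let ?f = "\<lambda>x. restrict (conj_map S x) R" and ?C = "centralizer S R"
  have HG: "H \<subseteq> carrier S" by (rule subgroup.subset[OF H])
  have finH: "finite H" by (rule finite_sub[OF H])
  have fiber: "card {x \<in> H. ?f x = ?f y} = card ?C" if y: "y \<in> H" for y
  proof -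
    have yG: "y \<in> carrier S" using y HG by blast
    have "{x \<in> H. ?f x = ?f y} = (\<lambda>c. y \<otimes> c) ` ?C"
    proof (intro equalityI subsetI)
      fix x assume "x \<in> {x \<in> H. ?f x = ?f y}"
      then have x: "x \<in> H" "?f x = ?f y" by auto
      have xG: "x \<in> carrier S" using x HG by blast
      have "inv y \<otimes> x \<in> ?C"
        unfolding centralizer_def
      proof (intro CollectI conjI ballI)
        show "inv y \<otimes> x \<in> carrier S" using xG yG by simp
        fix g assume g: "g \<in> R"
        have gG: "g \<in> carrier S" using g R by blast
        have "conj_map S x g = conj_map S y g" using fun_cong[OF x(2), of g] g by simp
        then have "conj_map S (inv y \<otimes> x) g = g" using xG yG gG by (simp add: conj_map_mult)
        then show "inv y \<otimes> x \<otimes> g = g \<otimes> (inv y \<otimes> x)"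
          unfolding conj_map_def using xG yG gG by (metis inv_closed inv_solve_right' m_closed)
      qed
      moreover have "x = y \<otimes> (inv y \<otimes> x)" using xG yG by (simp add: m_assoc[symmetric])
      ultimately show "x \<in> (\<lambda>c. y \<otimes> c) ` ?C" by blast
    next
      fix x assume "x \<in> (\<lambda>c. y \<otimes> c) ` ?C"
      then obtain c where c: "c \<in> ?C" "x = y \<otimes> c" by blast
      have cG: "c \<in> carrier S" "c \<in> H" using c C by (auto simp: centralizer_def)
      have "conj_map S x g = conj_map S y g" if g: "g \<in> R" for g
      proof -
        have gG: "g \<in> carrier S" using g R by blast
        have "c \<otimes> g = g \<otimes> c" using c(1) g by (simp add: centralizer_def)
        then have "conj_map S c g = g" unfolding conj_map_def using cG gG by (simp add: m_assoc)
        then show ?thesis using conj_map_mult[OF yG cG(1) gG] c(2) by simp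
      qed
      moreover have "x \<in> H" using c y cG subgroup.m_closed[OF H] by blast
      ultimately show "x \<in> {x \<in> H. ?f x = ?f y}" by (auto simp: fun_eq_iff)
    qed
    moreover have "inj_on (\<lambda>c. y \<otimes> c) ?C"
      using yG by (auto simp: inj_on_def centralizer_def)
    ultimately show ?thesis by (simp add: card_image)
  qed
  have "card H = (\<Sum>k\<in>?f ` H. \<Sum>x\<in>{x \<in> H. ?f x = k}. 1)"
    using sum.image_gen[OF finH, of "\<lambda>_. 1 :: nat" ?f] by simp
  also have "\<dots> = (\<Sum>k\<in>?f ` H. card ?C)"
    by (intro sum.cong refl) (use fiber in auto)
  finally show ?thesis by simp
qed

lemma centralizer_le_normalizer:
  assumes "P \<subseteq> R" "R \<subseteq> carrier S"
  shows "centralizer S R \<subseteq> normalizer S P"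
proof
  fix x assume x: "x \<in> centralizer S R"
  then have xG: "x \<in> carrier S" by (simp add: centralizer_def)
  have PG: "P \<subseteq> carrier S" using assms by blast
  have "conj_map S x g = g" if "g \<in> P" for g
  proof -
    have "x \<otimes> g = g \<otimes> x" "g \<in> carrier S" using x that assms by (auto simp: centralizer_def)
    then show ?thesis unfolding conj_map_def using xG by (simp add: m_assoc)
  qed
  then have "conj_map S x ` P \<subseteq> P" by auto
  then show "x \<in> normalizer S P" using normalizerI[OF finite_carrier PG xG] by blast
qed

section \<open>The size of an F-conjugacy class\<close>

text \<open>
  This compares \<open>p\<close>-parts: the orbit of \<open>P\<close> under the automorphisms of \<open>R\<close> has, up to factors prime to \<open>p\<close>,
  as many elements as \<open>R\<close> has cosets in its normalizer.  Let \<open>D\<close> be the stabilizer of \<open>P\<close> among the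
  automorphisms and \<open>?K\<close> the group of conjugations by elements of \<open>R\<close>.  Every image of \<open>P\<close> under an automorphism of
  \<open>R\<close> again has normalizer \<open>R\<close>, because \<open>P\<close> is fully normalized.  So each conjugate of the Sylow subgroup
  \<open>?B = Aut_S S R\<close> meets \<open>D\<close> exactly in \<open>?K\<close>.  By the coset count for \<open>D\<close> and \<open>?B\<close>, the index of \<open>?K\<close> in
  \<open>D\<close> is prime to \<open>p\<close>.  The orders of \<open>?B\<close> and \<open>?K\<close> are those of \<open>normalizer S R\<close> and \<open>R\<close> divided by that of the
  centralizer of \<open>R\<close>.
\<close>

lemma card_Aut_orbit:
  assumes P: "subgroup P S" and fnP: "fully_normalized S F P"
    and fnR: "fully_normalized S F (normalizer S P)"
  defines "R \<equiv> normalizer S P"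
  shows "\<exists>u d. \<not> p dvd u \<and> \<not> p dvd d \<and>
    card ((\<lambda>\<alpha>. \<alpha> ` P) ` F R R) * card R * d = card (normalizer S R) * u"
proof -
  let ?A = "Aut_F F R" and ?B = "Aut_S S R" and ?O = "(\<lambda>\<alpha>. \<alpha> ` P) ` F R R"
  have R: "subgroup R S" unfolding R_def by (rule normalizer_subgroup[OF P])
  have RG: "R \<subseteq> carrier S" by (rule subgroup.subset[OF R])
  have PR: "P \<subseteq> R" unfolding R_def by (rule subgroup_le_normalizer[OF P])
  have PG: "P \<subseteq> carrier S" using PR RG by blast
  note A = Aut_F[OF R]
  interpret A: group ?A by (rule A(1))
  have B: "subgroup ?B ?A" "card ?B = p ^ multiplicity p (order ?A)"
    using fully_normalized_imp[OF R] fnR by (auto simp: sylow_subgroup_def R_def)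
  have ordA: "order ?A \<noteq> 0" using A A.order_gt_0_iff_finite by simp
  obtain u where u: "order ?A = card ?B * u" "\<not> p dvd u"
    using multiplicity_decompose'[OF ordA, of p] prime_gt_1_nat[OF prime_p] B(2) by auto
  have act: "acts ?A (Pow R) (\<lambda>\<alpha> U. \<alpha> ` U)"
    unfolding acts_def
  proof (intro conjI ballI)
    fix U assume U: "U \<in> Pow R"
    show "\<one>\<^bsub>?A\<^esub> ` U = U" using U A(5) by auto
    fix \<alpha> assume \<alpha>: "\<alpha> \<in> carrier ?A"
    show "\<alpha> ` U \<in> Pow R" using U A(6)[of \<alpha>] \<alpha> A(2) by auto
    fix \<beta> assume "\<beta> \<in> carrier ?A"
    then show "(\<alpha> \<otimes>\<^bsub>?A\<^esub> \<beta>) ` U = \<alpha> ` \<beta> ` U"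
      using U \<alpha> A(2,4) by (force simp: compose_def)
  qed
  define D where "D = stabilizer ?A (\<lambda>\<alpha> U. \<alpha> ` U) P"
  have D_iff: "\<alpha> \<in> D \<longleftrightarrow> \<alpha> \<in> F R R \<and> \<alpha> ` P = P" for \<alpha> by (simp add: D_def stabilizer_def A(2))
  have D: "subgroup D ?A" unfolding D_def using A.stabilizer_subgroup_acts[OF act] PR by simp
  have OD: "card ?O * card D = order ?A"
  proof -
    have "orbit ?A (\<lambda>\<alpha> U. \<alpha> ` U) P = ?O" by (auto simp: orbit_def A(2))
    then show ?thesis using A.orbit_stabilizer_acts[OF act, of P] PR by (simp add: D_def)
  qed
  let ?K = "(\<lambda>x. restrict (conj_map S x) R) ` R"
  have conjR: "conj_map S x g \<in> R" if "x \<in> R" "g \<in> R" for x g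
    using that R by (simp add: conj_map_def subgroup.m_closed subgroup.m_inv_closed)
  have cF: "restrict (conj_map S x) R \<in> F R R" if "x \<in> R" for x
    using conjugation[OF R R] conjR that RG by auto
  have cAlpha: "\<alpha> \<otimes>\<^bsub>?A\<^esub> restrict (conj_map S x) R \<otimes>\<^bsub>?A\<^esub> inv\<^bsub>?A\<^esub> \<alpha> = restrict (conj_map S (\<alpha> x)) R"
    if \<alpha>: "\<alpha> \<in> F R R" and x: "x \<in> R" for \<alpha> x
  proof -
    have "\<alpha> \<otimes>\<^bsub>?A\<^esub> restrict (conj_map S x) R \<otimes>\<^bsub>?A\<^esub> inv\<^bsub>?A\<^esub> \<alpha> =
        compose R (compose R \<alpha> (restrict (conj_map S x) R)) (inv\<^bsub>?A\<^esub> \<alpha>)"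
      using A(4,9) \<alpha> cF[OF x] composition[OF R R R] by simp
    also have "\<dots> = restrict (conj_map S (\<alpha> x)) R"
    proof
      fix g
      show "compose R (compose R \<alpha> (restrict (conj_map S x) R)) (inv\<^bsub>?A\<^esub> \<alpha>) g = restrict (conj_map S (\<alpha> x)) R g"
      proof (cases "g \<in> R")
        case True
        then have *: "(inv\<^bsub>?A\<^esub> \<alpha>) g \<in> R" using morphismD(1)[OF R R A(9)[OF \<alpha>]] by simp
        show ?thesis
          using True * A(7)[OF \<alpha> True] morphism_conj_map[OF R R \<alpha> x *] by (simp add: compose_def)
      qed (simp add: compose_def)
    qed
    finally show ?thesis .
  qed
  \<comment> \<open>The restriction of \<open>conj_map S x\<close> to \<open>R\<close> that fixes an image of \<open>P\<close> must have \<open>x\<close> in \<open>R\<close>, the normalizer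
    of that image.  In the other direction, \<open>?K\<close> is normalized by all automorphisms.\<close>
  have int: "{d \<in> D. inv\<^bsub>?A\<^esub> \<alpha> \<otimes>\<^bsub>?A\<^esub> d \<otimes>\<^bsub>?A\<^esub> \<alpha> \<in> ?B} = ?K" if "\<alpha> \<in> carrier ?A" for \<alpha>
  proof -
    have \<alpha>: "\<alpha> \<in> F R R" using that A(2) by simp
    let ?i = "inv\<^bsub>?A\<^esub> \<alpha>"
    have i: "?i \<in> F R R" by (rule A(9)[OF \<alpha>])
    have NP2: "normalizer S (?i ` P) = R"
    proof -
      have "R \<subseteq> normalizer S (?i ` P)"
        using normalizer_image[OF R R i P PR] A(6)[OF i] by (simp add: R_def)
      moreover have cl: "?i ` P \<in> F_class S F P" by (rule F_class_image[OF R R i P PR])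
      then have "card (normalizer S (?i ` P)) \<le> card R"
        using fnP by (simp add: fully_normalized_def R_def)
      moreover have "finite (normalizer S (?i ` P))"
        using finite_sub[OF normalizer_subgroup[OF F_class_subgroup[OF cl]]] .
      ultimately show ?thesis by (metis card_seteq)
    qed
    have iPG: "?i ` P \<subseteq> carrier S" using morphismD(1)[OF R R i] PR RG by blast
    show ?thesis
    proof (intro equalityI subsetI)
      fix d assume "d \<in> {d \<in> D. ?i \<otimes>\<^bsub>?A\<^esub> d \<otimes>\<^bsub>?A\<^esub> \<alpha> \<in> ?B}"
      then have d: "d \<in> F R R" "d ` P = P" "?i \<otimes>\<^bsub>?A\<^esub> d \<otimes>\<^bsub>?A\<^esub> \<alpha> \<in> ?B" by (auto simp: D_iff)
      then obtain x where x: "x \<in> normalizer S R" "?i \<otimes>\<^bsub>?A\<^esub> d \<otimes>\<^bsub>?A\<^esub> \<alpha> = restrict (conj_map S x) R"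
        by (auto simp: Aut_S_def)
      have xG: "x \<in> carrier S" using x(1) subgroup.subset[OF normalizer_subgroup[OF R]] by blast
      have val: "conj_map S x g = ?i (d (\<alpha> g))" if "g \<in> R" for g
      proof -
        have "?i \<otimes>\<^bsub>?A\<^esub> d \<otimes>\<^bsub>?A\<^esub> \<alpha> = compose R (compose R ?i d) \<alpha>"
          using A(4) i d(1) \<alpha> composition[OF R R R] by simp
        then show ?thesis
          using fun_cong[OF x(2), of g] that morphismD(1)[OF R R \<alpha> that] by (simp add: compose_def)
      qed
      have "conj_map S x ` ?i ` P \<subseteq> ?i ` P"
      proof -
        have "conj_map S x (?i g) \<in> ?i ` P" if "g \<in> P" for g
        proof -
          have "g \<in> R" using that PR by blast
          then have "conj_map S x (?i g) = ?i (d g)"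
            using val morphismD(1)[OF R R i] A(7)[OF \<alpha>] by simp
          moreover have "d g \<in> P" using d(2) that by blast
          ultimately show ?thesis by simp
        qed
        then show ?thesis by blast
      qed
      then have xR: "x \<in> R" using normalizerI[OF finite_carrier iPG xG] NP2 by simp
      have "d = \<alpha> \<otimes>\<^bsub>?A\<^esub> (?i \<otimes>\<^bsub>?A\<^esub> d \<otimes>\<^bsub>?A\<^esub> \<alpha>) \<otimes>\<^bsub>?A\<^esub> ?i"
        using A.conjugation_is_surj[of \<alpha> d] \<alpha> d(1) A(2) by simp
      then have "d = restrict (conj_map S (\<alpha> x)) R" using x(2) cAlpha[OF \<alpha> xR] by simp
      then show "d \<in> ?K" using morphismD(1)[OF R R \<alpha> xR] by blast
    next
      fix d assume "d \<in> ?K"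
      then obtain y where y: "y \<in> R" "d = restrict (conj_map S y) R" by blast
      have "y \<in> normalizer S P" using y(1) by (simp add: R_def)
      then have "conj_map S y ` P = P" by (simp add: normalizer_eq[OF PG])
      then have "d ` P = P" using y(2) PR by (metis image_restrict_eq Int_absorb1 image_cong restrict_apply' subsetD)
      then have "d \<in> D" using D_iff cF[OF y(1)] y(2) by simp
      moreover have "inv\<^bsub>?A\<^esub> ?i = \<alpha>" using \<alpha> A(2) by simp
      then have "?i \<otimes>\<^bsub>?A\<^esub> d \<otimes>\<^bsub>?A\<^esub> \<alpha> = restrict (conj_map S (?i y)) R"
        using cAlpha[OF i y(1)] y(2) by simp
      then have "?i \<otimes>\<^bsub>?A\<^esub> d \<otimes>\<^bsub>?A\<^esub> \<alpha> \<in> ?B"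
        using morphismD(1)[OF R R i y(1)] subgroup_le_normalizer[OF R] by (auto simp: Aut_S_def)
      ultimately show "d \<in> {d \<in> D. ?i \<otimes>\<^bsub>?A\<^esub> d \<otimes>\<^bsub>?A\<^esub> \<alpha> \<in> ?B}" by simp
    qed
  qed
  have finA: "finite (carrier ?A)" using A by simp
  have dv: "card D * card ?B dvd order ?A * card ?K"
    by (rule A.card_mult_dvd_if_conjugate_intersections_equal[OF finA B(1) D]) (simp add: int)
  have "card ?K dvd card D"
    by (rule A.card_conjugate_intersection_dvd[OF finA B(1) D]) (simp add: int)
  then obtain d where d: "card D = card ?K * d" by blast
  have Bpos: "card ?B \<noteq> 0" and Kpos: "card ?K \<noteq> 0"
    using u(1) ordA OD d by (metis mult_0 mult_0_right)+
  have "d dvd u"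
    using dv unfolding d u(1) using Bpos Kpos by (simp add: ac_simps)
  then have nd: "\<not> p dvd d" using u(2) dvd_trans by blast
  let ?z = "card (centralizer S R)"
  have KR: "card ?K * ?z = card R"
    using card_conj_image[OF R _ RG] centralizer_le_normalizer[OF PR RG] by (simp add: R_def)
  have BN: "card ?B * ?z = card (normalizer S R)"
    using card_conj_image[OF normalizer_subgroup[OF R] _ RG] centralizer_le_normalizer[OF subset_refl RG]
    by (simp add: Aut_S_def)
  have eq: "card ?O * (card ?K * d) = card ?B * u" using OD d u(1) by metis
  have "card ?O * card R * d = card ?O * (card ?K * d) * ?z" unfolding KR[symmetric] by (simp only: ac_simps)
  also have "\<dots> = card (normalizer S R) * u" unfolding eq BN[symmetric] by (simp only: ac_simps)
  finally have "card ?O * card R * d = card (normalizer S R) * u" .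
  then show ?thesis using u(2) nd by blast
qed

end

context fusion_system
begin

lemma card_normalizer_conj:
  assumes x: "x \<in> carrier S" and Q: "subgroup Q S"
  shows "card (normalizer S (conj_map S x ` Q)) = card (normalizer S Q)"
proof -
  let ?c = "\<lambda>x P. conj_map S x ` P"
  have Q': "subgroup (?c x Q) S" by (rule conj_map_subgroup[OF x Q])
  have "card (normalizer S T) \<le> card (normalizer S (?c y T))"
    if y: "y \<in> carrier S" and T: "subgroup T S" for y T
  proof -
    note N = normalizer_subgroup[OF T]
    let ?\<phi> = "restrict (conj_map S y) (normalizer S T)"
    have c: "?\<phi> \<in> F (normalizer S T) (carrier S)"
      by (rule conjugation[OF N subgroup_self y subgroup.subset[OF conj_map_subgroup[OF y N]]])
    have "?\<phi> ` T = ?c y T" using subgroup_le_normalizer[OF T] by force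
    then have "?\<phi> ` normalizer S T \<subseteq> normalizer S (?c y T)"
      using normalizer_image[OF N subgroup_self c T subgroup_le_normalizer[OF T] subset_refl] by simp
    from card_mono[OF finite_sub[OF normalizer_subgroup[OF conj_map_subgroup[OF y T]]] this]
    show ?thesis using card_image[OF morphismD(3)[OF N subgroup_self c]] by simp
  qed
  from this[OF x Q] this[OF inv_closed[OF x] Q'] show ?thesis
    using acts_inv(1)[OF acts_conj_subgroups x, of Q] Q by simp
qed

lemma fully_normalized_iff:
  assumes P: "subgroup P S" and fn: "fully_normalized S F P" and Q: "Q \<in> F_class S F P"
  shows "fully_normalized S F Q \<longleftrightarrow> card (normalizer S Q) = card (normalizer S P)"
proof -
  have "F_class S F Q = F_class S F P" by (rule F_class_eq[OF P Q])
  then show ?thesis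
    using fn Q F_class_refl[OF P] unfolding fully_normalized_def by (metis le_antisym)
qed

end

context saturated_fusion_system
begin

text \<open>
  The fully normalized conjugates \<open>Q\<close> of \<open>P\<close> are sorted by their normalizer, which runs through the class
  of \<open>R\<close>.  An isomorphism from \<open>R\<close> to \<open>R'\<close> puts the \<open>Q\<close> with normalizer \<open>R'\<close> in bijection with the
  images of \<open>P\<close> under automorphisms of \<open>R\<close>.
\<close>

lemma card_fully_normalized_conjugates:
  assumes P: "subgroup P S" and fnP: "fully_normalized S F P"
  defines "R \<equiv> normalizer S P"
  shows "card {Q \<in> F_class S F P. fully_normalized S F Q} =
    card (F_class S F R) * card ((\<lambda>\<alpha>. \<alpha> ` P) ` F R R)"
proof -
  let ?O = "(\<lambda>\<alpha>. \<alpha> ` P) ` F R R" and ?QQ = "{Q \<in> F_class S F P. fully_normalized S F Q}"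
  have R: "subgroup R S" unfolding R_def by (rule normalizer_subgroup[OF P])
  have PR: "P \<subseteq> R" unfolding R_def by (rule subgroup_le_normalizer[OF P])
  have to_R: "\<exists>\<psi>\<in>F (normalizer S Q) R. \<psi> ` normalizer S Q = R \<and> \<psi> ` Q = P" if Q: "Q \<in> ?QQ" for Q
  proof -
    have Qc: "Q \<in> F_class S F P" and Qn: "fully_normalized S F Q" using Q by auto
    have QS: "subgroup Q S" by (rule F_class_subgroup[OF Qc])
    have N: "subgroup (normalizer S Q) S" by (rule normalizer_subgroup[OF QS])
    obtain \<psi> where \<psi>: "\<psi> \<in> F (normalizer S Q) (carrier S)" "\<psi> ` Q = P"
      by (rule normalizer_extension[OF P fnP Qc])
    have "\<psi> ` normalizer S Q \<subseteq> R"
      using normalizer_image[OF N subgroup_self \<psi>(1) QS subgroup_le_normalizer[OF QS] subset_refl]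
      by (simp add: \<psi>(2) R_def)
    moreover have "card (\<psi> ` normalizer S Q) = card R"
      using card_image[OF morphismD(3)[OF N subgroup_self \<psi>(1)]] fully_normalized_iff[OF P fnP Qc] Qn
      by (simp add: R_def)
    ultimately have "\<psi> ` normalizer S Q = R" by (simp add: card_subset_eq finite_sub[OF R])
    then show ?thesis using onto_image[OF N subgroup_self \<psi>(1)] \<psi>(2) by auto
  qed
  have fiber: "card {Q \<in> ?QQ. normalizer S Q = R'} = card ?O" if R': "R' \<in> F_class S F R" for R'
  proof -
    obtain \<theta> where \<theta>: "\<theta> \<in> F R R'" "\<theta> ` R = R'" and R'S: "subgroup R' S" by (rule F_classE[OF R R'])
    have "{Q \<in> ?QQ. normalizer S Q = R'} = (\<lambda>U. \<theta> ` U) ` ?O"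
    proof (intro equalityI subsetI)
      fix Q assume "Q \<in> {Q \<in> ?QQ. normalizer S Q = R'}"
      then have Q: "Q \<in> ?QQ" and NQ: "normalizer S Q = R'" by auto
      obtain \<psi> where \<psi>: "\<psi> \<in> F R' R" "\<psi> ` R' = R" "\<psi> ` Q = P" using to_R[OF Q] NQ by auto
      have "Q \<subseteq> R'"
        using subgroup_le_normalizer[of Q] F_class_subgroup Q NQ by blast
      define U where "U = {r \<in> R. \<theta> r \<in> Q}"
      have \<theta>U: "\<theta> ` U = Q" using \<theta>(2) \<open>Q \<subseteq> R'\<close> by (auto simp: U_def)
      define \<beta> where "\<beta> = compose R \<psi> \<theta>"
      have \<beta>: "\<beta> \<in> F R R" unfolding \<beta>_def by (rule composition[OF R R'S R \<theta>(1) \<psi>(1)])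
      have "\<beta> ` U = P"
      proof -
        have "\<beta> ` U = \<psi> ` \<theta> ` U" by (force simp: \<beta>_def compose_def U_def)
        then show ?thesis using \<theta>U \<psi>(3) by simp
      qed
      then have "(inv\<^bsub>Aut_F F R\<^esub> \<beta>) ` P = U"
        using Aut_F(8)[OF R \<beta>] by (force simp: U_def)
      then have "U \<in> ?O" using Aut_F(9)[OF R \<beta>] by blast
      then show "Q \<in> (\<lambda>U. \<theta> ` U) ` ?O" using \<theta>U by blast
    next
      fix Q assume "Q \<in> (\<lambda>U. \<theta> ` U) ` ?O"
      then obtain \<alpha> where \<alpha>: "\<alpha> \<in> F R R" "Q = \<theta> ` \<alpha> ` P" by blast
      define \<gamma> where "\<gamma> = compose R \<theta> \<alpha>"
      have \<gamma>: "\<gamma> \<in> F R R'" unfolding \<gamma>_def by (rule composition[OF R R R'S \<alpha>(1) \<theta>(1)])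
      have Q: "Q = \<gamma> ` P" using \<alpha>(2) PR by (force simp: \<gamma>_def compose_def)
      have "\<gamma> ` R = \<theta> ` \<alpha> ` R" by (force simp: \<gamma>_def compose_def)
      then have \<gamma>R: "\<gamma> ` R = R'" using \<theta>(2) Aut_F(6)[OF R \<alpha>(1)] by simp
      have Qc: "Q \<in> F_class S F P" unfolding Q by (rule F_class_image[OF R R'S \<gamma> P PR])
      have "R' \<subseteq> normalizer S Q"
        using normalizer_image[OF R R'S \<gamma> P PR] \<gamma>R Q by (simp add: R_def)
      moreover have "card (normalizer S Q) \<le> card R'"
        using fnP Qc F_class_card[OF R R'] by (simp add: fully_normalized_def R_def)
      ultimately have "normalizer S Q = R'"
        using finite_sub[OF normalizer_subgroup[OF F_class_subgroup[OF Qc]]] by (metis card_seteq)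
      moreover have "fully_normalized S F Q"
        using fully_normalized_iff[OF P fnP Qc] calculation F_class_card[OF R R'] by (simp add: R_def)
      ultimately show "Q \<in> {Q \<in> ?QQ. normalizer S Q = R'}" using Qc by simp
    qed
    moreover have "inj_on (\<lambda>U. \<theta> ` U) ?O"
    proof (rule inj_onI)
      fix U V assume "U \<in> ?O" "V \<in> ?O" and eq: "\<theta> ` U = \<theta> ` V"
      then have "U \<subseteq> R" "V \<subseteq> R" using PR Aut_F(6)[OF R] by blast+
      then show "U = V" using eq inj_on_image_eq_iff[OF morphismD(3)[OF R R'S \<theta>(1)]] by simp
    qed
    ultimately show ?thesis by (simp add: card_image)
  qed
  have "normalizer S ` ?QQ \<subseteq> F_class S F R"
  proof (rule image_subsetI)
    fix Q assume Q: "Q \<in> ?QQ"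
    have N: "subgroup (normalizer S Q) S" using normalizer_subgroup F_class_subgroup Q by blast
    have "R \<in> F_class S F (normalizer S Q)" using to_R[OF Q] R F_class_iff[OF N] by blast
    then show "normalizer S Q \<in> F_class S F R" by (rule F_class_sym[OF N])
  qed
  then have "(\<Sum>R'\<in>F_class S F R. \<Sum>Q\<in>{Q \<in> ?QQ. normalizer S Q = R'}. 1) = (\<Sum>Q\<in>?QQ. 1 :: nat)"
    using finite_F_class by (intro sum.group) auto
  then have "card ?QQ = (\<Sum>R'\<in>F_class S F R. card {Q \<in> ?QQ. normalizer S Q = R'})" by simp
  then show ?thesis using fiber by simp
qed

text \<open>
  Induction on the index of \<open>P\<close>.  The case \<open>P = S\<close> is trivial, and otherwise the normalizer of \<open>P\<close> is larger
  than \<open>P\<close>.  Given the induction hypothesis for a fully normalized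
  conjugate of this normalizer, the previous two counts determine the number of fully normalized conjugates of \<open>P\<close> up to factors prime to \<open>p\<close>.  The other conjugates have smaller
  normalizers, hence larger \<open>S\<close>-orbits, and do not affect the claim modulo \<open>p\<close>.
\<close>

theorem card_F_class_fully_normalized:
  assumes "subgroup P S" "fully_normalized S F P"
  shows "\<exists>k. \<not> p dvd k \<and> card (F_class S F P) * card (normalizer S P) = k * order S"
  using assms
proof (induction "order S - card P" arbitrary: P rule: less_induct)
  case less
  note P0 = \<open>subgroup P S\<close> and fn0 = \<open>fully_normalized S F P\<close>
  show ?case
  proof (cases "P = carrier S")
    case True
    have "Q = carrier S" if Q: "Q \<in> F_class S F P" for Q
      using F_class_card[OF P0 Q] subgroup.subset[OF F_class_subgroup[OF Q]] True
      by (simp add: card_subset_eq finite_carrier)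
    then have "F_class S F P = {carrier S}" using F_class_refl[OF P0] True by blast
    moreover have "normalizer S P = carrier S"
      using True subgroup_le_normalizer[OF P0] subgroup.subset[OF normalizer_subgroup[OF P0]] by blast
    ultimately show ?thesis using prime_p by (intro exI[of _ 1]) (auto simp: order_def)
  next
    case False
    define R0 where "R0 = normalizer S P"
    have R0: "subgroup R0 S" unfolding R0_def by (rule normalizer_subgroup[OF P0])
    have PR0: "P \<subset> R0" unfolding R0_def by (rule normalizer_grows[OF P0 False])
    obtain R where R: "R \<in> F_class S F R0" and fnR: "fully_normalized S F R"
      by (rule exists_fully_normalized[OF R0])
    obtain \<psi> where \<psi>: "\<psi> \<in> F R0 R" "\<psi> ` R0 = R" and RS: "subgroup R S" by (rule F_classE[OF R0 R])
    \<comment> \<open>\<open>P1\<close> replaces \<open>P\<close>: it is an equally good member of the class, and its normalizer is the fully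
      normalized group \<open>R\<close>, to which the induction hypothesis applies.\<close>
    define P1 where "P1 = \<psi> ` P"
    have P1c: "P1 \<in> F_class S F P"
      unfolding P1_def using PR0 by (intro F_class_image[OF R0 RS \<psi>(1) P0]) auto
    have P1: "subgroup P1 S" by (rule F_class_subgroup[OF P1c])
    have clsP1: "F_class S F P1 = F_class S F P" by (rule F_class_eq[OF P0 P1c])
    have NP1: "normalizer S P1 = R"
    proof -
      have "R \<subseteq> normalizer S P1"
        using normalizer_image[OF R0 RS \<psi>(1) P0] PR0 \<psi>(2) by (auto simp: R0_def P1_def)
      moreover have "card (normalizer S P1) \<le> card R"
        using fn0 P1c F_class_card[OF R0 R] by (simp add: fully_normalized_def R0_def)
      ultimately show ?thesis
        using finite_sub[OF normalizer_subgroup[OF P1]] by (metis card_seteq)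
    qed
    have cardR: "card R = card (normalizer S P)" using F_class_card[OF R0 R] by (simp add: R0_def)
    have fn1: "fully_normalized S F P1"
      using fully_normalized_iff[OF P0 fn0 P1c] NP1 cardR by simp
    have "card P < card R"
      using psubset_card_mono[OF finite_sub[OF R0] PR0] F_class_card[OF R0 R] by simp
    moreover have "card R \<le> order S"
      using card_mono[OF finite_carrier subgroup.subset[OF RS]] by (simp add: order_def)
    ultimately have "order S - card R < order S - card P" by simp
    then obtain k where k: "\<not> p dvd k" "card (F_class S F R) * card (normalizer S R) = k * order S"
      using less.hyps[OF _ RS fnR] by blast
    let ?O = "(\<lambda>\<alpha>. \<alpha> ` P1) ` F R R" and ?QQ = "{Q \<in> F_class S F P1. fully_normalized S F Q}"
    obtain u d where ud: "\<not> p dvd u" "\<not> p dvd d" "card ?O * card R * d = card (normalizer S R) * u"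
      using card_Aut_orbit[OF P1 fn1] fnR unfolding NP1 by blast
    have QQ: "card ?QQ = card (F_class S F R) * card ?O"
      using card_fully_normalized_conjugates[OF P1 fn1] unfolding NP1 .
    obtain n where n: "order S = p ^ n" using order_prime_power by blast
    obtain b where b: "card R = p ^ b" by (rule subgroup_card_power[OF RS])
    have p1: "p > 1" by (rule prime_gt_1_nat[OF prime_p])
    have bn: "b \<le> n"
      using \<open>card R \<le> order S\<close> power_le_imp_le_exp[OF p1, of b n] unfolding n b by blast
    have orb: "card (orbit S (\<lambda>x P. conj_map S x ` P) Q) * card (normalizer S Q) = p ^ n"
      if "Q \<in> F_class S F P1" for Q
      using card_conjugates[OF F_class_subgroup[OF that]] n by simp
    have fn_conj: "fully_normalized S F (conj_map S x ` Q) \<longleftrightarrow> fully_normalized S F Q"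
      and conj_in: "conj_map S x ` Q \<in> F_class S F P1"
      if x: "x \<in> carrier S" and Q: "Q \<in> F_class S F P1" for x Q
    proof -
      show c: "conj_map S x ` Q \<in> F_class S F P1" using actsD(1)[OF acts_F_class[OF P1] x Q] .
      show "fully_normalized S F (conj_map S x ` Q) \<longleftrightarrow> fully_normalized S F Q"
        using fully_normalized_iff[OF P1 fn1 c] fully_normalized_iff[OF P1 fn1 Q] card_normalizer_conj[OF x F_class_subgroup[OF Q]] by simp
    qed
    let ?rest = "{Q \<in> F_class S F P1. \<not> fully_normalized S F Q}"
    \<comment> \<open>With \<open>|S| = p ^ n\<close> and \<open>|R| = p ^ b\<close>, the \<open>S\<close>-orbits of fully normalized conjugates have \<open>p ^ (n - b)\<close> elements
      each, and the orbits of the other conjugates are larger by at least one factor \<open>p\<close>.\<close>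
    have "p ^ (n - b) dvd card ?QQ"
    proof (rule dvd_card_by_orbits)
      show "acts S ?QQ (\<lambda>x P. conj_map S x ` P)"
        by (rule acts_subset[OF acts_F_class[OF P1]]) (use fn_conj conj_in in auto)
      fix Q assume Q: "Q \<in> ?QQ"
      then have "card (normalizer S Q) = p ^ b" using fully_normalized_iff[OF P1 fn1, of Q] NP1 b by auto
      then have "card (orbit S (\<lambda>x P. conj_map S x ` P) Q) * p ^ b = p ^ (n - b) * p ^ b"
        using orb[of Q] Q bn by (simp flip: power_add)
      then show "p ^ (n - b) dvd card (orbit S (\<lambda>x P. conj_map S x ` P) Q)" using p1 by simp
    qed (use finite_F_class in auto)
    then obtain k' where k': "card ?QQ = p ^ (n - b) * k'" by blast
    have "p ^ Suc (n - b) dvd card ?rest"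
    proof (rule dvd_card_by_orbits)
      show "acts S ?rest (\<lambda>x P. conj_map S x ` P)"
        by (rule acts_subset[OF acts_F_class[OF P1]]) (use fn_conj conj_in in auto)
      fix Q assume Q: "Q \<in> ?rest"
      obtain c where c: "card (normalizer S Q) = p ^ c"
        using subgroup_card_power normalizer_subgroup F_class_subgroup Q by blast
      have "p ^ c < p ^ b"
        using fn1 fully_normalized_iff[OF P1 fn1, of Q] Q NP1 b c
        by (auto simp: fully_normalized_def order.order_iff_strict)
      then have cb: "c < b" using p1 by simp
      have "card (orbit S (\<lambda>x P. conj_map S x ` P) Q) * p ^ c = p ^ (n - c) * p ^ c"
        using orb[of Q] Q c cb bn by (simp flip: power_add)
      then have "card (orbit S (\<lambda>x P. conj_map S x ` P) Q) = p ^ (n - c)" using p1 by simp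
      then show "p ^ Suc (n - b) dvd card (orbit S (\<lambda>x P. conj_map S x ` P) Q)"
        using cb bn by (simp only:) (intro le_imp_power_dvd, simp)
    qed (use finite_F_class in auto)
    then obtain j where j: "card ?rest = p ^ Suc (n - b) * j" by blast
    have nb: "p ^ (n - b) * p ^ b = order S" using n bn by (simp flip: power_add)
    have "k' * d * order S = card ?QQ * card R * d" unfolding k' b nb[symmetric] by simp
    also have "\<dots> = card (F_class S F R) * (card ?O * card R * d)" unfolding QQ by simp
    also have "\<dots> = k * u * order S" unfolding ud(3) using k(2) by simp
    finally have "k' * d = k * u" using n p1 by simp
    then have nk': "\<not> p dvd k'" using k(1) ud(1) prime_p by (metis dvd_mult2 prime_dvd_mult_iff)
    have "F_class S F P = ?QQ \<union> ?rest" using clsP1 by auto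
    then have "card (F_class S F P) = card ?QQ + card ?rest"
      using finite_F_class by (simp only:) (intro card_Un_disjoint, auto)
    then have "card (F_class S F P) * card (normalizer S P) = (k' + p * j) * order S"
      unfolding cardR[symmetric] k' j b nb[symmetric] by (simp add: algebra_simps)
    moreover have "\<not> p dvd k' + p * j" using nk' by (simp add: dvd_add_left_iff)
    ultimately show ?thesis by blast
  qed
qed

end

section \<open>Rational numbers with denominator prime to p\<close>

definition p_integral :: "nat \<Rightarrow> rat \<Rightarrow> bool" where
  "p_integral p r \<longleftrightarrow> (\<exists>a m. m \<in> p_denominators p \<and> r = of_int a / of_int m)"

lemma p_integralE:
  assumes "p_integral p r"
  obtains a m where "m \<in> p_denominators p" "m \<noteq> 0" "r = of_int a / of_int m"
  using assms unfolding p_integral_def p_denominators_def by force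

context
  fixes p :: nat
  assumes p: "prime p"
begin

lemma p_integral_of_int: "p_integral p (of_int a)"
  unfolding p_integral_def using prime_gt_1_nat[OF p]
  by (intro exI[of _ a] exI[of _ 1]) (simp add: p_denominators_def)

lemma p_integral_mult:
  assumes "p_integral p r" "p_integral p s"
  shows "p_integral p (r * s)"
proof -
  obtain a m where r: "m \<in> p_denominators p" "r = of_int a / of_int m" using assms(1) by (rule p_integralE)
  obtain b n where s: "n \<in> p_denominators p" "s = of_int b / of_int n" using assms(2) by (rule p_integralE)
  have "r * s = of_int (a * b) / of_int (m * n)" using r s by simp
  moreover have "m * n \<in> p_denominators p"
    using r s p by (simp add: p_denominators_def prime_dvd_mult_iff)
  ultimately show ?thesis unfolding p_integral_def by blast
qed

lemma p_integral_add:
  assumes "p_integral p r" "p_integral p s"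
  shows "p_integral p (r + s)"
proof -
  obtain a m where r: "m \<in> p_denominators p" "m \<noteq> 0" "r = of_int a / of_int m" using assms(1) by (rule p_integralE)
  obtain b n where s: "n \<in> p_denominators p" "n \<noteq> 0" "s = of_int b / of_int n" using assms(2) by (rule p_integralE)
  have "r + s = of_int (a * n + b * m) / of_int (m * n)" using r s by (simp add: field_simps)
  moreover have "m * n \<in> p_denominators p"
    using r s p by (simp add: p_denominators_def prime_dvd_mult_iff)
  ultimately show ?thesis unfolding p_integral_def by blast
qed

lemma p_integral_diff:
  assumes "p_integral p r" "p_integral p s"
  shows "p_integral p (r - s)"
  using p_integral_add[OF assms(1) p_integral_mult[OF p_integral_of_int[of "-1"] assms(2)]] by simp

lemma p_integral_cancel:
  assumes "\<not> p dvd k" "p_integral p (of_nat k * r)"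
  shows "p_integral p r"
proof -
  have "int k \<in> p_denominators p" using assms(1) by (simp add: p_denominators_def)
  then have "p_integral p (1 / of_nat k)"
    unfolding p_integral_def by (intro exI[of _ 1] exI[of _ "int k"]) simp
  moreover have "k \<noteq> 0" using assms(1) by (auto intro: ccontr)
  ultimately show ?thesis using p_integral_mult[OF _ assms(2), of "1 / of_nat k"] by simp
qed

end

context finite_group
begin

section \<open>Marks with denominators prime to p\<close>

text \<open>
  The element \<open>x\<close> maps the \<open>Q\<close>-fixed points bijectively to the points fixed by the conjugate of \<open>Q\<close>.
\<close>

lemma card_fixed_points_conj:
  assumes "X \<in> finite_gsets G" "x \<in> carrier G" "Q \<subseteq> carrier G"
  shows "card (fixed_points (conj_map G x ` Q) X) = card (fixed_points Q X)"
proof -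
  obtain E a where X: "X = (E, a)" by (metis surj_pair)
  have act: "acts G E a" using assms(1) X group_action_imp_acts by (auto simp: finite_gsets_iff)
  have fixed_iff: "a (conj_map G x g) (a x e) = a x e \<longleftrightarrow> a g e = e" if "e \<in> E" "g \<in> Q" for e g
  proof -
    have g: "g \<in> carrier G" using that assms by blast
    have "conj_map G x g \<otimes> x = x \<otimes> g" using g assms(2) by (simp add: conj_map_def m_assoc)
    then have "a (conj_map G x g) (a x e) = a x (a g e)"
      using actsD(3)[OF act] g assms(2) that by (metis conj_map_closed)
    then show ?thesis
      using acts_inv(1)[OF act assms(2)] actsD(1)[OF act g that(1)] that(1) by metis
  qed
  have "a x ` fixed_set Q E a = fixed_set (conj_map G x ` Q) E a"
  proof (intro equalityI subsetI)
    fix e assume "e \<in> a x ` fixed_set Q E a"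
    then show "e \<in> fixed_set (conj_map G x ` Q) E a"
      using fixed_iff actsD(1)[OF act assms(2)] by (auto simp: fixed_set_def)
  next
    fix e assume e: "e \<in> fixed_set (conj_map G x ` Q) E a"
    let ?e = "a (inv x) e"
    have eE: "e \<in> E" using e by (simp add: fixed_set_def)
    have "?e \<in> E" "a x ?e = e"
      using actsD(1)[OF act _ eE, of "inv x"] acts_inv(2)[OF act assms(2) eE] assms(2) by auto
    moreover from this have "?e \<in> fixed_set Q E a" using fixed_iff[of ?e] e by (auto simp: fixed_set_def)
    ultimately show "e \<in> a x ` fixed_set Q E a" by (metis imageI)
  qed
  moreover have "inj_on (a x) (fixed_set Q E a)"
    using acts_inv(1)[OF act assms(2)] by (intro inj_on_inverseI[where g = "a (inv x)"]) (auto simp: fixed_set_def)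
  ultimately show ?thesis unfolding X fixed_points_eq by (metis card_image)
qed

end

context finite_group_prime
begin

lemma mark_p_conj:
  assumes X: "X \<in> carrier (burnside_ring_p p G)" and x: "x \<in> carrier G" and Q: "subgroup Q G"
  shows "mark_p (conj_map G x ` Q) X = mark_p Q X"
proof -
  obtain y m where y: "y \<in> carrier (burnside_ring G)"
    "\<And>Q. subgroup Q G \<Longrightarrow> mark_p Q X = of_int (mark Q y) / of_int m"
    using burnside_p_carrierE[OF X] by metis
  obtain A B where AB: "A \<in> finite_gsets G" "B \<in> finite_gsets G"
    "\<And>Q. subgroup Q G \<Longrightarrow> mark Q y = int (card (fixed_points Q A)) - int (card (fixed_points Q B))"
    using burnside_carrierE[OF y(1)] by metis
  have "subgroup (conj_map G x ` Q) G" by (rule conj_map_subgroup[OF x Q])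
  then show ?thesis
    using y(2) AB(3) Q card_fixed_points_conj[OF AB(1) x] card_fixed_points_conj[OF AB(2) x]
    by (simp add: subgroup.subset)
qed

lemma mark_p_congruence:
  assumes X: "X \<in> carrier (burnside_ring_p p G)" and P: "subgroup P G" and N: "subgroup N G"
    and "P \<subseteq> N" "N \<subseteq> normalizer G P"
  shows "p_integral p ((\<Sum>n\<in>N. mark_p (generate G (insert n P)) X) / of_nat (card N))"
proof -
  obtain y m where y: "y \<in> carrier (burnside_ring G)" "m \<in> p_denominators p"
    "\<And>Q. subgroup Q G \<Longrightarrow> mark_p Q X = of_int (mark Q y) / of_int m"
    using burnside_p_carrierE[OF X] by metis
  obtain A B where AB: "A \<in> finite_gsets G" "B \<in> finite_gsets G"
    "\<And>Q. subgroup Q G \<Longrightarrow> mark Q y = int (card (fixed_points Q A)) - int (card (fixed_points Q B))"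
    using burnside_carrierE[OF y(1)] by metis
  let ?g = "\<lambda>n. generate G (insert n P)"
  obtain k where k: "(\<Sum>n\<in>N. card (fixed_points (?g n) A)) = card N * k"
    using fixed_points_congruence[OF AB(1) P N assms(4,5)] by blast
  obtain l where l: "(\<Sum>n\<in>N. card (fixed_points (?g n) B)) = card N * l"
    using fixed_points_congruence[OF AB(2) P N assms(4,5)] by blast
  have gen: "subgroup (?g n) G" if "n \<in> N" for n
    using that subgroup.subset[OF N] subgroup.subset[OF P] by (intro generate_is_subgroup) auto
  have cN: "card N \<noteq> 0"
    using finite_subset[OF subgroup.subset[OF N] finite_carrier] subgroup.one_closed[OF N] by auto
  have "(\<Sum>n\<in>N. mark_p (?g n) X) = (\<Sum>n\<in>N. (of_nat (card (fixed_points (?g n) A)) - of_nat (card (fixed_points (?g n) B))) / of_int m)"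
    by (intro sum.cong refl) (simp add: y(3) AB(3) gen)
  also have "\<dots> = (of_nat (\<Sum>n\<in>N. card (fixed_points (?g n) A)) - of_nat (\<Sum>n\<in>N. card (fixed_points (?g n) B))) / of_int m"
    by (simp add: sum_divide_distrib[symmetric] sum_subtractf)
  also have "\<dots> / of_nat (card N) = of_int (int k - int l) / of_int m"
  proof -
    have "(of_nat (card N * k) - of_nat (card N * l) :: rat) = of_nat (card N) * of_int (int k - int l)"
      by (simp add: algebra_simps)
    then show ?thesis unfolding k l using cN by simp
  qed
  finally show ?thesis unfolding p_integral_def using y(2) by blast
qed

lemma burnside_p_scale:
  assumes x: "x \<in> carrier (burnside_ring G)" and r: "p_integral p r"
  obtains Y where "Y \<in> carrier (burnside_ring_p p G)"
    "\<And>Q. subgroup Q G \<Longrightarrow> mark_p Q Y = r * of_int (mark Q x)"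
proof -
  obtain a m where r: "m \<in> p_denominators p" "r = of_int a / of_int m" using r by (rule p_integralE)
  let ?ax = "add_pow (burnside_ring G) a x"
  have "?ax \<in> carrier (burnside_ring G)" using x by simp
  then obtain Y where Y: "Y \<in> carrier (burnside_ring_p p G)"
    "\<And>Q. subgroup Q G \<Longrightarrow> mark_p Q Y = of_int (mark Q ?ax) / of_int m"
    using burnside_p_carrierI[OF _ r(1)] by metis
  then show thesis using that[of Y] x r(2) by (simp add: burnside.mark_add_pow)
qed

end

section \<open>Averaging over F-conjugacy classes\<close>

definition F_average ::
  "('a, 'b) monoid_scheme \<Rightarrow> 'a homs \<Rightarrow> ('a set \<Rightarrow> rat) \<Rightarrow> 'a set \<Rightarrow> rat" where
  "F_average S F f Q = 1 / of_nat (card (F_class S F Q)) * (\<Sum>Q'\<in>F_class S F Q. f Q')"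

context fusion_system
begin

lemma F_average_class:
  assumes "subgroup Q S" "Q' \<in> F_class S F Q"
  shows "F_average S F f Q' = F_average S F f Q"
  by (simp add: F_average_def F_class_eq[OF assms])

lemma F_average_cong:
  assumes "\<And>Q. subgroup Q S \<Longrightarrow> f Q = g Q"
  shows "F_average S F f Q = F_average S F g Q"
  unfolding F_average_def using assms by (simp add: F_class_subgroup cong: sum.cong)

lemma F_average_mult_invariant:
  assumes "\<And>Q'. Q' \<in> F_class S F Q \<Longrightarrow> g Q' = g Q"
  shows "F_average S F (\<lambda>Q. f Q * g Q) Q = F_average S F f Q * g Q"
  unfolding F_average_def using assms by (simp add: sum_distrib_right[symmetric] cong: sum.cong)

lemma F_average_add: "F_average S F (\<lambda>Q. f Q + g Q) Q = F_average S F f Q + F_average S F g Q"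
  unfolding F_average_def by (simp add: sum.distrib algebra_simps)

lemma F_average_invariant:
  assumes "subgroup Q S" "\<And>Q'. Q' \<in> F_class S F Q \<Longrightarrow> f Q' = f Q"
  shows "F_average S F f Q = f Q"
  unfolding F_average_def using assms card_F_class_pos[OF assms(1)] by (simp cong: sum.cong)

text \<open>
  Each \<open>f Q'\<close> occurs on the left once for every member of its class, with the reciprocal of the class size as
  weight.
\<close>

lemma sum_F_average:
  assumes fin: "finite \<Q>" and sub: "\<And>Q. Q \<in> \<Q> \<Longrightarrow> subgroup Q S"
    and closed: "\<And>Q. Q \<in> \<Q> \<Longrightarrow> F_class S F Q \<subseteq> \<Q>"
  shows "(\<Sum>Q\<in>\<Q>. F_average S F f Q) = (\<Sum>Q\<in>\<Q>. f Q)"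
proof -
  have "F_average S F f Q = (\<Sum>Q'\<in>\<Q>. if Q' \<in> F_class S F Q then f Q' / of_nat (card (F_class S F Q')) else 0)"
    if Q: "Q \<in> \<Q>" for Q
  proof -
    have "F_average S F f Q = (\<Sum>Q'\<in>F_class S F Q. f Q' / of_nat (card (F_class S F Q')))"
      unfolding F_average_def using F_class_eq[OF sub[OF Q]]
      by (simp add: sum_divide_distrib cong: sum.cong)
    also have "\<dots> = (\<Sum>Q'\<in>\<Q> \<inter> F_class S F Q. f Q' / of_nat (card (F_class S F Q')))"
      using closed[OF Q] by (simp add: Int_absorb1)
    finally show ?thesis using fin by (simp add: sum.inter_restrict)
  qed
  then have "(\<Sum>Q\<in>\<Q>. F_average S F f Q) =
      (\<Sum>Q\<in>\<Q>. \<Sum>Q'\<in>\<Q>. if Q' \<in> F_class S F Q then f Q' / of_nat (card (F_class S F Q')) else 0)"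
    by simp
  also have "\<dots> = (\<Sum>Q'\<in>\<Q>. \<Sum>Q\<in>\<Q>. if Q' \<in> F_class S F Q then f Q' / of_nat (card (F_class S F Q')) else 0)"
    by (rule sum.swap)
  also have "\<dots> = (\<Sum>Q'\<in>\<Q>. f Q')"
  proof (rule sum.cong[OF refl])
    fix Q' assume Q': "Q' \<in> \<Q>"
    have "(\<Sum>Q\<in>\<Q>. if Q' \<in> F_class S F Q then f Q' / of_nat (card (F_class S F Q')) else 0) =
        (\<Sum>Q\<in>\<Q>. if Q \<in> F_class S F Q' then f Q' / of_nat (card (F_class S F Q')) else 0)"
      using F_class_sym sub Q' by (intro sum.cong refl) meson
    also have "\<dots> = (\<Sum>Q\<in>\<Q> \<inter> F_class S F Q'. f Q' / of_nat (card (F_class S F Q')))"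
      by (rule sum.inter_restrict[OF fin, symmetric])
    also have "\<dots> = f Q'"
      using closed[OF Q'] card_F_class_pos[OF sub[OF Q']] by (simp add: Int_absorb1)
    finally show "(\<Sum>Q\<in>\<Q>. if Q' \<in> F_class S F Q then f Q' / of_nat (card (F_class S F Q')) else 0) = f Q'" .
  qed
  finally show ?thesis .
qed

lemma card_subgroup_pos:
  assumes "subgroup H S"
  shows "0 < card H"
  using finite_sub[OF assms] subgroup.one_closed[OF assms] by (auto simp: card_gt_0_iff)

lemma card_transporter_conj:
  assumes "x \<in> carrier S" "R \<subseteq> carrier S" "Q \<subseteq> carrier S"
  shows "card (transporter S R (conj_map S x ` Q)) = card (transporter S R Q)"
proof -
  have le: "card (transporter S R Q) \<le> card (transporter S R (conj_map S y ` Q))"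
    if y: "y \<in> carrier S" and Q: "Q \<subseteq> carrier S" for y Q
  proof (rule card_inj_on_le[where f = "\<lambda>a. a \<otimes> inv y"])
    show "inj_on (\<lambda>a. a \<otimes> inv y) (transporter S R Q)"
      using y by (auto simp: inj_on_def transporter_def)
    show "finite (transporter S R (conj_map S y ` Q))"
      using finite_carrier by (auto simp: transporter_def)
    show "(\<lambda>a. a \<otimes> inv y) ` transporter S R Q \<subseteq> transporter S R (conj_map S y ` Q)"
    proof (rule image_subsetI)
      fix a assume "a \<in> transporter S R Q"
      then have a: "a \<in> carrier S" "conj_map S (inv a) ` R \<subseteq> Q" by (auto simp: transporter_def)
      have "conj_map S (inv (a \<otimes> inv y)) ` R = conj_map S y ` conj_map S (inv a) ` R"
        using a(1) y assms(2) by (simp add: inv_mult_group conj_map_image_mult)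
      then show "a \<otimes> inv y \<in> transporter S R (conj_map S y ` Q)"
        using a y by (auto simp: transporter_def)
    qed
  qed
  have conj_back: "conj_map S (inv x) ` conj_map S x ` Q = Q"
    using conj_map_image_mult[of "inv x" x Q] conj_map_image_one[of Q] assms by simp
  have sub: "conj_map S x ` Q \<subseteq> carrier S" using assms by auto
  show ?thesis
    using le[OF inv_closed[OF assms(1)] sub] unfolding conj_back by (intro antisym le assms)
qed

text \<open>
  The \<open>S\<close>-orbit of \<open>Q\<close> has \<open>|S| / |N Q|\<close> members, where \<open>N Q\<close> is the normalizer.  All of them contribute the
  same summand, and \<open>card (transporter S R Q)\<close> is \<open>|Q|\<close> times the mark of \<open>S/Q\<close> at \<open>R\<close>.  So the
  orbit contributes the mark of \<open>S/Q\<close> with coefficient \<open>|Q| d Q / |N Q|\<close>.  Summing over all \<open>Q\<close> instead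
  of representatives of the orbits avoids choices.
\<close>

lemma mark_vector_of_conj_invariant:
  assumes inv: "\<And>x Q. \<lbrakk>x \<in> carrier S; subgroup Q S\<rbrakk> \<Longrightarrow> d (conj_map S x ` Q) = d Q"
    and int: "\<And>Q. \<lbrakk>subgroup Q S; card Q = n\<rbrakk> \<Longrightarrow>
      p_integral p (of_nat (card Q) * d Q / of_nat (card (normalizer S Q)))"
  shows "\<exists>Y\<in>carrier (burnside_ring_p p S). \<forall>R. subgroup R S \<longrightarrow>
    mark_p R Y = (\<Sum>Q | subgroup Q S \<and> card Q = n. d Q * of_nat (card (transporter S R Q)) / of_nat (order S))"
proof -
  let ?X = "{Q. subgroup Q S \<and> card Q = n}" and ?c = "\<lambda>x Q. conj_map S x ` Q"
  let ?h = "\<lambda>Q R. d Q * of_nat (card (transporter S R Q)) / of_nat (order S)"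
  have conjX: "conj_map S x ` Q \<in> ?X" if "x \<in> carrier S" "Q \<in> ?X" for x Q
    using that conj_map_subgroup F_class_card[OF _ conj_F_class] by auto
  show ?thesis
  proof (rule sum_over_orbits[where X = ?X and a = ?c and h = ?h and
        P = "\<lambda>f. \<exists>Y\<in>carrier (burnside_ring_p p S). \<forall>R. subgroup R S \<longrightarrow> mark_p R Y = f R"])
    show "acts S ?X ?c" by (rule acts_subset[OF acts_conj_subgroups]) (use conjX in auto)
    show "finite ?X" by (rule finite_subset[OF _ finite_subgroups]) auto
    show "\<exists>Y\<in>carrier (burnside_ring_p p S). \<forall>R. subgroup R S \<longrightarrow> mark_p R Y = 0"
      using burnside_p.zero_in burnside_p.mark_zero by blast
    show "\<exists>Y\<in>carrier (burnside_ring_p p S). \<forall>R. subgroup R S \<longrightarrow> mark_p R Y = f R + g R"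
      if "\<exists>Y\<in>carrier (burnside_ring_p p S). \<forall>R. subgroup R S \<longrightarrow> mark_p R Y = f R"
        "\<exists>Y\<in>carrier (burnside_ring_p p S). \<forall>R. subgroup R S \<longrightarrow> mark_p R Y = g R" for f g
    proof -
      from that(1) obtain Y
        where "Y \<in> carrier (burnside_ring_p p S)" "\<forall>R. subgroup R S \<longrightarrow> mark_p R Y = f R" ..
      moreover from that(2) obtain Z
        where "Z \<in> carrier (burnside_ring_p p S)" "\<forall>R. subgroup R S \<longrightarrow> mark_p R Z = g R" ..
      ultimately show ?thesis
        by (intro bexI[of _ "Y \<oplus>\<^bsub>burnside_ring_p p S\<^esub> Z"])
           (auto simp: burnside_p.mark_add burnside_p.add_closed)
    qed
    fix Q assume "Q \<in> ?X"
    then have Q: "subgroup Q S" "card Q = n" by auto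
    have QG: "Q \<subseteq> carrier S" by (rule subgroup.subset[OF Q(1)])
    have nz: "order S \<noteq> 0" "card (normalizer S Q) \<noteq> 0" "card Q \<noteq> 0"
      using card_subgroup_pos subgroup_self normalizer_subgroup[OF Q(1)] Q(1)
      by (simp_all only: order_def) (metis less_irrefl)+
    obtain x where x: "x \<in> carrier (burnside_ring S)"
      "\<And>R. subgroup R S \<Longrightarrow> mark R x * int (card Q) = int (card (transporter S R Q))"
      using coset_marks[OF Q(1)] by blast
    obtain Y where Y: "Y \<in> carrier (burnside_ring_p p S)"
      "\<And>R. subgroup R S \<Longrightarrow>
        mark_p R Y = of_nat (card Q) * d Q / of_nat (card (normalizer S Q)) * of_int (mark R x)"
      using burnside_p_scale[OF x(1) int[OF Q]] by metis
    have "mark_p R Y = (\<Sum>Q'\<in>orbit S ?c Q. ?h Q' R)" if R: "subgroup R S" for R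
    proof -
      have RG: "R \<subseteq> carrier S" by (rule subgroup.subset[OF R])
      have "(\<Sum>Q'\<in>orbit S ?c Q. ?h Q' R) = (\<Sum>Q'\<in>orbit S ?c Q. ?h Q R)"
        using inv Q(1) card_transporter_conj[OF _ RG QG] by (intro sum.cong refl) (auto simp: orbit_def)
      also have "\<dots> = of_nat (card (orbit S ?c Q)) * ?h Q R" by simp
      also have "\<dots> = of_nat (card (orbit S ?c Q)) * (d Q * (of_int (mark R x) * of_nat (card Q))) /
          of_nat (order S)"
        using arg_cong[OF x(2)[OF R], of "of_int :: int \<Rightarrow> rat"] by simp
      also have "\<dots> = mark_p R Y"
      proof -
        have "(of_nat (card (orbit S ?c Q)) :: rat) * of_nat (card (normalizer S Q)) = of_nat (order S)"
          using card_conjugates[OF Q(1)] by (metis of_nat_mult)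
        then show ?thesis unfolding Y(2)[OF R] using nz
          by (simp add: divide_simps)
      qed
      finally show ?thesis by simp
    qed
    then show "\<exists>Y\<in>carrier (burnside_ring_p p S). \<forall>R. subgroup R S \<longrightarrow>
        mark_p R Y = (\<Sum>Q'\<in>orbit S ?c Q. ?h Q' R)" using Y(1) by blast
  qed
qed

end

context saturated_fusion_system
begin

section \<open>Integrality of the corrections\<close>

text \<open>
  The congruence for \<open>normalizer S Q\<close> acting on \<open>Q\<close>-fixed points is compared with the congruence for its image
  under \<open>\<psi>\<close> acting on \<open>P\<close>-fixed points.  An element \<open>n\<close> outside \<open>Q\<close> contributes to both the mark of a
  subgroup larger than \<open>Q\<close> or of its \<open>F\<close>-conjugate under \<open>\<psi>\<close>, and these agree by hypothesis.  Only the
  \<open>card Q\<close> terms from \<open>Q\<close> itself are left in the difference.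
\<close>

lemma mark_p_difference_integral:
  assumes X: "X \<in> carrier (burnside_ring_p p S)"
    and inv: "\<And>R R'. \<lbrakk>subgroup R S; card P < card R; R' \<in> F_class S F R\<rbrakk> \<Longrightarrow> mark_p R' X = mark_p R X"
    and P: "subgroup P S" and fn: "fully_normalized S F P" and Q: "Q \<in> F_class S F P"
  shows "p_integral p (of_nat (card Q) * (mark_p Q X - mark_p P X) / of_nat (card (normalizer S Q)))"
proof -
  have QS: "subgroup Q S" by (rule F_class_subgroup[OF Q])
  have QG: "Q \<subseteq> carrier S" by (rule subgroup.subset[OF QS])
  let ?N = "normalizer S Q"
  have N: "subgroup ?N S" by (rule normalizer_subgroup[OF QS])
  have QN: "Q \<subseteq> ?N" by (rule subgroup_le_normalizer[OF QS])
  obtain \<psi> where \<psi>: "\<psi> \<in> F ?N (carrier S)" "\<psi> ` Q = P"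
    by (rule normalizer_extension[OF P fn Q])
  interpret \<psi>: group_hom "S\<lparr>carrier := ?N\<rparr>" S \<psi>
    by (rule morphism_group_hom[OF N subgroup_self \<psi>(1)])
  have inj: "inj_on \<psi> ?N" by (rule morphismD(3)[OF N subgroup_self \<psi>(1)])
  have N': "subgroup (\<psi> ` ?N) S" by (rule morphism_image_subgroup[OF N subgroup_self \<psi>(1) N subset_refl])
  have N'P: "\<psi> ` ?N \<subseteq> normalizer S P"
    using normalizer_image[OF N subgroup_self \<psi>(1) QS QN subset_refl] \<psi>(2) by simp
  let ?g = "\<lambda>n. generate S (insert n Q)" and ?g' = "\<lambda>n. generate S (insert n P)"
  have gen: "subgroup (?g n) S" "?g n \<subseteq> ?N" "?g' (\<psi> n) = \<psi> ` ?g n" if n: "n \<in> ?N" for n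
  proof -
    have sub: "insert n Q \<subseteq> ?N" using n QN by simp
    then show "subgroup (?g n) S"
      using subgroup.subset[OF N] by (intro generate_is_subgroup) auto
    show "?g n \<subseteq> ?N" by (rule generate_subgroup_incl[OF sub N])
    have "generate (S\<lparr>carrier := ?N\<rparr>) (insert n Q) = ?g n"
      using generate_consistent[OF sub N] by simp
    then show "?g' (\<psi> n) = \<psi> ` ?g n"
      using \<psi>.generate_img[of "insert n Q"] sub \<psi>(2) by simp
  qed
  have same: "mark_p (?g' (\<psi> n)) X = mark_p (?g n) X" if n: "n \<in> ?N" "n \<notin> Q" for n
  proof -
    have "insert n Q \<subseteq> ?g n" by (auto intro: generate.incl)
    then have "Q \<subset> ?g n" using n(2) by blast
    then have "card P < card (?g n)"
      using psubset_card_mono[OF finite_sub[OF gen(1)[OF n(1)]], of Q] F_class_card[OF P Q] by simp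
    moreover have "\<psi> ` ?g n \<in> F_class S F (?g n)"
      by (rule F_class_image[OF N subgroup_self \<psi>(1) gen(1,2)[OF n(1)]])
    ultimately show ?thesis using inv[OF gen(1)[OF n(1)]] gen(3)[OF n(1)] by simp
  qed
  have gQ: "?g n = Q" "?g' (\<psi> n) = P" if n: "n \<in> Q" for n
  proof -
    have "insert n Q = Q" using n by auto
    then show *: "?g n = Q" using generate_subgroup_incl[OF _ QS, of Q] generate.incl[of _ Q S] by auto
    show "?g' (\<psi> n) = P" using gen(3)[of n] n QN \<psi>(2) * by auto
  qed
  have "p_integral p ((\<Sum>n\<in>?N. mark_p (?g n) X) / of_nat (card ?N))"
    by (rule mark_p_congruence[OF X QS N QN subset_refl])
  moreover have "p_integral p ((\<Sum>n\<in>?N. mark_p (?g' (\<psi> n)) X) / of_nat (card ?N))"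
  proof -
    have "P \<subseteq> \<psi> ` ?N" using \<psi>(2) QN by blast
    then have "p_integral p ((\<Sum>n\<in>\<psi> ` ?N. mark_p (?g' n) X) / of_nat (card (\<psi> ` ?N)))"
      by (rule mark_p_congruence[OF X P N' _ N'P])
    then show ?thesis by (simp add: sum.reindex[OF inj] card_image[OF inj] comp_def)
  qed
  ultimately have "p_integral p ((\<Sum>n\<in>?N. mark_p (?g n) X) / of_nat (card ?N) -
      (\<Sum>n\<in>?N. mark_p (?g' (\<psi> n)) X) / of_nat (card ?N))"
    by (rule p_integral_diff[OF prime_p])
  moreover have "(\<Sum>n\<in>?N. mark_p (?g n) X) - (\<Sum>n\<in>?N. mark_p (?g' (\<psi> n)) X) =
      of_nat (card Q) * (mark_p Q X - mark_p P X)"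
  proof -
    have "(\<Sum>n\<in>?N. mark_p (?g n) X) - (\<Sum>n\<in>?N. mark_p (?g' (\<psi> n)) X) =
        (\<Sum>n\<in>?N. mark_p (?g n) X - mark_p (?g' (\<psi> n)) X)" by (simp add: sum_subtractf)
    also have "\<dots> = (\<Sum>n\<in>Q. mark_p (?g n) X - mark_p (?g' (\<psi> n)) X)"
      by (rule sum.mono_neutral_right[OF finite_sub[OF N] QN]) (use same in auto)
    also have "\<dots> = (\<Sum>n\<in>Q. mark_p Q X - mark_p P X)" using gQ by simp
    finally show ?thesis by simp
  qed
  ultimately show ?thesis by (simp add: diff_divide_distrib[symmetric])
qed

text \<open>
  First the claim is shown for the fully normalized conjugate \<open>P\<close>.  In the sum of the differences
  \<open>m Q' - m P\<close> of marks over the class of \<open>P\<close>, each \<open>S\<close>-orbit contributes \<open>|S| / |N Q'|\<close> equal summands,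
  where \<open>N Q'\<close> is the normalizer.  So by \<open>mark_p_difference_integral\<close> the sum is \<open>|S| / |P|\<close> times
  a fraction with denominator prime to \<open>p\<close>.  Dividing by the size of the class, which is \<open>|S| / |N P|\<close>
  up to a factor prime to \<open>p\<close>, leaves \<open>|N P| / |P|\<close> times such a fraction.  Since \<open>P\<close> is fully normalized,
  \<open>|N Q|\<close> divides \<open>|N P|\<close>, and \<open>mark_p_difference_integral\<close> leads from \<open>P\<close> to \<open>Q\<close>.
\<close>

lemma average_difference_integral:
  assumes X: "X \<in> carrier (burnside_ring_p p S)"
    and inv: "\<And>R R'. \<lbrakk>subgroup R S; card Q < card R; R' \<in> F_class S F R\<rbrakk> \<Longrightarrow> mark_p R' X = mark_p R X"
    and Q: "subgroup Q S"
  shows "p_integral p (of_nat (card Q) * (F_average S F (\<lambda>Q. mark_p Q X) Q - mark_p Q X) /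
    of_nat (card (normalizer S Q)))"
proof -
  obtain P where Pc: "P \<in> F_class S F Q" and fn: "fully_normalized S F P"
    by (rule exists_fully_normalized[OF Q])
  have P: "subgroup P S" by (rule F_class_subgroup[OF Pc])
  have cls: "F_class S F P = F_class S F Q" by (rule F_class_eq[OF Q Pc])
  have cardPQ: "card P = card Q" by (rule F_class_card[OF Q Pc])
  have QcP: "Q \<in> F_class S F P" using cls F_class_refl[OF Q] by simp
  have nzP: "(of_nat (card (normalizer S P)) :: rat) \<noteq> 0" "(of_nat (card (normalizer S Q)) :: rat) \<noteq> 0"
    "(of_nat (card (F_class S F P)) :: rat) \<noteq> 0" "(of_nat (order S) :: rat) \<noteq> 0"
    using card_subgroup_pos[OF normalizer_subgroup[OF P]] card_subgroup_pos[OF normalizer_subgroup[OF Q]]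
      card_F_class_pos[OF P] card_subgroup_pos[OF subgroup_self]
    by (simp_all add: order_def)
  let ?m = "\<lambda>Q. mark_p Q X" and ?a = "F_average S F (\<lambda>Q. mark_p Q X) Q"
  let ?c = "\<lambda>x Q. conj_map S x ` Q"
  have diff: "p_integral p (of_nat (card P) * (?m Q' - ?m P) / of_nat (card (normalizer S Q')))"
    if Q': "Q' \<in> F_class S F P" for Q'
    using mark_p_difference_integral[OF X _ P fn Q'] inv F_class_card[OF P Q'] cardPQ by simp
  have "p_integral p (of_nat (card P) / of_nat (order S) * (\<Sum>Q'\<in>F_class S F P. ?m Q' - ?m P))"
  proof (rule sum_over_orbits[where X = "F_class S F P" and a = ?c and h = "\<lambda>Q' _. ?m Q' - ?m P" and
        P = "\<lambda>f. p_integral p (of_nat (card P) / of_nat (order S) * f ())"])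
    show "acts S (F_class S F P) ?c" by (rule acts_F_class[OF P])
    show "finite (F_class S F P)" by (rule finite_F_class)
    show "p_integral p (of_nat (card P) / of_nat (order S) * 0)"
      using p_integral_of_int[OF prime_p, of 0] by simp
    show "p_integral p (of_nat (card P) / of_nat (order S) * (f () + g ()))"
      if "p_integral p (of_nat (card P) / of_nat (order S) * f ())"
        "p_integral p (of_nat (card P) / of_nat (order S) * g ())" for f g
      using p_integral_add[OF prime_p that] by (simp add: distrib_left)
    fix Q' assume Q': "Q' \<in> F_class S F P"
    have Q'S: "subgroup Q' S" by (rule F_class_subgroup[OF Q'])
    have "(\<Sum>T\<in>orbit S ?c Q'. ?m T - ?m P) = (\<Sum>T\<in>orbit S ?c Q'. ?m Q' - ?m P)"
      using mark_p_conj[OF X _ Q'S] by (intro sum.cong refl) (auto simp: orbit_def)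
    moreover have "(of_nat (card (orbit S ?c Q')) :: rat) = of_nat (order S) / of_nat (card (normalizer S Q'))"
    proof -
      have "(of_nat (card (orbit S ?c Q')) :: rat) * of_nat (card (normalizer S Q')) = of_nat (order S)"
        using card_conjugates[OF Q'S] by (metis of_nat_mult)
      then show ?thesis
        using card_subgroup_pos[OF normalizer_subgroup[OF Q'S]] by (simp add: eq_divide_eq)
    qed
    ultimately show "p_integral p (of_nat (card P) / of_nat (order S) * (\<Sum>T\<in>orbit S ?c Q'. ?m T - ?m P))"
      using diff[OF Q'] nzP(4) by (simp add: ac_simps)
  qed
  moreover have "(\<Sum>Q'\<in>F_class S F P. ?m Q' - ?m P) = of_nat (card (F_class S F P)) * (?a - ?m P)"
    unfolding F_average_def cls[symmetric] using nzP(3) by (simp add: sum_subtractf field_simps)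
  moreover obtain k where k: "\<not> p dvd k" "card (F_class S F P) * card (normalizer S P) = k * order S"
    using card_F_class_fully_normalized[OF P fn] by blast
  have "(of_nat (card (F_class S F P)) :: rat) * of_nat (card (normalizer S P)) = of_nat k * of_nat (order S)"
    using k(2) by (metis of_nat_mult)
  then have "(of_nat (card (F_class S F P)) :: rat) = of_nat k * of_nat (order S) / of_nat (card (normalizer S P))"
    using nzP(1) by (simp add: eq_divide_eq)
  ultimately have "p_integral p (of_nat k * (of_nat (card P) * (?a - ?m P) / of_nat (card (normalizer S P))))"
    using nzP(4) by (simp add: ac_simps)
  then have aP: "p_integral p (of_nat (card P) * (?a - ?m P) / of_nat (card (normalizer S P)))"
    by (rule p_integral_cancel[OF prime_p k(1)])
  obtain b where b: "card (normalizer S P) = p ^ b" by (rule subgroup_card_power[OF normalizer_subgroup[OF P]])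
  obtain c where c: "card (normalizer S Q) = p ^ c" by (rule subgroup_card_power[OF normalizer_subgroup[OF Q]])
  have "card (normalizer S Q) \<le> card (normalizer S P)"
    using fn QcP unfolding fully_normalized_def by blast
  then have "p ^ c \<le> p ^ b" unfolding b c .
  then have "c \<le> b" by (rule power_le_imp_le_exp[OF prime_gt_1_nat[OF prime_p]])
  then have "card (normalizer S P) = p ^ (b - c) * card (normalizer S Q)"
    unfolding b c by (simp flip: power_add)
  then have NPQ: "(of_nat (card (normalizer S P)) :: rat) = of_nat (p ^ (b - c)) * of_nat (card (normalizer S Q))"
    by (metis of_nat_mult)
  have "p_integral p (of_nat (p ^ (b - c)) * (of_nat (card P) * (?a - ?m P) / of_nat (card (normalizer S P))))"
    using p_integral_mult[OF prime_p p_integral_of_int[OF prime_p, of "int (p ^ (b - c))"] aP] by simp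
  moreover have "of_nat (p ^ (b - c)) * (of_nat (card P) * (?a - ?m P) / of_nat (card (normalizer S P))) =
      of_nat (card P) * (?a - ?m P) / of_nat (card (normalizer S Q))"
    unfolding NPQ using nzP(2) prime_gt_0_nat[OF prime_p] by simp
  ultimately have "p_integral p (of_nat (card P) * (?a - ?m P) / of_nat (card (normalizer S Q)))" by simp
  from p_integral_diff[OF prime_p this diff[OF QcP]]
  show ?thesis unfolding cardPQ by (simp add: diff_divide_distrib[symmetric] algebra_simps)
qed

section \<open>The average of a mark function is a mark function\<close>

text \<open>
  One step of the descent: \<open>Y\<close> corrects the marks of \<open>X\<close> at the subgroups of order \<open>n\<close> to their average.
  Its own average vanishes at every \<open>R\<close>, because averaging the marks of \<open>S/Q\<close> over the class of \<open>R\<close>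
  yields, up to a factor that depends only on \<open>n\<close> and \<open>R\<close>, the number \<open>h Q\<close> of members of this class
  that are contained in \<open>Q\<close>.  This number depends only on the \<open>F\<close>-class of \<open>Q\<close>, while the corrections \<open>d Q\<close> sum to zero over each \<open>F\<close>-class.
\<close>

lemma stabilize_step:
  assumes X: "X \<in> carrier (burnside_ring_p p S)"
    and inv: "\<And>R R'. \<lbrakk>subgroup R S; n < card R; R' \<in> F_class S F R\<rbrakk> \<Longrightarrow> mark_p R' X = mark_p R X"
  shows "\<exists>X'\<in>carrier (burnside_ring_p p S).
    (\<forall>R R'. subgroup R S \<longrightarrow> n \<le> card R \<longrightarrow> R' \<in> F_class S F R \<longrightarrow> mark_p R' X' = mark_p R X') \<and>
    (\<forall>R. subgroup R S \<longrightarrow>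
      F_average S F (\<lambda>Q. mark_p Q X') R = F_average S F (\<lambda>Q. mark_p Q X) R)"
proof -
  let ?m = "\<lambda>Q. mark_p Q X" and ?a = "F_average S F (\<lambda>Q. mark_p Q X)"
  let ?Qs = "{Q. subgroup Q S \<and> card Q = n}"
  define d where "d Q = (if subgroup Q S then ?a Q - ?m Q else 0)" for Q
  have finQ: "finite ?Qs" by (rule finite_subset[OF _ finite_subgroups]) auto
  have d_conj: "d (conj_map S x ` Q) = d Q" if "x \<in> carrier S" "subgroup Q S" for x Q
    using mark_p_conj[OF X that] F_average_class[OF that(2) conj_F_class[OF that(2,1)]]
      conj_map_subgroup[OF that] that by (simp add: d_def)
  have "\<exists>Y\<in>carrier (burnside_ring_p p S). \<forall>R. subgroup R S \<longrightarrow>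
      mark_p R Y = (\<Sum>Q\<in>?Qs. d Q * of_nat (card (transporter S R Q)) / of_nat (order S))"
  proof (rule mark_vector_of_conj_invariant[OF d_conj])
    fix Q assume Q: "subgroup Q S" "card Q = n"
    show "p_integral p (of_nat (card Q) * d Q / of_nat (card (normalizer S Q)))"
      using average_difference_integral[OF X _ Q(1)] inv Q by (simp add: d_def)
  qed auto
  then obtain Y where Y: "Y \<in> carrier (burnside_ring_p p S)"
    "\<And>R. subgroup R S \<Longrightarrow>
      mark_p R Y = (\<Sum>Q\<in>?Qs. d Q * of_nat (card (transporter S R Q)) / of_nat (order S))"
    by blast
  let ?X' = "X \<oplus>\<^bsub>burnside_ring_p p S\<^esub> Y"
  have X': "?X' \<in> carrier (burnside_ring_p p S)" by (rule burnside_p.add_closed[OF X Y(1)])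
  have mX': "mark_p R ?X' = ?m R + mark_p R Y" if "subgroup R S" for R
    using burnside_p.mark_add[OF _ X Y(1)] that by simp
  have ordS: "(of_nat (order S) :: rat) \<noteq> 0"
    using card_subgroup_pos[OF subgroup_self] by (simp add: order_def)
  have card_conj: "card (conj_map S x ` R) = card R" if "x \<in> carrier S" "subgroup R S" for x R
    using F_class_card[OF that(2) conj_F_class[OF that(2,1)]] .
  have above: "mark_p R Y = 0" if R: "subgroup R S" "n < card R" for R
  proof -
    have "transporter S R Q = {}" if Q: "Q \<in> ?Qs" for Q
    proof -
      have "\<not> conj_map S (inv a) ` R \<subseteq> Q" if "a \<in> carrier S" for a
        using card_mono[OF finite_sub, of Q "conj_map S (inv a) ` R"] card_conj[of "inv a" R] that R Q by auto
      then show ?thesis by (auto simp: transporter_def)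
    qed
    then show ?thesis using Y(2)[OF R(1)] by simp
  qed
  \<comment> \<open>A conjugate of \<open>R\<close> of the same order as \<open>Q\<close> lies in \<open>Q\<close> only if it equals \<open>Q\<close>, so each \<open>x\<close> in \<open>S\<close> selects
    one summand, and this is \<open>d R\<close> by invariance under conjugation.\<close>
  have level: "mark_p R Y = d R" if R: "subgroup R S" "card R = n" for R
  proof -
    have "(\<Sum>Q\<in>?Qs. d Q * of_nat (card (transporter S R Q))) =
        (\<Sum>Q\<in>?Qs. \<Sum>x\<in>carrier S. if Q = conj_map S (inv x) ` R then d Q else 0)"
    proof (rule sum.cong[OF refl])
      fix Q assume Q: "Q \<in> ?Qs"
      have "conj_map S (inv x) ` R \<subseteq> Q \<longleftrightarrow> Q = conj_map S (inv x) ` R" if "x \<in> carrier S" for x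
        using card_subset_eq[OF finite_sub, of Q "conj_map S (inv x) ` R"] card_conj[of "inv x" R] that R Q
        by auto
      then have "transporter S R Q = carrier S \<inter> {x. Q = conj_map S (inv x) ` R}"
        by (auto simp: transporter_def)
      then show "d Q * of_nat (card (transporter S R Q)) =
          (\<Sum>x\<in>carrier S. if Q = conj_map S (inv x) ` R then d Q else 0)"
        using sum.inter_restrict[OF finite_carrier, of "\<lambda>_. d Q" "{x. Q = conj_map S (inv x) ` R}"]
        by (simp only: mem_Collect_eq sum_constant mult.commute)
    qed
    also have "\<dots> = (\<Sum>x\<in>carrier S. \<Sum>Q\<in>?Qs. if Q = conj_map S (inv x) ` R then d Q else 0)"
      by (rule sum.swap)
    also have "\<dots> = (\<Sum>x\<in>carrier S. d R)"
    proof (rule sum.cong[OF refl])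
      fix x assume x: "x \<in> carrier S"
      have "conj_map S (inv x) ` R \<in> ?Qs" using conj_map_subgroup[of "inv x" R] card_conj[of "inv x" R] x R by simp
      then show "(\<Sum>Q\<in>?Qs. if Q = conj_map S (inv x) ` R then d Q else 0) = d R"
        using finQ d_conj[of "inv x" R] x R by simp
    qed
    also have "\<dots> = of_nat (order S) * d R" by (simp add: order_def)
    finally show ?thesis
      using Y(2)[OF R(1)] ordS by (simp add: sum_divide_distrib[symmetric])
  qed
  have inv': "mark_p R' ?X' = mark_p R ?X'" if R: "subgroup R S" "n \<le> card R" "R' \<in> F_class S F R" for R R'
  proof -
    have R'S: "subgroup R' S" by (rule F_class_subgroup[OF R(3)])
    have cR: "card R' = card R" by (rule F_class_card[OF R(1,3)])
    show ?thesis
    proof (cases "card R = n")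
      case True
      then show ?thesis
        using level[OF R(1)] level[OF R'S] cR R(1) R'S F_average_class[OF R(1,3)] by (simp add: mX' d_def)
    next
      case False
      then have "n < card R" using R(2) by simp
      then show ?thesis using above[OF R(1)] above[OF R'S] cR R(1) R'S inv[OF R(1) _ R(3)] by (simp add: mX')
    qed
  qed
  have avgY: "F_average S F (\<lambda>Q. mark_p Q Y) R = 0" if R: "subgroup R S" for R
  proof -
    let ?C = "F_class S F R"
    define h where "h Q = card {T \<in> ?C. T \<subseteq> Q}" for Q
    \<comment> \<open>Conjugation by any fixed element of \<open>S\<close> permutes the class of \<open>R\<close>.\<close>
    have trans_sum: "(\<Sum>T\<in>?C. card (transporter S T Q)) = order S * h Q" for Q
    proof -
      have "(\<Sum>T\<in>?C. card (transporter S T Q)) =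
          (\<Sum>T\<in>?C. \<Sum>x\<in>carrier S. if conj_map S (inv x) ` T \<subseteq> Q then 1 else 0)"
        using finite_carrier by (intro sum.cong refl) (simp add: sum.If_cases transporter_def Int_def)
      also have "\<dots> = (\<Sum>x\<in>carrier S. \<Sum>T\<in>?C. if conj_map S (inv x) ` T \<subseteq> Q then 1 else 0)"
        by (rule sum.swap)
      also have "\<dots> = (\<Sum>x\<in>carrier S. h Q)"
      proof (rule sum.cong[OF refl])
        fix x assume x: "x \<in> carrier S"
        let ?f = "\<lambda>T. conj_map S (inv x) ` T"
        note act = acts_F_class[OF R]
        have bij: "bij_betw ?f ?C ?C"
        proof (rule bij_betw_byWitness[where f' = "\<lambda>T. conj_map S x ` T"])
          show "\<forall>T\<in>?C. conj_map S x ` ?f T = T" "\<forall>T\<in>?C. ?f (conj_map S x ` T) = T"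
            using acts_inv[OF act x] by simp_all
          show "?f ` ?C \<subseteq> ?C" "(\<lambda>T. conj_map S x ` T) ` ?C \<subseteq> ?C"
            using actsD(1)[OF act] x by (simp_all add: image_subset_iff)
        qed
        have "(\<Sum>T\<in>?C. if ?f T \<subseteq> Q then 1 else 0) = (\<Sum>T\<in>?C. if T \<subseteq> Q then 1 else (0::nat))"
          using sum.reindex_bij_betw[OF bij, of "\<lambda>T. if T \<subseteq> Q then 1 else (0::nat)"] .
        then show "(\<Sum>T\<in>?C. if ?f T \<subseteq> Q then 1 else 0) = h Q"
          using finite_F_class by (simp add: sum.If_cases h_def Int_def)
      qed
      finally show ?thesis by (simp add: order_def)
    qed
    have h_inv: "h Q' = h Q" if Q: "subgroup Q S" and Q': "Q' \<in> F_class S F Q" for Q Q'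
    proof -
      have le: "h Q \<le> h Q'" if Q: "subgroup Q S" and Q': "Q' \<in> F_class S F Q" for Q Q'
      proof -
        obtain \<phi> where \<phi>: "\<phi> \<in> F Q Q'" "\<phi> ` Q = Q'" "subgroup Q' S" by (rule F_classE[OF Q Q'])
        show ?thesis
          unfolding h_def
        proof (rule card_inj_on_le[where f = "\<lambda>T. \<phi> ` T"])
          show "inj_on (\<lambda>T. \<phi> ` T) {T \<in> ?C. T \<subseteq> Q}"
            by (rule inj_onI) (use inj_on_image_eq_iff[OF morphismD(3)[OF Q \<phi>(3,1)]] in auto)
          show "finite {T \<in> ?C. T \<subseteq> Q'}" using finite_F_class by simp
          show "(\<lambda>T. \<phi> ` T) ` {T \<in> ?C. T \<subseteq> Q} \<subseteq> {T \<in> ?C. T \<subseteq> Q'}"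
          proof (rule image_subsetI)
            fix T assume T: "T \<in> {T \<in> ?C. T \<subseteq> Q}"
            then have "\<phi> ` T \<in> F_class S F T"
              using F_class_image[OF Q \<phi>(3,1)] F_class_subgroup by blast
            then have "\<phi> ` T \<in> ?C" using F_class_trans[OF R] T by blast
            then show "\<phi> ` T \<in> {T \<in> ?C. T \<subseteq> Q'}" using T \<phi>(2) by blast
          qed
        qed
      qed
      show ?thesis
        using le[OF Q Q'] le[OF F_class_subgroup[OF Q'] F_class_sym[OF Q Q']] by simp
    qed
    have "(\<Sum>T\<in>?C. mark_p T Y) =
        (\<Sum>T\<in>?C. \<Sum>Q\<in>?Qs. d Q * of_nat (card (transporter S T Q)) / of_nat (order S))"
      using Y(2) F_class_subgroup by (intro sum.cong refl) blast
    also have "\<dots> = (\<Sum>Q\<in>?Qs. \<Sum>T\<in>?C. d Q * of_nat (card (transporter S T Q)) / of_nat (order S))"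
      by (rule sum.swap)
    also have "\<dots> = (\<Sum>Q\<in>?Qs. d Q * of_nat (h Q))"
    proof (rule sum.cong[OF refl])
      fix Q
      have "(\<Sum>T\<in>?C. d Q * of_nat (card (transporter S T Q)) / of_nat (order S)) =
          d Q * of_nat (\<Sum>T\<in>?C. card (transporter S T Q)) / of_nat (order S)"
        by (simp add: sum_divide_distrib[symmetric] sum_distrib_left[symmetric])
      then show "(\<Sum>T\<in>?C. d Q * of_nat (card (transporter S T Q)) / of_nat (order S)) = d Q * of_nat (h Q)"
        unfolding trans_sum using ordS by simp
    qed
    also have "\<dots> = (\<Sum>Q\<in>?Qs. F_average S F (\<lambda>Q. ?m Q * of_nat (h Q)) Q - ?m Q * of_nat (h Q))"
      using h_inv by (intro sum.cong refl) (simp add: F_average_mult_invariant d_def algebra_simps)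
    also have "\<dots> = 0"
    proof -
      have "(\<Sum>Q\<in>?Qs. F_average S F (\<lambda>Q. ?m Q * of_nat (h Q)) Q) = (\<Sum>Q\<in>?Qs. ?m Q * of_nat (h Q))"
        by (rule sum_F_average[OF finQ]) (use F_class_card F_class_subgroup in auto)
      then show ?thesis by (simp add: sum_subtractf)
    qed
    finally show ?thesis by (simp add: F_average_def)
  qed
  have "F_average S F (\<lambda>Q. mark_p Q ?X') R = ?a R" if R: "subgroup R S" for R
  proof -
    have "F_average S F (\<lambda>Q. mark_p Q ?X') R = F_average S F (\<lambda>Q. ?m Q + mark_p Q Y) R"
      by (rule F_average_cong) (rule mX')
    then show ?thesis using avgY[OF R] by (simp add: F_average_add)
  qed
  then show ?thesis using X' inv' by blast
qed

theorem average_of_marks_is_mark_vector: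
  assumes X: "X \<in> carrier (burnside_ring_p p S)"
  shows "\<exists>Y\<in>carrier (burnside_ring_p p S). \<forall>Q. subgroup Q S \<longrightarrow>
    mark_p Q Y = F_average S F (\<lambda>Q. mark_p Q X) Q"
proof -
  have "\<exists>X'\<in>carrier (burnside_ring_p p S).
    (\<forall>R R'. subgroup R S \<longrightarrow> Suc (order S) - k \<le> card R \<longrightarrow> R' \<in> F_class S F R \<longrightarrow> mark_p R' X' = mark_p R X') \<and>
    (\<forall>R. subgroup R S \<longrightarrow> F_average S F (\<lambda>Q. mark_p Q X') R = F_average S F (\<lambda>Q. mark_p Q X) R)" for k
  proof (induction k)
    case 0
    have "\<not> Suc (order S) \<le> card R" if "subgroup R S" for R
      using card_mono[OF finite_carrier subgroup.subset[OF that]] by (simp add: order_def)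
    then show ?case using X by (intro bexI[of _ X]) auto
  next
    case (Suc k)
    then obtain X' where X': "X' \<in> carrier (burnside_ring_p p S)"
      "\<And>R R'. \<lbrakk>subgroup R S; Suc (order S) - k \<le> card R; R' \<in> F_class S F R\<rbrakk> \<Longrightarrow> mark_p R' X' = mark_p R X'"
      "\<And>R. subgroup R S \<Longrightarrow> F_average S F (\<lambda>Q. mark_p Q X') R = F_average S F (\<lambda>Q. mark_p Q X) R"
      by blast
    have "mark_p R' X' = mark_p R X'"
      if "subgroup R S" "Suc (order S) - Suc k < card R" "R' \<in> F_class S F R" for R R'
      using X'(2)[OF that(1) _ that(3)] that(2) by simp
    from stabilize_step[OF X'(1) this]
    show ?case using X'(3) by simp
  qed
  from this[of "Suc (order S)"] obtain X' where X': "X' \<in> carrier (burnside_ring_p p S)"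
      "\<And>R R'. \<lbrakk>subgroup R S; R' \<in> F_class S F R\<rbrakk> \<Longrightarrow> mark_p R' X' = mark_p R X'"
      "\<And>R. subgroup R S \<Longrightarrow> F_average S F (\<lambda>Q. mark_p Q X') R = F_average S F (\<lambda>Q. mark_p Q X) R"
    by auto
  have "mark_p Q X' = F_average S F (\<lambda>Q. mark_p Q X) Q" if Q: "subgroup Q S" for Q
    using F_average_invariant[OF Q, of "\<lambda>Q. mark_p Q X'"] X'(2)[OF Q] X'(3)[OF Q] by simp
  then show ?thesis using X'(1) by blast
qed

end

section \<open>The projection onto stable elements\<close>

context fusion_system
begin

lemma burnside_ring_F_simps:
  "carrier (burnside_ring_F S p F) = {X \<in> carrier (burnside_ring_p p S). stable S p F X}"
  "add (burnside_ring_F S p F) = add (burnside_ring_p p S)"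
  "mult (burnside_ring_F S p F) = mult (burnside_ring_p p S)"
  "zero (burnside_ring_F S p F) = zero (burnside_ring_p p S)"
  "one (burnside_ring_F S p F) = one (burnside_ring_p p S)"
  by (simp_all add: burnside_ring_F_def)

lemma burnside_ring_F_iff:
  "X \<in> carrier (burnside_ring_F S p F) \<longleftrightarrow> X \<in> carrier (burnside_ring_p p S) \<and>
    (\<forall>P. subgroup P S \<longrightarrow> (\<forall>Q\<in>F_class S F P. mark_p Q X = mark_p P X))"
  using stable_iff by (auto simp: burnside_ring_F_simps)

lemma marked_ring_burnside_ring_F: "marked_ring (burnside_ring_F S p F) {Q. subgroup Q S} mark_p"
proof
  fix X assume X: "X \<in> carrier (burnside_ring_F S p F)"
  then have Xc: "X \<in> carrier (burnside_ring_p p S)" by (simp add: burnside_ring_F_iff)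
  then show "\<exists>Y\<in>carrier (burnside_ring_F S p F). \<forall>Q\<in>{Q. subgroup Q S}. mark_p Q Y = - mark_p Q X"
    using X F_class_subgroup
    by (intro bexI[of _ "\<ominus>\<^bsub>burnside_ring_p p S\<^esub> X"]) (auto simp: burnside_ring_F_iff burnside_p.mark_neg)
next
  fix X Y assume "X \<in> carrier (burnside_ring_F S p F)" "Y \<in> carrier (burnside_ring_F S p F)"
    "\<And>Q. Q \<in> {Q. subgroup Q S} \<Longrightarrow> mark_p Q X = mark_p Q Y"
  then show "X = Y" by (intro burnside_p.mark_eqI) (simp_all add: burnside_ring_F_iff)
qed (use F_class_subgroup in \<open>auto simp: burnside_ring_F_iff burnside_ring_F_simps(2-)
  burnside_p.mark_add burnside_p.mark_mult burnside_p.mark_zero burnside_p.mark_one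
  burnside_p.add_closed burnside_p.mult_closed burnside_p.zero_in burnside_p.one_in\<close>)

sublocale stable: marked_ring "burnside_ring_F S p F" "{Q. subgroup Q S}" mark_p
  by (rule marked_ring_burnside_ring_F)

end

lemma mult_module_simps [simp]:
  "carrier (mult_module R) = carrier R" "add (mult_module R) = add R" "zero (mult_module R) = zero R"
  "smult (mult_module R) = mult R"
  by (simp_all add: mult_module_def)

lemma module_over_subring:
  assumes "cring R" "cring R'" "carrier R' \<subseteq> carrier R"
    "add R' = add R" "mult R' = mult R" "one R' = one R"
  shows "module R' (mult_module R)"
proof -
  interpret R: cring R by (rule assms(1))
  show ?thesis
  proof (rule moduleI)
    show "abelian_group (mult_module R)"
    proof (rule abelian_groupI)
      fix x assume "x \<in> carrier (mult_module R)"
      then show "\<exists>y\<in>carrier (mult_module R). y \<oplus>\<^bsub>mult_module R\<^esub> x = \<zero>\<^bsub>mult_module R\<^esub>"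
        by (intro bexI[of _ "\<ominus>\<^bsub>R\<^esub> x"]) (auto simp: R.l_neg)
    qed (auto simp: R.a_ac)
  qed (use assms in \<open>auto simp: R.l_distr R.r_distr R.m_assoc subset_iff\<close>)
qed

theorem theorem1:
  fixes S :: "('a, 'b) monoid_scheme" and p :: nat and F :: "'a homs"
  assumes "saturated_fusion_system S p F"
  shows "\<exists>\<pi>.
    (\<forall>X\<in>carrier (burnside_ring_p p S).
      \<pi> X \<in> carrier (burnside_ring_F S p F) \<and>
      (\<forall>Y\<in>carrier (burnside_ring_p p S). Y = \<pi> X \<longleftrightarrow>
        (\<forall>Q. subgroup Q S \<longrightarrow>
          mark_p Q Y = 1 / of_nat (card (F_class S F Q)) * (\<Sum>Q'\<in>F_class S F Q. mark_p Q' X)))) \<and>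
    module_homomorphism (burnside_ring_F S p F)
      (mult_module (burnside_ring_p p S)) (mult_module (burnside_ring_F S p F)) \<pi> \<and>
    (\<forall>X\<in>carrier (burnside_ring_F S p F). \<pi> X = X)"
proof -
  interpret saturated_fusion_system S p F by (rule assms)
  let ?A = "burnside_ring_p p S" and ?AF = "burnside_ring_F S p F"
  have "\<forall>X\<in>carrier ?A. \<exists>Y. Y \<in> carrier ?A \<and>
      (\<forall>Q. subgroup Q S \<longrightarrow> mark_p Q Y = F_average S F (\<lambda>Q. mark_p Q X) Q)"
    using average_of_marks_is_mark_vector by blast
  then obtain \<pi> where "\<forall>X\<in>carrier ?A. \<pi> X \<in> carrier ?A \<and>
      (\<forall>Q. subgroup Q S \<longrightarrow> mark_p Q (\<pi> X) = F_average S F (\<lambda>Q. mark_p Q X) Q)"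
    unfolding bchoice_iff by blast
  then have \<pi>A: "\<pi> X \<in> carrier ?A"
    and mark_\<pi>: "subgroup Q S \<Longrightarrow> mark_p Q (\<pi> X) = F_average S F (\<lambda>Q. mark_p Q X) Q"
    if "X \<in> carrier ?A" for X Q
    using that by auto
  have unique: "Y = \<pi> X \<longleftrightarrow> (\<forall>Q. subgroup Q S \<longrightarrow> mark_p Q Y = F_average S F (\<lambda>Q. mark_p Q X) Q)"
    if "X \<in> carrier ?A" "Y \<in> carrier ?A" for X Y
    using mark_\<pi>[OF that(1)] burnside_p.mark_eqI[OF that(2) \<pi>A[OF that(1)]] by auto
  have AF_A: "X \<in> carrier ?A" and AF_inv: "\<lbrakk>subgroup Q S; Q' \<in> F_class S F Q\<rbrakk> \<Longrightarrow> mark_p Q' X = mark_p Q X"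
    if "X \<in> carrier ?AF" for X Q Q'
    using that by (auto simp: burnside_ring_F_iff)
  have \<pi>AF: "\<pi> X \<in> carrier ?AF" if X: "X \<in> carrier ?A" for X
    using \<pi>A[OF X] mark_\<pi>[OF X] F_average_class F_class_subgroup by (auto simp: burnside_ring_F_iff)
  have hom: "module_homomorphism ?AF (mult_module ?A) (mult_module ?AF) \<pi>"
  proof (intro module_homomorphism.intro module_homomorphism_axioms.intro)
    show "module ?AF (mult_module ?A)"
      by (rule module_over_subring[OF burnside_p.cring stable.cring])
         (auto simp: burnside_ring_F_simps)
    show "module ?AF (mult_module ?AF)"
      by (rule module_over_subring[OF stable.cring stable.cring]) auto
    show "\<pi> X \<in> carrier (mult_module ?AF)" if "X \<in> carrier (mult_module ?A)" for X
      using \<pi>AF that by simp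
    show "\<pi> (X \<oplus>\<^bsub>mult_module ?A\<^esub> Y) = \<pi> X \<oplus>\<^bsub>mult_module ?AF\<^esub> \<pi> Y"
      if "X \<in> carrier (mult_module ?A)" "Y \<in> carrier (mult_module ?A)" for X Y
    proof -
      have XY: "X \<in> carrier ?A" "Y \<in> carrier ?A" using that by auto
      have "mark_p Q (\<pi> X \<oplus>\<^bsub>?A\<^esub> \<pi> Y) = F_average S F (\<lambda>Q. mark_p Q (X \<oplus>\<^bsub>?A\<^esub> Y)) Q"
        if Q: "subgroup Q S" for Q
      proof -
        have "F_average S F (\<lambda>Q. mark_p Q (X \<oplus>\<^bsub>?A\<^esub> Y)) Q = F_average S F (\<lambda>Q. mark_p Q X + mark_p Q Y) Q"
          by (rule F_average_cong) (use XY burnside_p.mark_add in auto)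
        then show ?thesis
          using XY Q by (simp add: F_average_add burnside_p.mark_add \<pi>A mark_\<pi>)
      qed
      then have "\<pi> X \<oplus>\<^bsub>?A\<^esub> \<pi> Y = \<pi> (X \<oplus>\<^bsub>?A\<^esub> Y)"
        using unique burnside_p.add_closed XY \<pi>A by blast
      then show ?thesis by (simp add: burnside_ring_F_simps)
    qed
    show "\<pi> (R \<odot>\<^bsub>mult_module ?A\<^esub> X) = R \<odot>\<^bsub>mult_module ?AF\<^esub> \<pi> X"
      if R: "R \<in> carrier ?AF" and "X \<in> carrier (mult_module ?A)" for R X
    proof -
      have X: "X \<in> carrier ?A" using that by auto
      have "mark_p Q (R \<otimes>\<^bsub>?A\<^esub> \<pi> X) = F_average S F (\<lambda>Q. mark_p Q (R \<otimes>\<^bsub>?A\<^esub> X)) Q"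
        if Q: "subgroup Q S" for Q
      proof -
        have "F_average S F (\<lambda>Q. mark_p Q (R \<otimes>\<^bsub>?A\<^esub> X)) Q = F_average S F (\<lambda>Q. mark_p Q X * mark_p Q R) Q"
          by (rule F_average_cong) (use AF_A[OF R] X burnside_p.mark_mult in auto)
        then show ?thesis
          using X Q AF_A[OF R] F_average_mult_invariant[where g = "\<lambda>Q. mark_p Q R", OF AF_inv[OF R Q]]
          by (simp add: burnside_p.mark_mult \<pi>A mark_\<pi>)
      qed
      then have "R \<otimes>\<^bsub>?A\<^esub> \<pi> X = \<pi> (R \<otimes>\<^bsub>?A\<^esub> X)"
        using unique burnside_p.mult_closed X AF_A[OF R] \<pi>A by blast
      then show ?thesis by (simp add: burnside_ring_F_simps)
    qed
  qed
  have id: "\<pi> X = X" if X: "X \<in> carrier ?AF" for X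
  proof -
    have "F_average S F (\<lambda>Q. mark_p Q X) Q = mark_p Q X" if Q: "subgroup Q S" for Q
      using F_average_invariant[OF Q, where f = "\<lambda>Q. mark_p Q X"] AF_inv[OF X Q] by simp
    then show ?thesis using unique[OF AF_A[OF X] AF_A[OF X]] by simp
  qed
  show ?thesis
  proof (intro exI[of _ \<pi>] conjI ballI)
    show "\<pi> X \<in> carrier ?AF" if "X \<in> carrier ?A" for X by (rule \<pi>AF[OF that])
    show "Y = \<pi> X \<longleftrightarrow> (\<forall>Q. subgroup Q S \<longrightarrow>
        mark_p Q Y = 1 / of_nat (card (F_class S F Q)) * (\<Sum>Q'\<in>F_class S F Q. mark_p Q' X))"
      if "X \<in> carrier ?A" "Y \<in> carrier ?A" for X Y
      using unique[OF that] unfolding F_average_def .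
  qed (use hom id in auto)
qed

end
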